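(* Let $X$ be a $\Delta^{\rm ss}_2$ set and $\kappa\in{}^*\mathrm{Card}$ with $\kappa\notin\mathrm{spv}(X)\cup\mathrm{spn}(X)$. Then $\kappa\in{}^*\mathbb N$ and ${}^*\mathrm{Card}\setminus(\mathrm{spv}(X)\cup\mathrm{spn}(X))\subseteq\mathrm{gal}(\kappa)$. Consequently, if $X$ is $\Delta^{\rm ss}_2$ and ${}^*\mathbb N\subseteq\mathrm{spn}(X)$, then $\mathrm{spn}(X)\cup\mathrm{spv}(X)={}^*\mathrm{Card}$.
   Context: Work in Hrbacek set theory HST, in the language with $\in$ and a standardness predicate $\mathrm{st}$; its universe contains the standard sets $\mathbb S$, the internal sets $\mathbb I=\{y:\exists^{\mathrm{st}}x\,(y\in x)\}$ (transitive, satisfying ZFC, elementary extension of $\mathbb S$) and the well-founded sets $\mathbb V$, isomorphic to $\mathbb S$; the universe is the von Neumann superstructure over $\mathbb I$. $\mathbb N\subseteq{}^*\mathbb N$ are the natural and internal natural numbers, ${}^*\mathrm{Card}\supseteq{}^*\mathbb N$ the internal cardinals, $\#x$ the internal cardinality of internal $x$. $\Delta^{\rm ss}_2$ sets are those representable both as $\bigcup_{a\in A}\bigcap_{b\in B}X_{ab}$ and as $\bigcap_{a\in A}\bigcup_{b\in B}X_{ab}$ with $A,B\in\mathbb V$ and $X_{ab}$ internal. $\mathrm{spn}(X)=\{\#y:y\in\mathbb I,\ y\subseteq X\}$, $\mathrm{spv}(X)=\{\#y:y\in\mathbb I,\ X\subseteq y\}$. For $\kappa\in{}^*\mathbb N$,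 the multiplicative galaxy is $\mathrm{gal}(\kappa)=\kappa\mathbb N\setminus\kappa/\mathbb N$, where $\kappa\mathbb N=\{\lambda\in{}^*\mathbb N:\exists n\in\mathbb N\,(\lambda<n\kappa)\}$ and $\kappa/\mathbb N=\{\lambda\in{}^*\mathbb N:\forall n\in\mathbb N\,(\lambda<\kappa/n)\}$. *)

theory Defs
  imports Main
begin

text \<open>
  A universe of Hrbacek set theory is given semantically: a type of sets with a membership
  relation and a standardness predicate which satisfy the HST axioms (predicate \<open>HST\<close> below).
  Schemata range over first-order formulas of the language with membership and standardness, so
  Separation and Collection are only available for definable (with parameters) properties.
\<close>

datatype fm =
    FMem nat nat
  | FEq nat nat
  | FSt nat
  | FNeg fm
  | FConj fm fm
  | FForall nat fm

primrec in_formula :: "fm \<Rightarrow> bool" where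
  "in_formula (FMem i j) \<longleftrightarrow> True"
| "in_formula (FEq i j) \<longleftrightarrow> True"
| "in_formula (FSt i) \<longleftrightarrow> False"
| "in_formula (FNeg p) \<longleftrightarrow> in_formula p"
| "in_formula (FConj p q) \<longleftrightarrow> in_formula p \<and> in_formula q"
| "in_formula (FForall i p) \<longleftrightarrow> in_formula p"

text \<open>
  Satisfaction of a formula with all quantifiers relativized to the class \<open>M\<close>. In particular
  \<open>M\<close> being the class of standard (internal) sets gives the superscript st (int) of a formula.
\<close>

primrec sat ::
  "('u \<Rightarrow> 'u \<Rightarrow> bool) \<Rightarrow> ('u \<Rightarrow> bool) \<Rightarrow> 'u set \<Rightarrow> fm \<Rightarrow> (nat \<Rightarrow> 'u) \<Rightarrow> bool" where
  "sat mem st M (FMem i j) e \<longleftrightarrow> mem (e i) (e j)"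
| "sat mem st M (FEq i j) e \<longleftrightarrow> e i = e j"
| "sat mem st M (FSt i) e \<longleftrightarrow> st (e i)"
| "sat mem st M (FNeg p) e \<longleftrightarrow> \<not> sat mem st M p e"
| "sat mem st M (FConj p q) e \<longleftrightarrow> sat mem st M p e \<and> sat mem st M q e"
| "sat mem st M (FForall i p) e \<longleftrightarrow> (\<forall>x\<in>M. sat mem st M p (e(i := x)))"

context
  fixes mem :: "'u \<Rightarrow> 'u \<Rightarrow> bool"  (infix "\<epsilon>" 50)
    and st :: "'u \<Rightarrow> bool"
begin

section \<open>Set-theoretic notions relativized to a class \<open>M\<close>\<close>

definition nonempty_in :: "'u set \<Rightarrow> 'u \<Rightarrow> bool" where
  "nonempty_in M a \<longleftrightarrow> (\<exists>x\<in>M. x \<epsilon> a)"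

definition subset_in :: "'u set \<Rightarrow> 'u \<Rightarrow> 'u \<Rightarrow> bool" where
  "subset_in M a b \<longleftrightarrow> (\<forall>x\<in>M. x \<epsilon> a \<longrightarrow> x \<epsilon> b)"

definition transitive_in :: "'u set \<Rightarrow> 'u \<Rightarrow> bool" where
  "transitive_in M a \<longleftrightarrow> (\<forall>x\<in>M. x \<epsilon> a \<longrightarrow> subset_in M x a)"

definition wellfounded_on_in :: "'u set \<Rightarrow> 'u \<Rightarrow> bool" where
  "wellfounded_on_in M a \<longleftrightarrow>
    (\<forall>u\<in>M. subset_in M u a \<and> nonempty_in M u \<longrightarrow>
      (\<exists>x\<in>M. x \<epsilon> u \<and> \<not> (\<exists>y\<in>M. y \<epsilon> u \<and> y \<epsilon> x)))"

definition is_upair_in :: "'u set \<Rightarrow> 'u \<Rightarrow> 'u \<Rightarrow> 'u \<Rightarrow> bool" where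
  "is_upair_in M a b p \<longleftrightarrow> (\<forall>x\<in>M. x \<epsilon> p \<longleftrightarrow> x = a \<or> x = b)"

definition is_pair_in :: "'u set \<Rightarrow> 'u \<Rightarrow> 'u \<Rightarrow> 'u \<Rightarrow> bool" where
  "is_pair_in M a b p \<longleftrightarrow>
    (\<exists>u\<in>M. \<exists>v\<in>M. is_upair_in M a a u \<and> is_upair_in M a b v \<and> is_upair_in M u v p)"

definition related_in :: "'u set \<Rightarrow> 'u \<Rightarrow> 'u \<Rightarrow> 'u \<Rightarrow> bool" where
  "related_in M r x y \<longleftrightarrow> (\<exists>p\<in>M. is_pair_in M x y p \<and> p \<epsilon> r)"

definition is_function_in :: "'u set \<Rightarrow> 'u \<Rightarrow> bool" where
  "is_function_in M f \<longleftrightarrow>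
    (\<forall>p\<in>M. p \<epsilon> f \<longrightarrow> (\<exists>x\<in>M. \<exists>y\<in>M. is_pair_in M x y p)) \<and>
    (\<forall>x\<in>M. \<forall>y\<in>M. \<forall>z\<in>M. related_in M f x y \<and> related_in M f x z \<longrightarrow> y = z)"

definition is_bijection_in :: "'u set \<Rightarrow> 'u \<Rightarrow> 'u \<Rightarrow> 'u \<Rightarrow> bool" where
  "is_bijection_in M f a b \<longleftrightarrow>
    is_function_in M f \<and>
    (\<forall>x\<in>M. \<forall>y\<in>M. related_in M f x y \<longrightarrow> x \<epsilon> a \<and> y \<epsilon> b) \<and>
    (\<forall>x\<in>M. x \<epsilon> a \<longrightarrow> (\<exists>y\<in>M. related_in M f x y)) \<and>
    (\<forall>y\<in>M. y \<epsilon> b \<longrightarrow> (\<exists>!x. x \<in> M \<and> related_in M f x y))"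

definition equinumerous_in :: "'u set \<Rightarrow> 'u \<Rightarrow> 'u \<Rightarrow> bool" where
  "equinumerous_in M a b \<longleftrightarrow> (\<exists>f\<in>M. is_bijection_in M f a b)"

definition is_ordinal_in :: "'u set \<Rightarrow> 'u \<Rightarrow> bool" where
  "is_ordinal_in M a \<longleftrightarrow>
    transitive_in M a \<and> wellfounded_on_in M a \<and>
    (\<forall>x\<in>M. \<forall>y\<in>M. x \<epsilon> a \<and> y \<epsilon> a \<longrightarrow> x \<epsilon> y \<or> x = y \<or> y \<epsilon> x)"

definition is_cardinal_in :: "'u set \<Rightarrow> 'u \<Rightarrow> bool" where
  "is_cardinal_in M k \<longleftrightarrow>
    is_ordinal_in M k \<and> (\<forall>a\<in>M. a \<epsilon> k \<longrightarrow> \<not> equinumerous_in M a k)"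

definition card_in :: "'u set \<Rightarrow> 'u \<Rightarrow> 'u" where
  "card_in M a = (THE k. k \<in> M \<and> is_cardinal_in M k \<and> equinumerous_in M a k)"

definition product_in :: "'u set \<Rightarrow> 'u \<Rightarrow> 'u \<Rightarrow> 'u" where
  "product_in M a b = (THE q. q \<in> M \<and>
    (\<forall>p\<in>M. p \<epsilon> q \<longleftrightarrow> (\<exists>x\<in>M. \<exists>y\<in>M. x \<epsilon> a \<and> y \<epsilon> b \<and> is_pair_in M x y p)))"

definition is_succ_in :: "'u set \<Rightarrow> 'u \<Rightarrow> 'u \<Rightarrow> bool" where
  "is_succ_in M x y \<longleftrightarrow> (\<forall>z\<in>M. z \<epsilon> y \<longleftrightarrow> z \<epsilon> x \<or> z = x)"

definition inductive_in :: "'u set \<Rightarrow> 'u \<Rightarrow> bool" where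
  "inductive_in M w \<longleftrightarrow>
    (\<exists>z\<in>M. \<not> nonempty_in M z \<and> z \<epsilon> w) \<and>
    (\<forall>x\<in>M. x \<epsilon> w \<longrightarrow> (\<exists>y\<in>M. is_succ_in M x y \<and> y \<epsilon> w))"

text \<open>The members of the least inductive set in the sense of \<open>M\<close>.\<close>

definition naturals_in :: "'u set \<Rightarrow> 'u set" where
  "naturals_in M = {x \<in> M. \<forall>w\<in>M. inductive_in M w \<longrightarrow> x \<epsilon> w}"

section \<open>ZFC axioms relativized to a class \<open>M\<close>\<close>

definition extensionality_in :: "'u set \<Rightarrow> bool" where
  "extensionality_in M \<longleftrightarrow> (\<forall>a\<in>M. \<forall>b\<in>M. (\<forall>x\<in>M. x \<epsilon> a \<longleftrightarrow> x \<epsilon> b) \<longrightarrow> a = b)"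

definition pairing_in :: "'u set \<Rightarrow> bool" where
  "pairing_in M \<longleftrightarrow> (\<forall>a\<in>M. \<forall>b\<in>M. \<exists>p\<in>M. is_upair_in M a b p)"

definition union_in :: "'u set \<Rightarrow> bool" where
  "union_in M \<longleftrightarrow> (\<forall>a\<in>M. \<exists>b\<in>M. \<forall>x\<in>M. x \<epsilon> b \<longleftrightarrow> (\<exists>y\<in>M. y \<epsilon> a \<and> x \<epsilon> y))"

definition infinity_in :: "'u set \<Rightarrow> bool" where
  "infinity_in M \<longleftrightarrow> (\<exists>w\<in>M. inductive_in M w)"

definition power_in :: "'u set \<Rightarrow> bool" where
  "power_in M \<longleftrightarrow> (\<forall>a\<in>M. \<exists>b\<in>M. \<forall>x\<in>M. x \<epsilon> b \<longleftrightarrow> subset_in M x a)"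

definition regularity_in :: "'u set \<Rightarrow> bool" where
  "regularity_in M \<longleftrightarrow>
    (\<forall>a\<in>M. nonempty_in M a \<longrightarrow> (\<exists>x\<in>M. x \<epsilon> a \<and> \<not> (\<exists>y\<in>M. y \<epsilon> x \<and> y \<epsilon> a)))"

definition has_choice_in :: "'u set \<Rightarrow> 'u \<Rightarrow> bool" where
  "has_choice_in M a \<longleftrightarrow>
    (\<forall>x\<in>M. x \<epsilon> a \<longrightarrow> nonempty_in M x) \<longrightarrow>
    (\<exists>f\<in>M. is_function_in M f \<and> (\<forall>x\<in>M. x \<epsilon> a \<longrightarrow> (\<exists>y\<in>M. y \<epsilon> x \<and> related_in M f x y)))"

text \<open>In the two schemata the formula ranges over the class \<open>L\<close>, and the assignment \<open>e\<close>
  supplies the parameters.\<close>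

definition separation_in :: "fm set \<Rightarrow> 'u set \<Rightarrow> bool" where
  "separation_in L M \<longleftrightarrow>
    (\<forall>p\<in>L. \<forall>e. range e \<subseteq> M \<longrightarrow>
      (\<forall>a\<in>M. \<exists>b\<in>M. \<forall>x\<in>M. x \<epsilon> b \<longleftrightarrow> x \<epsilon> a \<and> sat (\<epsilon>) st M p (e(0 := x))))"

definition collection_in :: "fm set \<Rightarrow> 'u set \<Rightarrow> bool" where
  "collection_in L M \<longleftrightarrow>
    (\<forall>p\<in>L. \<forall>e. range e \<subseteq> M \<longrightarrow>
      (\<forall>a\<in>M. \<exists>b\<in>M. \<forall>x\<in>M. x \<epsilon> a \<longrightarrow>
        (\<exists>y\<in>M. sat (\<epsilon>) st M p (e(0 := x, 1 := y))) \<longrightarrow>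
        (\<exists>y\<in>M. y \<epsilon> b \<and> sat (\<epsilon>) st M p (e(0 := x, 1 := y)))))"

definition ZFC_in :: "'u set \<Rightarrow> bool" where
  "ZFC_in M \<longleftrightarrow>
    extensionality_in M \<and> pairing_in M \<and> union_in M \<and> infinity_in M \<and> power_in M \<and>
    regularity_in M \<and> (\<forall>a\<in>M. has_choice_in M a) \<and>
    separation_in {p. in_formula p} M \<and> collection_in {p. in_formula p} M"

section \<open>Hrbacek set theory\<close>

definition Standard :: "'u set" where
  "Standard = {x. st x}"

definition Internal :: "'u set" where
  "Internal = {y. \<exists>x. st x \<and> y \<epsilon> x}"

definition WellFounded :: "'u set" where
  "WellFounded =
    {x. \<exists>t. subset_in UNIV x t \<and> transitive_in UNIV t \<and> wellfounded_on_in UNIV t}"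

definition NN :: "'u set" where
  "NN = naturals_in UNIV"

text \<open>A set is of standard size if it is the image of the set of standard elements of a
  standard set.\<close>

definition standard_size :: "'u \<Rightarrow> bool" where
  "standard_size X \<longleftrightarrow>
    (\<exists>a f. st a \<and> is_function_in UNIV f \<and>
      (\<forall>y. y \<epsilon> X \<longleftrightarrow> (\<exists>x. st x \<and> x \<epsilon> a \<and> related_in UNIV f x y)))"

definition transfer :: bool where
  "transfer \<longleftrightarrow>
    (\<forall>p e. in_formula p \<and> range e \<subseteq> Standard \<longrightarrow>
      (sat (\<epsilon>) st Standard p e \<longleftrightarrow> sat (\<epsilon>) st Internal p e))"

definition internal_transitivity :: bool where
  "internal_transitivity \<longleftrightarrow> (\<forall>x\<in>Internal. \<forall>y. y \<epsilon> x \<longrightarrow> y \<in> Internal)"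

definition regularity_over_internal :: bool where
  "regularity_over_internal \<longleftrightarrow>
    (\<forall>X. nonempty_in UNIV X \<longrightarrow> (\<exists>x. x \<epsilon> X \<and> (\<forall>y. y \<epsilon> x \<and> y \<epsilon> X \<longrightarrow> y \<in> Internal)))"

definition standardization :: bool where
  "standardization \<longleftrightarrow> (\<forall>X. \<exists>Y. st Y \<and> (\<forall>x. st x \<longrightarrow> (x \<epsilon> X \<longleftrightarrow> x \<epsilon> Y)))"

definition saturation :: bool where
  "saturation \<longleftrightarrow>
    (\<forall>F. standard_size F \<and>
      (\<forall>X. X \<epsilon> F \<longrightarrow> X \<in> Internal \<and> nonempty_in UNIV X) \<and>
      (\<forall>X Y. X \<epsilon> F \<and> Y \<epsilon> F \<longrightarrow> (\<exists>Z. Z \<epsilon> F \<and> (\<forall>x. x \<epsilon> Z \<longleftrightarrow> x \<epsilon> X \<and> x \<epsilon> Y))) \<longrightarrow>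
      (\<exists>x. \<forall>X. X \<epsilon> F \<longrightarrow> x \<epsilon> X))"

definition standard_size_choice :: bool where
  "standard_size_choice \<longleftrightarrow> (\<forall>a. standard_size a \<longrightarrow> has_choice_in UNIV a)"

definition dependent_choice :: bool where
  "dependent_choice \<longleftrightarrow>
    (\<forall>a r. nonempty_in UNIV a \<and>
      (\<forall>x. x \<epsilon> a \<longrightarrow> (\<exists>y. y \<epsilon> a \<and> related_in UNIV r x y)) \<longrightarrow>
      (\<exists>f. is_function_in UNIV f \<and>
        (\<forall>n\<in>NN. \<exists>x. x \<epsilon> a \<and> related_in UNIV f n x) \<and>
        (\<forall>n\<in>NN. \<forall>m x y. is_succ_in UNIV n m \<and> related_in UNIV f n x \<and> related_in UNIV f m y
          \<longrightarrow> related_in UNIV r x y)))"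

definition HST :: bool where
  "HST \<longleftrightarrow>
    extensionality_in UNIV \<and> pairing_in UNIV \<and> union_in UNIV \<and> infinity_in UNIV \<and>
    separation_in UNIV UNIV \<and> collection_in UNIV UNIV \<and>
    ZFC_in Standard \<and> transfer \<and> internal_transitivity \<and> regularity_over_internal \<and>
    standardization \<and> saturation \<and> standard_size_choice \<and> dependent_choice"

section \<open>Delta-ss-2 sets, spectra and galaxies\<close>

text \<open>The family \<open>F\<close> is a set of the HST universe: a function on the product of \<open>A\<close> and \<open>B\<close>
  with internal values.\<close>

definition family_member :: "'u \<Rightarrow> 'u \<Rightarrow> 'u \<Rightarrow> 'u \<Rightarrow> bool" where
  "family_member F a b Y \<longleftrightarrow> (\<exists>p. is_pair_in UNIV a b p \<and> related_in UNIV F p Y)"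

definition internal_family :: "'u \<Rightarrow> 'u \<Rightarrow> 'u \<Rightarrow> bool" where
  "internal_family F A B \<longleftrightarrow>
    is_function_in UNIV F \<and>
    (\<forall>a b. a \<epsilon> A \<and> b \<epsilon> B \<longrightarrow> (\<exists>Y\<in>Internal. family_member F a b Y))"

text \<open>No convention for intersections over an empty index set is needed: it would be the whole
  universe, which is not the extension of any \<open>X\<close>.\<close>

definition Sigma_ss_2 :: "'u \<Rightarrow> bool" where
  "Sigma_ss_2 X \<longleftrightarrow>
    (\<exists>A\<in>WellFounded. \<exists>B\<in>WellFounded. \<exists>F. internal_family F A B \<and>
      (\<forall>x. x \<epsilon> X \<longleftrightarrow> (\<exists>a. a \<epsilon> A \<and> (\<forall>b. b \<epsilon> B \<longrightarrow> (\<exists>Y. family_member F a b Y \<and> x \<epsilon> Y)))))"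

definition Pi_ss_2 :: "'u \<Rightarrow> bool" where
  "Pi_ss_2 X \<longleftrightarrow>
    (\<exists>A\<in>WellFounded. \<exists>B\<in>WellFounded. \<exists>F. internal_family F A B \<and>
      (\<forall>x. x \<epsilon> X \<longleftrightarrow> (\<forall>a. a \<epsilon> A \<longrightarrow> (\<exists>b. b \<epsilon> B \<and> (\<exists>Y. family_member F a b Y \<and> x \<epsilon> Y)))))"

definition Delta_ss_2 :: "'u \<Rightarrow> bool" where
  "Delta_ss_2 X \<longleftrightarrow> Sigma_ss_2 X \<and> Pi_ss_2 X"

definition star_NN :: "'u set" where
  "star_NN = naturals_in Internal"

definition star_Card :: "'u set" where
  "star_Card = {k \<in> Internal. is_cardinal_in Internal k}"

definition spn :: "'u \<Rightarrow> 'u set" where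
  "spn X = {card_in Internal y | y. y \<in> Internal \<and> subset_in UNIV y X}"

definition spv :: "'u \<Rightarrow> 'u set" where
  "spv X = {card_in Internal y | y. y \<in> Internal \<and> subset_in UNIV X y}"

text \<open>Internal multiplication, as multiplication of internal cardinals. The order of (internal)
  cardinals is membership.\<close>

definition star_times :: "'u \<Rightarrow> 'u \<Rightarrow> 'u" where
  "star_times m k = card_in Internal (product_in Internal m k)"

definition mult_NN :: "'u \<Rightarrow> 'u set" where
  "mult_NN k = {l \<in> star_NN. \<exists>n\<in>NN. l \<epsilon> star_times n k}"

text \<open>The condition \<open>l < k / n\<close> for nonzero \<open>n\<close> is written without quotients as \<open>n l < k\<close>.\<close>

definition div_NN :: "'u \<Rightarrow> 'u set" where
  "div_NN k = {l \<in> star_NN. \<forall>n\<in>NN. nonempty_in UNIV n \<longrightarrow> star_times n l \<epsilon> k}"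

definition gal :: "'u \<Rightarrow> 'u set" where
  "gal k = mult_NN k - div_NN k"

end

end

theory Submission
  imports Defs
begin

text \<open>
  Only a \<open>\<Sigma>\<close>-representation \<open>X = (\<Union>a\<in>A. P a)\<close>, \<open>P a = (\<Inter>b\<in>B. X a b)\<close>, is needed. Let \<open>\<kappa> \<notin> spn X\<close>, so
  that no \<open>P a\<close> has an internal subset of size \<open>\<kappa>\<close>. By Saturation \<open>P a\<close> is contained in a finite
  intersection \<open>Z a\<close> of sets \<open>X a b\<close> that has no such subset either. If \<open>\<lambda>\<close> is not below any
  multiple \<open>n \<kappa>\<close> with \<open>n \<in> \<nat>\<close>, then finite unions of sets \<open>Z a\<close> have size at most \<open>\<lambda>\<close>, and
  Saturation yields an internal set of size \<open>\<lambda>\<close> that contains all of them, whence \<open>\<lambda> \<in> spv X\<close>.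
  Thus two cardinals of the gap lie below finite multiples of each other, and each one lies below a
  finite multiple of itself. As \<open>n \<kappa> = \<kappa>\<close> for infinite \<open>\<kappa>\<close>, both are internal natural numbers.

  Saturation applies to families indexed by well-founded sets since these are of standard size. The
  cardinal arithmetic is that of ZFC and is carried out in an arbitrary class model, where sets and
  relations of HOL that are coded by elements of the model replace its own sets and functions.
\<close>

section \<open>Definable predicates\<close>

text \<open>Since HST grants Separation and Collection for formulas only, every set formed below and
  every induction carries a proof of definability. The delicate notion is finiteness. The index sets
  are standard, so their finite subsets are those of the standard universe, whereas the count
  \<open>n\<close> in \<open>n \<kappa>\<close> has to be a true natural number. The two fit because
  Standardization replaces an external property by a standard family with the same standard members;
  hence induction over the finite subsets of a standard set is valid for external properties too.
  Saturation yields \<open>Z a\<close> as follows. If each finite intersection of sets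
  \<open>X a b\<close> had an internal subset of size \<kappa>, the internal sets of those
  \<open>y\<close> of size \<kappa> with \<open>y \<subseteq> X a b\<close> would have the finite
  intersection property, and a common element would be a subset of \<open>P a\<close>. A set without
  subsets of size \<kappa> has size at most \<kappa>, so a union of \<open>n\<close> sets
  \<open>Z a\<close> has size at most \<open>n \<kappa>\<close>. This is where the multiplicative
  galaxy comes from.\<close>

primrec rename :: "(nat \<Rightarrow> nat) \<Rightarrow> fm \<Rightarrow> fm" where
  "rename f (FMem i j) = FMem (f i) (f j)"
| "rename f (FEq i j) = FEq (f i) (f j)"
| "rename f (FSt i) = FSt (f i)"
| "rename f (FNeg p) = FNeg (rename f p)"
| "rename f (FConj p q) = FConj (rename f p) (rename f q)"
| "rename f (FForall i p) = FForall (f i) (rename f p)"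

text \<open>Bound variables count as well, so every variable from \<open>var_bound p\<close> on is
  fresh for \<open>p\<close>.\<close>

primrec var_bound :: "fm \<Rightarrow> nat" where
  "var_bound (FMem i j) = Suc (max i j)"
| "var_bound (FEq i j) = Suc (max i j)"
| "var_bound (FSt i) = Suc i"
| "var_bound (FNeg p) = var_bound p"
| "var_bound (FConj p q) = max (var_bound p) (var_bound q)"
| "var_bound (FForall i p) = max (Suc i) (var_bound p)"

lemma in_formula_rename [simp]: "in_formula (rename f p) \<longleftrightarrow> in_formula p"
  by (induction p) auto

lemma fun_upd_comp_inj: "inj f \<Longrightarrow> e(f i := x) \<circ> f = (e \<circ> f)(i := x)"
  by (auto simp: fun_eq_iff inj_eq)

text \<open>Bound variables are renamed along with free ones; injectivity of \<open>f\<close> keeps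
  a quantifier from capturing a variable that was distinct from its own.\<close>

lemma sat_rename: "inj f \<Longrightarrow> sat mem st M (rename f p) e = sat mem st M p (e \<circ> f)"
  by (induction p arbitrary: e) (auto simp: fun_upd_comp_inj)

lemma sat_cong:
  "(\<And>n. n < var_bound p \<Longrightarrow> e n = e' n) \<Longrightarrow> sat mem st M p e = sat mem st M p e'"
proof (induction p arbitrary: e e')
  case (FForall i p)
  have "sat mem st M p (e(i := x)) = sat mem st M p (e'(i := x))" for x
    by (rule FForall.IH) (use FForall.prems in auto)
  then show ?case by simp
next
  case (FConj p q)
  have "sat mem st M p e = sat mem st M p e'" "sat mem st M q e = sat mem st M q e'"
    by (rule FConj.IH; use FConj.prems in auto)+
  then show ?case by simp
next
  case (FNeg p)
  have "sat mem st M p e = sat mem st M p e'"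
    by (rule FNeg.IH) (use FNeg.prems in auto)
  then show ?case by simp
qed auto

definition with_params :: "nat \<Rightarrow> (nat \<Rightarrow> 'u) \<Rightarrow> (nat \<Rightarrow> 'u) \<Rightarrow> nat \<Rightarrow> 'u" where
  "with_params k q e = (\<lambda>n. if n < k then q n else e (n - k))"

text \<open>Predicates of a class \<open>M\<close> and of an environment that are expressed, uniformly for all
  \<open>M \<in> MM\<close>, by a formula with parameters relativized to \<open>M\<close>. Environments act as de Bruijn
  contexts: the variable of the innermost quantifier is \<open>e 0\<close>. The flag \<open>full\<close> admits formulas in
  which \<open>st\<close> occurs.\<close>

locale language =
  fixes mem :: "'u \<Rightarrow> 'u \<Rightarrow> bool" (infix "\<epsilon>" 50)
    and st :: "'u \<Rightarrow> bool" and full :: bool and MM :: "'u set set"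
begin

definition expresses :: "fm \<Rightarrow> nat \<Rightarrow> (nat \<Rightarrow> 'u) \<Rightarrow> ('u set \<Rightarrow> (nat \<Rightarrow> 'u) \<Rightarrow> bool) \<Rightarrow> bool" where
  "expresses p k q P \<longleftrightarrow> (full \<or> in_formula p) \<and> (\<forall>i<k. \<forall>M\<in>MM. q i \<in> M) \<and>
    (\<forall>M\<in>MM. \<forall>e. range e \<subseteq> M \<longrightarrow> P M e = sat mem st M p (with_params k q e))"

definition dfn :: "('u set \<Rightarrow> (nat \<Rightarrow> 'u) \<Rightarrow> bool) \<Rightarrow> bool" where
  "dfn P \<longleftrightarrow> (\<exists>p k q. expresses p k q P)"

lemma dfnI:
  assumes "full \<or> in_formula p" "\<And>i M. i < k \<Longrightarrow> M \<in> MM \<Longrightarrow> q i \<in> M"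
    "\<And>M e. M \<in> MM \<Longrightarrow> range e \<subseteq> M \<Longrightarrow> P M e = sat mem st M p (with_params k q e)"
  shows "dfn P"
proof -
  have "expresses p k q P"
    unfolding expresses_def using assms by simp
  then show ?thesis unfolding dfn_def by blast
qed

lemma dfnE:
  assumes "dfn P"
  obtains p k q where "full \<or> in_formula p" "\<And>i M. i < k \<Longrightarrow> M \<in> MM \<Longrightarrow> q i \<in> M"
    "\<And>M e. M \<in> MM \<Longrightarrow> range e \<subseteq> M \<Longrightarrow> P M e = sat mem st M p (with_params k q e)"
proof -
  from assms obtain p k q where "expresses p k q P" unfolding dfn_def by blast
  then show thesis unfolding expresses_def by (intro that) simp_all
qed

text \<open>The language has no function symbols, so terms are variables and parameters that lie in
  every class of \<open>MM\<close>. Values such as pairs and successors enter through rules for the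
  atoms that contain them.\<close>

definition trm :: "((nat \<Rightarrow> 'u) \<Rightarrow> 'u) \<Rightarrow> bool" where
  "trm t \<longleftrightarrow> (\<exists>i. t = (\<lambda>e. e i)) \<or> (\<exists>c. (\<forall>M\<in>MM. c \<in> M) \<and> t = (\<lambda>_. c))"

named_theorems dfn_intros

lemma trm_var [dfn_intros]: "trm (\<lambda>e. e i)"
  by (auto simp: trm_def)

lemma trm_const [dfn_intros]: "(\<And>M. M \<in> MM \<Longrightarrow> c \<in> M) \<Longrightarrow> trm (\<lambda>_. c)"
  unfolding trm_def by blast

lemma trm_shift: "trm t \<Longrightarrow> trm (\<lambda>e. t (\<lambda>n. e (Suc n)))"
  by (auto simp: trm_def)

lemma trm_in: "trm t \<Longrightarrow> M \<in> MM \<Longrightarrow> range e \<subseteq> M \<Longrightarrow> t e \<in> M"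
  by (auto simp: trm_def)

lemma dfn_cong:
  "(\<And>M e. M \<in> MM \<Longrightarrow> range e \<subseteq> M \<Longrightarrow> P M e = Q M e) \<Longrightarrow> dfn P = dfn Q"
  by (auto simp: dfn_def expresses_def)

lemma dfn_const [dfn_intros]: "dfn (\<lambda>_ _. b)"
  by (rule dfnI[of "if b then FEq 0 0 else FNeg (FEq 0 0)" 0]) auto

lemma dfn_neg [dfn_intros]: "dfn P \<Longrightarrow> dfn (\<lambda>M e. \<not> P M e)"
  by (erule dfnE, rule dfnI[of "FNeg _"]) auto

lemma dfn_conj [dfn_intros]:
  assumes "dfn P" "dfn Q" shows "dfn (\<lambda>M e. P M e \<and> Q M e)"
proof -
  from assms(1) obtain p1 k1 q1 where 1: "full \<or> in_formula p1"
    "\<And>i M. i < k1 \<Longrightarrow> M \<in> MM \<Longrightarrow> q1 i \<in> M"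
    "\<And>M e. M \<in> MM \<Longrightarrow> range e \<subseteq> M \<Longrightarrow> P M e = sat mem st M p1 (with_params k1 q1 e)"
    by (rule dfnE) blast
  from assms(2) obtain p2 k2 q2 where 2: "full \<or> in_formula p2"
    "\<And>i M. i < k2 \<Longrightarrow> M \<in> MM \<Longrightarrow> q2 i \<in> M"
    "\<And>M e. M \<in> MM \<Longrightarrow> range e \<subseteq> M \<Longrightarrow> Q M e = sat mem st M p2 (with_params k2 q2 e)"
    by (rule dfnE) blast
  \<comment> \<open>The parameter lists are concatenated: \<open>f1\<close> moves the variables of
    \<open>p1\<close> past the \<open>k2\<close> additional parameters, and \<open>f2\<close> moves
    everything in \<open>p2\<close> behind the \<open>k1\<close> parameters of
    \<open>p1\<close>.\<close>
  define f1 where "f1 n = (if n < k1 then n else n + k2)" for n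
  define f2 where "f2 n = n + k1" for n
  define q where "q n = (if n < k1 then q1 n else q2 (n - k1))" for n
  have f: "inj f1" "inj f2" by (auto simp: inj_def f1_def f2_def)
  have e1: "with_params (k1 + k2) q e \<circ> f1 = with_params k1 q1 e" for e
    by (auto simp: fun_eq_iff with_params_def f1_def q_def)
  have e2: "with_params (k1 + k2) q e \<circ> f2 = with_params k2 q2 e" for e
    by (auto simp: fun_eq_iff with_params_def f2_def q_def)
  show ?thesis
  proof (rule dfnI[of "FConj (rename f1 p1) (rename f2 p2)" "k1 + k2" q])
    show "full \<or> in_formula (FConj (rename f1 p1) (rename f2 p2))"
      using 1(1) 2(1) by auto
    fix i M assume i: "i < k1 + k2" "M \<in> MM"
    show "q i \<in> M"
    proof (cases "i < k1")
      case True
      then show ?thesis using 1(2) i(2) by (simp add: q_def)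
    next
      case False
      then have "i - k1 < k2" using i(1) by linarith
      then show ?thesis using 2(2) i(2) False by (simp add: q_def)
    qed
  next
    fix M and e :: "nat \<Rightarrow> 'u" assume "M \<in> MM" "range e \<subseteq> M"
    note M = this
    show "(P M e \<and> Q M e) =
        sat mem st M (FConj (rename f1 p1) (rename f2 p2)) (with_params (k1 + k2) q e)"
      by (simp add: sat_rename f e1 e2 1(3)[OF M] 2(3)[OF M])
  qed
qed

lemma dfn_all [dfn_intros]:
  assumes "dfn (\<lambda>M e. Q M (e 0) (\<lambda>n. e (Suc n)))"
  shows "dfn (\<lambda>M e. \<forall>x\<in>M. Q M x e)"
proof -
  from assms obtain p k q where 1: "full \<or> in_formula p" "\<And>i M. i < k \<Longrightarrow> M \<in> MM \<Longrightarrow> q i \<in> M"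
    "\<And>M e. M \<in> MM \<Longrightarrow> range e \<subseteq> M \<Longrightarrow>
      Q M (e 0) (\<lambda>n. e (Suc n)) = sat mem st M p (with_params k q e)"
    by (rule dfnE) blast
  define N where "N = max (var_bound p) k"
  \<comment> \<open>A cyclic shift of \<open>k\<close>, ..., \<open>N\<close>. Variable
    \<open>k\<close>, which holds \<open>e 0\<close>, becomes \<open>N\<close> and can be quantified
    there, since no variable of \<open>p\<close> reaches \<open>N\<close>; those in between move
    down by one.\<close>
  define f where "f n = (if n = k then N else if k < n \<and> n \<le> N then n - 1 else n)" for n
  have kN: "k \<le> N" by (simp add: N_def)
  have inj: "inj f"
    using kN unfolding inj_def f_def by auto
  have *: "Q M x e = sat mem st M (rename f p) ((with_params k q e)(N := x))"
    if "M \<in> MM" "range e \<subseteq> M" "x \<in> M" for M x e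
  proof -
    have "case_nat x e n \<in> M" for n
      using that by (cases n) auto
    then have "range (case_nat x e) \<subseteq> M" by blast
    from 1(3)[OF that(1) this]
    have "Q M x e = sat mem st M p (with_params k q (case_nat x e))" by simp
    also have "\<dots> = sat mem st M p ((with_params k q e)(N := x) \<circ> f)"
    proof (rule sat_cong)
      fix n assume "n < var_bound p"
      then have n: "n < N" unfolding N_def by simp
      consider "n < k" | "n = k" | m where "n = Suc m" "k \<le> m"
        by (metis Suc_le_D Suc_leI Suc_le_mono linorder_neqE_nat)
      then show "with_params k q (case_nat x e) n = ((with_params k q e)(N := x) \<circ> f) n"
      proof cases
        case 3
        then have "n - k = Suc (m - k)" by simp
        then show ?thesis using n 3 by (simp add: with_params_def f_def)
      qed (use n in \<open>simp_all add: with_params_def f_def\<close>)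
    qed
    finally show ?thesis by (simp add: sat_rename inj)
  qed
  show ?thesis
    by (rule dfnI[of "FForall N (rename f p)" k q]) (use 1(1,2) in \<open>auto simp: *\<close>)
qed

lemma dfn_disj [dfn_intros]:
  assumes "dfn P" "dfn Q" shows "dfn (\<lambda>M e. P M e \<or> Q M e)"
proof -
  have "dfn (\<lambda>M e. \<not> (\<not> P M e \<and> \<not> Q M e))"
    by (intro dfn_neg dfn_conj assms)
  then show ?thesis by (simp only: de_Morgan_conj not_not)
qed

lemma dfn_imp [dfn_intros]:
  assumes "dfn P" "dfn Q" shows "dfn (\<lambda>M e. P M e \<longrightarrow> Q M e)"
  unfolding imp_conv_disj by (intro dfn_disj dfn_neg assms)

lemma dfn_iff [dfn_intros]:
  assumes "dfn P" "dfn Q" shows "dfn (\<lambda>M e. P M e \<longleftrightarrow> Q M e)"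
  unfolding iff_conv_conj_imp by (intro dfn_conj dfn_imp assms)

lemma dfn_ex [dfn_intros]:
  assumes "dfn (\<lambda>M e. Q M (e 0) (\<lambda>n. e (Suc n)))"
  shows "dfn (\<lambda>M e. \<exists>x\<in>M. Q M x e)"
proof -
  have "dfn (\<lambda>M e. \<not> (\<forall>x\<in>M. \<not> Q M x e))"
    by (intro dfn_neg dfn_all assms)
  then show ?thesis by (simp only: ball_simps not_not)
qed

lemma trm_params:
  assumes "trm t" "trm s"
  obtains k q i j where "\<And>n M. n < k \<Longrightarrow> M \<in> MM \<Longrightarrow> q n \<in> M"
    "\<And>e. t e = with_params k q e i" "\<And>e. s e = with_params k q e j"
proof -
  note thesis = that
  from assms(1) show thesis unfolding trm_def
  proof (elim disjE exE conjE)
    fix i assume t: "t = (\<lambda>e. e i)"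
    from assms(2) show thesis unfolding trm_def
    proof (elim disjE exE conjE)
      fix j assume "s = (\<lambda>e. e j)"
      then show thesis using t by (intro thesis[of 0 undefined i j]) (simp_all add: with_params_def)
    next
      fix d assume "\<forall>M\<in>MM. d \<in> M" "s = (\<lambda>_. d)"
      then show thesis
        using t by (intro thesis[of 1 "\<lambda>_. d" "Suc i" 0]) (simp_all add: with_params_def)
    qed
  next
    fix c assume t: "\<forall>M\<in>MM. c \<in> M" "t = (\<lambda>_. c)"
    from assms(2) show thesis unfolding trm_def
    proof (elim disjE exE conjE)
      fix j assume "s = (\<lambda>e. e j)"
      then show thesis
        using t by (intro thesis[of 1 "\<lambda>_. c" 0 "Suc j"]) (simp_all add: with_params_def)
    next
      fix d assume "\<forall>M\<in>MM. d \<in> M" "s = (\<lambda>_. d)"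
      then show thesis
        using t by (intro thesis[of 2 "\<lambda>n. if n = 0 then c else d" 0 1]) (simp_all add: with_params_def)
    qed
  qed
qed

lemma dfn_mem [dfn_intros]:
  assumes "trm t" "trm s" shows "dfn (\<lambda>_ e. t e \<epsilon> s e)"
proof -
  obtain k q i j where *: "\<And>n M. n < k \<Longrightarrow> M \<in> MM \<Longrightarrow> q n \<in> M"
    "\<And>e. t e = with_params k q e i" "\<And>e. s e = with_params k q e j"
    using assms by (rule trm_params) blast
  show ?thesis
    by (rule dfnI[of "FMem i j" k q]) (simp_all add: *)
qed

lemma dfn_eq [dfn_intros]:
  assumes "trm t" "trm s" shows "dfn (\<lambda>_ e. t e = s e)"
proof -
  obtain k q i j where *: "\<And>n M. n < k \<Longrightarrow> M \<in> MM \<Longrightarrow> q n \<in> M"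
    "\<And>e. t e = with_params k q e i" "\<And>e. s e = with_params k q e j"
    using assms by (rule trm_params) blast
  show ?thesis
    by (rule dfnI[of "FEq i j" k q]) (simp_all add: *)
qed

lemma dfn_st [dfn_intros]:
  assumes full "trm t" shows "dfn (\<lambda>_ e. st (t e))"
proof -
  obtain k q i j where *: "\<And>n M. n < k \<Longrightarrow> M \<in> MM \<Longrightarrow> q n \<in> M"
    "\<And>e. t e = with_params k q e i" "\<And>e. t e = with_params k q e j"
    using assms(2,2) by (rule trm_params) blast
  show ?thesis
    by (rule dfnI[of "FSt i" k q]) (simp_all add: * assms(1))
qed

text \<open>Meant for the schemata, whose instances are given as formulas: this brings such a
  formula, with its variables renumbered, under the rules for quantifiers and connectives.\<close>

lemma dfn_sat:
  assumes "full \<or> in_formula p" "inj f"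
  shows "dfn (\<lambda>M e. sat mem st M p (\<lambda>n. e (f n)))"
  by (rule dfnI[of "rename f p" 0]) (use assms in \<open>auto simp: sat_rename with_params_def comp_def\<close>)

section \<open>Definability of the basic set-theoretic vocabulary\<close>

lemma dfn_subset_in [dfn_intros]:
  "trm t \<Longrightarrow> trm s \<Longrightarrow> dfn (\<lambda>M e. subset_in mem M (t e) (s e))"
  unfolding subset_in_def by (intro dfn_intros trm_shift)

lemma dfn_nonempty_in [dfn_intros]: "trm t \<Longrightarrow> dfn (\<lambda>M e. nonempty_in mem M (t e))"
  unfolding nonempty_in_def by (intro dfn_intros trm_shift)

lemma dfn_is_upair_in [dfn_intros]:
  "trm t \<Longrightarrow> trm s \<Longrightarrow> trm r \<Longrightarrow> dfn (\<lambda>M e. is_upair_in mem M (t e) (s e) (r e))"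
  unfolding is_upair_in_def by (intro dfn_intros trm_shift)

lemma dfn_is_pair_in [dfn_intros]:
  "trm t \<Longrightarrow> trm s \<Longrightarrow> trm r \<Longrightarrow> dfn (\<lambda>M e. is_pair_in mem M (t e) (s e) (r e))"
  unfolding is_pair_in_def by (intro dfn_intros trm_shift)

lemma dfn_related_in [dfn_intros]:
  "trm t \<Longrightarrow> trm s \<Longrightarrow> trm r \<Longrightarrow> dfn (\<lambda>M e. related_in mem M (t e) (s e) (r e))"
  unfolding related_in_def by (intro dfn_intros trm_shift)

lemma dfn_is_function_in [dfn_intros]:
  "trm t \<Longrightarrow> dfn (\<lambda>M e. is_function_in mem M (t e))"
  unfolding is_function_in_def by (intro dfn_intros trm_shift)

lemma dfn_is_succ_in [dfn_intros]:
  "trm t \<Longrightarrow> trm s \<Longrightarrow> dfn (\<lambda>M e. is_succ_in mem M (t e) (s e))"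
  unfolding is_succ_in_def by (intro dfn_intros trm_shift)

lemma dfn_inductive_in [dfn_intros]: "trm t \<Longrightarrow> dfn (\<lambda>M e. inductive_in mem M (t e))"
  unfolding inductive_in_def by (intro dfn_intros trm_shift)

lemma dfn_has_choice_in [dfn_intros]: "trm t \<Longrightarrow> dfn (\<lambda>M e. has_choice_in mem M (t e))"
  unfolding has_choice_in_def by (intro dfn_intros trm_shift)

end

section \<open>Coded sets and relations\<close>

text \<open>Power set, Regularity and Choice are left to \<open>zfc_model\<close>, because the whole
  universe of HST is to be a model of this weaker kind.\<close>

locale base_model = language mem st full "{M}"
  for mem :: "'u \<Rightarrow> 'u \<Rightarrow> bool" (infix "\<epsilon>" 50) and st full and M :: "'u set" +
  assumes extensionality: "extensionality_in mem M"
    and pairing: "pairing_in mem M"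
    and union: "union_in mem M"
    and infinity: "infinity_in mem M"
    and separation: "separation_in mem st {p. full \<or> in_formula p} M"
    and collection: "collection_in mem st {p. full \<or> in_formula p} M"
begin

declare trm_const [dfn_intros del]

lemma trm_const_in [dfn_intros]: "c \<in> M \<Longrightarrow> trm (\<lambda>_. c)"
  by (rule trm_const) simp

lemma trm_in_M: "trm t \<Longrightarrow> range e \<subseteq> M \<Longrightarrow> t e \<in> M"
  by (rule trm_in) simp_all

lemma dfn_single: "dfn P \<Longrightarrow> dfn (\<lambda>_. P M)"
  by (subst dfn_cong[of _ P]) simp_all

lemma dfn_cong1: "(\<And>e. range e \<subseteq> M \<Longrightarrow> P e = Q e) \<Longrightarrow> dfn (\<lambda>_. Q) \<Longrightarrow> dfn (\<lambda>_. P)"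
  by (subst dfn_cong[of _ "\<lambda>_. Q"]) simp_all

lemma dfn_all_M [dfn_intros]:
  "dfn (\<lambda>_ e. Q (e 0) (\<lambda>n. e (Suc n))) \<Longrightarrow> dfn (\<lambda>_ e. \<forall>x\<in>M. Q x e)"
  using dfn_single[OF dfn_all, of "\<lambda>_. Q"] by simp

lemma dfn_ex_M [dfn_intros]:
  "dfn (\<lambda>_ e. Q (e 0) (\<lambda>n. e (Suc n))) \<Longrightarrow> dfn (\<lambda>_ e. \<exists>x\<in>M. Q x e)"
  using dfn_single[OF dfn_ex, of "\<lambda>_. Q"] by simp

text \<open>This is the shape in which \<open>separation_in\<close> and \<open>collection_in\<close>
  take a formula: arguments in the variables 0 and 1, parameters from 2 on. By
  \<open>e 1 = c\<close>, an instance of Separation, which updates variable 0 alone, can be read off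
  too.\<close>

lemma dfn_parameters:
  assumes "dfn (\<lambda>_ e. P (e 0) (e (Suc 0)))" "c \<in> M"
  obtains p e where "full \<or> in_formula p" "range e \<subseteq> M" "e 1 = c"
    "\<And>x y. x \<in> M \<Longrightarrow> y \<in> M \<Longrightarrow> sat mem st M p (e(0 := x, 1 := y)) = P x y"
proof -
  show thesis
  proof (rule dfnE[OF assms(1)])
    fix p k q
    assume p: "full \<or> in_formula p"
      and q: "\<And>i M'. i < k \<Longrightarrow> M' \<in> {M} \<Longrightarrow> q i \<in> M'"
      and P: "\<And>M' e. M' \<in> {M} \<Longrightarrow> range e \<subseteq> M' \<Longrightarrow>
        P (e 0) (e (Suc 0)) = sat mem st M' p (with_params k q e)"
    define f where
      "f n = (if n = k then 0 else if n = k + 1 then 1 else if n < k then n + 2 else n)" for n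
    define e where "e n = (if 2 \<le> n \<and> n < k + 2 then q (n - 2) else c)" for n
    have inj: "inj f"
    proof (rule injI)
      fix m n assume "f m = f n"
      then show "m = n"
        unfolding f_def by (simp split: if_splits)
    qed
    have e: "range e \<subseteq> M"
      using q[of _ M] assms(2) unfolding e_def by auto
    show thesis
    proof (rule that)
      show "full \<or> in_formula (rename f p)" "e 1 = c"
        using p by (simp_all add: e_def)
      fix x y assume xy: "x \<in> M" "y \<in> M"
      define e' where "e' n = (if n = 0 then x else if n = 1 then y else c)" for n :: nat
      have "range e' \<subseteq> M" using xy assms(2) by (auto simp: e'_def)
      then have "P (e' 0) (e' (Suc 0)) = sat mem st M p (with_params k q e')"
        by (intro P) simp_all
      moreover have "(e(0 := x, 1 := y)) \<circ> f = with_params k q e'"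
      proof
        fix n
        consider "n < k" | "n = k" | "n = k + 1" | "k + 2 \<le> n" by linarith
        then show "(e(0 := x, 1 := y) \<circ> f) n = with_params k q e' n"
        proof cases
          case 4
          then have "n - k \<noteq> 0" "n - k \<noteq> 1" by linarith+
          then show ?thesis using 4 by (simp add: with_params_def f_def e_def e'_def)
        qed (simp_all add: with_params_def f_def e_def e'_def)
      qed
      ultimately show "sat mem st M (rename f p) (e(0 := x, 1 := y)) = P x y"
        using inj by (simp add: sat_rename e'_def)
    qed (rule e)
  qed
qed

lemma dfn_subst1:
  assumes "dfn (\<lambda>_ e. P (e 0))" "trm t" shows "dfn (\<lambda>_ e. P (t e))"
proof (rule dfn_cong1)
  show "P (t e) = (\<exists>x\<in>M. x = t e \<and> P x)" if "range e \<subseteq> M" for e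
    using trm_in_M[OF assms(2) that] by blast
  show "dfn (\<lambda>_ e. \<exists>x\<in>M. x = t e \<and> P x)"
    by (intro dfn_intros trm_shift assms)
qed

lemma dfn_subst2:
  assumes "dfn (\<lambda>_ e. P (e 0) (e (Suc 0)))" "trm t" "trm s" shows "dfn (\<lambda>_ e. P (t e) (s e))"
proof (rule dfn_cong1)
  show "P (t e) (s e) = (\<exists>y\<in>M. y = s e \<and> (\<exists>x\<in>M. x = t e \<and> P x y))" if "range e \<subseteq> M" for e
    using trm_in_M[OF assms(2) that] trm_in_M[OF assms(3) that] by blast
  show "dfn (\<lambda>_ e. \<exists>y\<in>M. y = s e \<and> (\<exists>x\<in>M. x = t e \<and> P x y))"
    by (intro dfn_intros trm_shift assms)
qed

section \<open>Elements of a model as sets of HOL\<close>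

definition E :: "'u \<Rightarrow> 'u set" where
  "E x = {y \<in> M. y \<epsilon> x}"

definition mset :: "'u set \<Rightarrow> bool" where
  "mset A \<longleftrightarrow> (\<exists>a\<in>M. E a = A)"

definition cd :: "'u set \<Rightarrow> 'u" where
  "cd A = (THE a. a \<in> M \<and> E a = A)"

lemma E_subset: "E x \<subseteq> M"
  by (auto simp: E_def)

lemma E_in: "y \<in> E x \<Longrightarrow> y \<in> M"
  by (simp add: E_def)

lemma E_eqD: "E a = E b \<Longrightarrow> a \<in> M \<Longrightarrow> b \<in> M \<Longrightarrow> a = b"
  using extensionality unfolding extensionality_in_def E_def by blast

lemma E_eqI: "a \<in> M \<Longrightarrow> b \<in> M \<Longrightarrow> (\<And>x. x \<in> M \<Longrightarrow> x \<in> E a \<longleftrightarrow> x \<in> E b) \<Longrightarrow> a = b"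
  by (rule E_eqD) (auto dest: E_in)

lemma cd_E [simp]: "a \<in> M \<Longrightarrow> cd (E a) = a"
  unfolding cd_def by (rule the_equality) (auto dest: E_eqD)

lemma mset_E: "a \<in> M \<Longrightarrow> mset (E a)"
  by (auto simp: mset_def)

lemma E_cd [simp]: "mset A \<Longrightarrow> E (cd A) = A"
  by (auto simp: mset_def)

lemma cd_in [simp]: "mset A \<Longrightarrow> cd A \<in> M"
  by (auto simp: mset_def)

lemma mset_subset: "mset A \<Longrightarrow> A \<subseteq> M"
  using E_subset by (auto simp: mset_def)

lemma mset_in: "mset A \<Longrightarrow> x \<in> A \<Longrightarrow> x \<in> M"
  using mset_subset by blast

lemma in_E_iff: "y \<in> M \<Longrightarrow> y \<in> E x \<longleftrightarrow> y \<epsilon> x"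
  by (simp add: E_def)

lemma dfn_E [dfn_intros]: "trm t \<Longrightarrow> trm s \<Longrightarrow> dfn (\<lambda>_ e. t e \<in> E (s e))"
  by (rule dfn_cong1[of _ "\<lambda>e. t e \<epsilon> s e"]) (auto simp: E_def trm_in_M intro: dfn_intros)

lemma dfn_mset [dfn_intros]: "mset A \<Longrightarrow> trm t \<Longrightarrow> dfn (\<lambda>_ e. t e \<in> A)"
  using dfn_E[of t "\<lambda>_. cd A"] by (simp add: trm_const_in)

lemma dfn_ball_E [dfn_intros]:
  assumes "dfn (\<lambda>_ e. Q (e 0) (\<lambda>n. e (Suc n)))" "trm t"
  shows "dfn (\<lambda>_ e. \<forall>x\<in>E (t e). Q x e)"
proof (rule dfn_cong1)
  show "(\<forall>x\<in>E (t e). Q x e) = (\<forall>x\<in>M. x \<in> E (t e) \<longrightarrow> Q x e)" for e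
    using E_in by blast
  show "dfn (\<lambda>_ e. \<forall>x\<in>M. x \<in> E (t e) \<longrightarrow> Q x e)"
    by (intro dfn_intros assms trm_shift)
qed

lemma dfn_bex_E [dfn_intros]:
  assumes "dfn (\<lambda>_ e. Q (e 0) (\<lambda>n. e (Suc n)))" "trm t"
  shows "dfn (\<lambda>_ e. \<exists>x\<in>E (t e). Q x e)"
proof (rule dfn_cong1)
  show "(\<exists>x\<in>E (t e). Q x e) = (\<exists>x\<in>M. x \<in> E (t e) \<and> Q x e)" for e
    using E_in by blast
  show "dfn (\<lambda>_ e. \<exists>x\<in>M. x \<in> E (t e) \<and> Q x e)"
    by (intro dfn_intros assms trm_shift)
qed

lemma dfn_ball_mset [dfn_intros]:
  assumes "mset A" "dfn (\<lambda>_ e. Q (e 0) (\<lambda>n. e (Suc n)))"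
  shows "dfn (\<lambda>_ e. \<forall>x\<in>A. Q x e)"
  using dfn_ball_E[OF assms(2), of "\<lambda>_. cd A"] assms(1) by (simp add: trm_const_in)

lemma dfn_bex_mset [dfn_intros]:
  assumes "mset A" "dfn (\<lambda>_ e. Q (e 0) (\<lambda>n. e (Suc n)))"
  shows "dfn (\<lambda>_ e. \<exists>x\<in>A. Q x e)"
  using dfn_bex_E[OF assms(2), of "\<lambda>_. cd A"] assms(1) by (simp add: trm_const_in)

lemma mset_sep:
  assumes "mset A" "dfn (\<lambda>_ e. P (e 0))" shows "mset {x \<in> A. P x}"
proof -
  from assms(1) obtain a where a: "a \<in> M" "E a = A" by (auto simp: mset_def)
  obtain p e where p: "full \<or> in_formula p" "range e \<subseteq> M" "e 1 = a"
    "\<And>x y. x \<in> M \<Longrightarrow> y \<in> M \<Longrightarrow> sat mem st M p (e(0 := x, 1 := y)) = P x"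
    using dfn_parameters[of "\<lambda>x _. P x", OF assms(2) a(1)] by blast
  have "sat mem st M p (e(0 := x)) = P x" if "x \<in> M" for x
    using p(4)[OF that a(1)] p(3) fun_upd_triv[of "e(0 := x)" 1] by simp
  moreover have "\<exists>b\<in>M. \<forall>x\<in>M. x \<epsilon> b \<longleftrightarrow> x \<epsilon> a \<and> sat mem st M p (e(0 := x))"
    by (rule separation[unfolded separation_in_def, rule_format]) (use p a in simp_all)
  ultimately obtain b where "b \<in> M" "\<forall>x\<in>M. x \<epsilon> b \<longleftrightarrow> x \<epsilon> a \<and> P x" by auto
  then have "b \<in> M" "E b = {x \<in> A. P x}"
    using a(2) by (auto simp: E_def)
  then show ?thesis by (auto simp: mset_def)
qed

lemma mset_collection:
  assumes "mset A" "dfn (\<lambda>_ e. P (e 0) (e (Suc 0)))"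
  obtains B where "mset B" "\<And>x y. x \<in> A \<Longrightarrow> y \<in> M \<Longrightarrow> P x y \<Longrightarrow> \<exists>y\<in>B. P x y"
proof -
  from assms(1) obtain a where a: "a \<in> M" "E a = A" by (auto simp: mset_def)
  obtain p e where p: "full \<or> in_formula p" "range e \<subseteq> M" "e 1 = a"
    "\<And>x y. x \<in> M \<Longrightarrow> y \<in> M \<Longrightarrow> sat mem st M p (e(0 := x, 1 := y)) = P x y"
    using dfn_parameters[of P, OF assms(2) a(1)] by blast
  have "\<exists>b\<in>M. \<forall>x\<in>M. x \<epsilon> a \<longrightarrow> (\<exists>y\<in>M. sat mem st M p (e(0 := x, 1 := y))) \<longrightarrow>
      (\<exists>y\<in>M. y \<epsilon> b \<and> sat mem st M p (e(0 := x, 1 := y)))"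
    by (rule collection[unfolded collection_in_def, rule_format, of p e a]) (use p a in simp_all)
  then obtain b where b: "b \<in> M" "\<forall>x\<in>M. x \<epsilon> a \<longrightarrow> (\<exists>y\<in>M. P x y) \<longrightarrow> (\<exists>y\<in>M. y \<epsilon> b \<and> P x y)"
    using p(4) by auto
  show thesis
  proof (rule that[of "E b"])
    fix x y assume *: "x \<in> A" "y \<in> M" "P x y"
    then have "x \<in> M" "x \<epsilon> a" using a by (auto simp: E_def)
    then have "\<exists>y\<in>M. y \<epsilon> b \<and> P x y"
      using b(2) * by blast
    then show "\<exists>y\<in>E b. P x y" by (auto simp: E_def)
  qed (use b mset_E in auto)
qed

text \<open>Collection gives a set that meets every nonempty fibre. As fibres have at most one
  point, it contains the whole image, which Separation then cuts out.\<close>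

lemma mset_repl:
  assumes "mset A" "dfn (\<lambda>_ e. P (e 0) (e (Suc 0)))"
    and "\<And>x y z. x \<in> A \<Longrightarrow> y \<in> M \<Longrightarrow> z \<in> M \<Longrightarrow> P x y \<Longrightarrow> P x z \<Longrightarrow> y = z"
  shows "mset {y \<in> M. \<exists>x\<in>A. P x y}"
proof -
  obtain B where B: "mset B" "\<And>x y. x \<in> A \<Longrightarrow> y \<in> M \<Longrightarrow> P x y \<Longrightarrow> \<exists>y\<in>B. P x y"
    using mset_collection[OF assms(1,2)] by blast
  have "{y \<in> M. \<exists>x\<in>A. P x y} = {y \<in> B. \<exists>x\<in>A. P x y}"
    using B assms(3) mset_subset[OF B(1)] by (auto; metis subsetD)
  moreover have "mset \<dots>"
    by (rule mset_sep[OF B(1)]) (intro dfn_intros assms(1,2))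
  ultimately show ?thesis by simp
qed

lemma mset_exists: "\<exists>A. mset A"
  using infinity mset_E unfolding infinity_in_def by blast

lemma mset_empty [simp, intro]: "mset {}"
proof -
  obtain A where "mset A" using mset_exists by blast
  from mset_sep[OF this dfn_const[of False]] show ?thesis by simp
qed

lemma mset_eqI:
  assumes "a \<in> M" "\<And>x. x \<in> M \<Longrightarrow> x \<epsilon> a \<longleftrightarrow> x \<in> A" "A \<subseteq> M"
  shows "mset A"
proof -
  have "E a = A" unfolding E_def using assms(2,3) by blast
  then show ?thesis unfolding mset_def using assms(1) by blast
qed

lemma mset_pair [intro]:
  assumes "x \<in> M" "y \<in> M" shows "mset {x, y}"
proof -
  obtain p where p: "p \<in> M" "\<forall>z\<in>M. z \<epsilon> p \<longleftrightarrow> z = x \<or> z = y"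
    by (rule bexE[OF pairing[unfolded pairing_in_def is_upair_in_def, rule_format, OF assms]])
  show ?thesis
  proof (rule mset_eqI[OF p(1)])
    show "z \<epsilon> p \<longleftrightarrow> z \<in> {x, y}" if "z \<in> M" for z
      using p(2) that by simp
  qed (use assms in simp)
qed

lemma mset_single [intro]: "x \<in> M \<Longrightarrow> mset {x}"
  using mset_pair[of x x] by simp

lemma mset_Union:
  assumes "mset A" shows "mset (\<Union>x\<in>A. E x)"
proof -
  obtain a where a: "a \<in> M" "E a = A" using assms by (auto simp: mset_def)
  obtain b where b: "b \<in> M" "\<forall>x\<in>M. x \<epsilon> b \<longleftrightarrow> (\<exists>y\<in>M. y \<epsilon> a \<and> x \<epsilon> y)"
    by (rule bexE[OF union[unfolded union_in_def, rule_format, OF a(1)]])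
  have "E b = (\<Union>x\<in>E a. E x)"
    using b(2) unfolding E_def by blast
  then show ?thesis
    using a(2) b(1) unfolding mset_def by blast
qed

lemma mset_Un [intro]:
  assumes "mset A" "mset B" shows "mset (A \<union> B)"
  using mset_Union[OF mset_pair[of "cd A" "cd B"]] assms by simp

lemma mset_insert [intro]: "x \<in> M \<Longrightarrow> mset A \<Longrightarrow> mset (insert x A)"
  using mset_Un[OF mset_single] by simp

lemma mset_Int:
  assumes "mset A" "mset B" shows "mset (A \<inter> B)"
proof -
  have "mset {x \<in> A. x \<in> B}" by (intro mset_sep dfn_intros assms)
  then show ?thesis by (simp add: Int_def)
qed

lemma mset_Diff:
  assumes "mset A" "mset B" shows "mset (A - B)"
proof -
  have "mset {x \<in> A. x \<notin> B}" by (intro mset_sep dfn_intros assms)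
  then show ?thesis by (simp add: set_diff_eq)
qed

section \<open>Ordered pairs, products and coded relations\<close>

definition pr :: "'u \<Rightarrow> 'u \<Rightarrow> 'u" where
  "pr x y = cd {cd {x}, cd {x, y}}"

lemma pr_in [simp]: "x \<in> M \<Longrightarrow> y \<in> M \<Longrightarrow> pr x y \<in> M"
  by (simp add: pr_def mset_pair mset_single)

lemma pr_inject [simp]:
  assumes "x \<in> M" "y \<in> M" "x' \<in> M" "y' \<in> M"
  shows "pr x y = pr x' y' \<longleftrightarrow> x = x' \<and> y = y'"
proof
  assume eq: "pr x y = pr x' y'"
  have E_pr: "E ` E (pr u v) = {{u}, {u, v}}" if "u \<in> M" "v \<in> M" for u v
    unfolding pr_def using that by (simp add: mset_pair mset_single)
  have "{{x}, {x, y}} = {{x'}, {x', y'}}"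
    using E_pr assms eq by metis
  then show "x = x' \<and> y = y'"
    by (metis doubleton_eq_iff insert_absorb2)
qed simp

lemma is_upair_in_iff:
  assumes "p \<in> M" "x \<in> M" "y \<in> M" shows "is_upair_in mem M x y p \<longleftrightarrow> p = cd {x, y}"
proof -
  have "is_upair_in mem M x y p \<longleftrightarrow> E p = {x, y}"
    using assms unfolding is_upair_in_def E_def by auto
  then show ?thesis
    by (metis E_cd assms cd_E mset_pair)
qed

lemma is_pair_in_iff:
  assumes "p \<in> M" "x \<in> M" "y \<in> M" shows "is_pair_in mem M x y p \<longleftrightarrow> p = pr x y"
proof -
  have "is_pair_in mem M x y p \<longleftrightarrow>
      (\<exists>u\<in>M. \<exists>v\<in>M. u = cd {x} \<and> v = cd {x, y} \<and> is_upair_in mem M u v p)"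
    unfolding is_pair_in_def using assms by (simp add: is_upair_in_iff)
  also have "\<dots> \<longleftrightarrow> p = pr x y"
    using assms by (simp add: is_upair_in_iff pr_def mset_pair mset_single)
  finally show ?thesis .
qed

lemma related_in_iff:
  "x \<in> M \<Longrightarrow> y \<in> M \<Longrightarrow> related_in mem M r x y \<longleftrightarrow> pr x y \<in> E r"
  unfolding related_in_def by (auto simp: is_pair_in_iff E_def)

text \<open>Proof search tries the rules in order of declaration, so the rules for atoms are declared
  again after those for pairs and successors.\<close>

declare dfn_eq [dfn_intros del] dfn_E [dfn_intros del] dfn_mset [dfn_intros del]

lemma dfn_eq_pr [dfn_intros]:
  assumes "trm t" "trm s" "trm r" shows "dfn (\<lambda>_ e. t e = pr (s e) (r e))"
proof (rule dfn_cong1)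
  show "(t e = pr (s e) (r e)) = is_pair_in mem M (s e) (r e) (t e)" if "range e \<subseteq> M" for e
    using that assms by (simp add: is_pair_in_iff trm_in_M)
  show "dfn (\<lambda>_ e. is_pair_in mem M (s e) (r e) (t e))"
    by (rule dfn_single[OF dfn_is_pair_in]) (fact assms)+
qed

lemma dfn_pr_E [dfn_intros]:
  assumes "trm t" "trm s" "trm r" shows "dfn (\<lambda>_ e. pr (s e) (r e) \<in> E (t e))"
proof (rule dfn_cong1)
  show "(pr (s e) (r e) \<in> E (t e)) = (\<exists>p\<in>E (t e). p = pr (s e) (r e))" for e
    by blast
  show "dfn (\<lambda>_ e. \<exists>p\<in>E (t e). p = pr (s e) (r e))"
    by (intro dfn_intros trm_shift assms)
qed

lemma dfn_pr_mset [dfn_intros]: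
  assumes "mset A" "trm s" "trm r" shows "dfn (\<lambda>_ e. pr (s e) (r e) \<in> A)"
  using dfn_pr_E[of "\<lambda>_. cd A" s r] assms by (simp add: trm_const_in)

declare dfn_eq [dfn_intros] dfn_E [dfn_intros] dfn_mset [dfn_intros]

definition prs :: "('u \<times> 'u) set \<Rightarrow> 'u set" where
  "prs R = (\<lambda>(x, y). pr x y) ` R"

lemma prs_iff: "p \<in> prs R \<longleftrightarrow> (\<exists>x y. (x, y) \<in> R \<and> p = pr x y)"
  unfolding prs_def by auto

definition mrel :: "('u \<times> 'u) set \<Rightarrow> bool" where
  "mrel R \<longleftrightarrow> R \<subseteq> M \<times> M \<and> mset (prs R)"

definition rel :: "'u \<Rightarrow> ('u \<times> 'u) set" where
  "rel r = {(x, y). x \<in> M \<and> y \<in> M \<and> pr x y \<in> E r}"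

lemma in_prs_iff: "R \<subseteq> M \<times> M \<Longrightarrow> x \<in> M \<Longrightarrow> y \<in> M \<Longrightarrow> pr x y \<in> prs R \<longleftrightarrow> (x, y) \<in> R"
  unfolding prs_def by (force simp: image_iff)

lemma rel_cd [simp]:
  assumes "mrel R" shows "rel (cd (prs R)) = R"
proof -
  have R: "R \<subseteq> M \<times> M" "mset (prs R)"
    using assms by (simp_all add: mrel_def)
  have "(x, y) \<in> rel (cd (prs R)) \<longleftrightarrow> (x, y) \<in> R" for x y
    unfolding rel_def E_cd[OF R(2)] using R(1) in_prs_iff[OF R(1)] by blast
  then show ?thesis by auto
qed

lemma mrel_rel: "r \<in> M \<Longrightarrow> mrel (rel r)"
proof -
  assume r: "r \<in> M"
  have "prs (rel r) = {p \<in> E r. \<exists>x\<in>M. \<exists>y\<in>M. p = pr x y}"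
    unfolding prs_def rel_def by auto
  moreover have "mset \<dots>"
    by (intro mset_sep mset_E r dfn_intros)
  ultimately show ?thesis unfolding mrel_def by (auto simp: rel_def)
qed

lemma dfn_mrel [dfn_intros]:
  assumes "mrel R" "trm t" "trm s" shows "dfn (\<lambda>_ e. (t e, s e) \<in> R)"
proof (rule dfn_cong1)
  have R: "R \<subseteq> M \<times> M" "mset (prs R)"
    using assms(1) by (simp_all add: mrel_def)
  show "((t e, s e) \<in> R) = (pr (t e) (s e) \<in> prs R)" if "range e \<subseteq> M" for e
    using in_prs_iff[OF R(1)] trm_in_M[OF assms(2) that] trm_in_M[OF assms(3) that] by blast
  show "dfn (\<lambda>_ e. pr (t e) (s e) \<in> prs R)"
    by (intro dfn_intros assms R)
qed

text \<open>Power set may fail in a \<open>base_model\<close>, so the product comes from Replacement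
  used twice: once for each row \<open>{x} \<times> B\<close>, once for the set of all rows, whose
  union it is.\<close>

lemma mset_prs_Times:
  assumes "mset A" "mset B" shows "mset (prs (A \<times> B))"
proof -
  have 1: "mset (prs ({x} \<times> B))" if "x \<in> M" for x
  proof -
    have "mset {p \<in> M. \<exists>y\<in>B. p = pr x y}"
      by (rule mset_repl[OF assms(2)]) (intro dfn_intros that | simp)+
    also have "{p \<in> M. \<exists>y\<in>B. p = pr x y} = prs ({x} \<times> B)"
      using that mset_subset[OF assms(2)] by (auto simp: prs_def)
    finally show ?thesis .
  qed
  have "mset {q \<in> M. \<exists>x\<in>A. \<forall>p\<in>M. p \<in> E q \<longleftrightarrow> (\<exists>y\<in>B. p = pr x y)}" (is "mset ?C")
  proof (rule mset_repl[OF assms(1)])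
    show "dfn (\<lambda>_ e. \<forall>p\<in>M. p \<in> E (e (Suc 0)) \<longleftrightarrow> (\<exists>y\<in>B. p = pr (e 0) y))"
      by (intro dfn_intros assms)
    show "y = z" if "y \<in> M" "z \<in> M" "\<forall>p\<in>M. p \<in> E y \<longleftrightarrow> (\<exists>y\<in>B. p = pr x y)"
      "\<forall>p\<in>M. p \<in> E z \<longleftrightarrow> (\<exists>y\<in>B. p = pr x y)" for x y z
      using that by (intro E_eqI) simp_all
  qed
  then have "mset (\<Union>q\<in>?C. E q)" by (rule mset_Union)
  also have "(\<Union>q\<in>?C. E q) = prs (A \<times> B)"
  proof
    show "(\<Union>q\<in>?C. E q) \<subseteq> prs (A \<times> B)"
    proof
      fix p assume "p \<in> (\<Union>q\<in>?C. E q)"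
      then obtain q x where q: "p \<in> E q" "x \<in> A" "\<forall>p\<in>M. p \<in> E q \<longleftrightarrow> (\<exists>y\<in>B. p = pr x y)"
        by blast
      then obtain y where "y \<in> B" "p = pr x y" using E_in[OF q(1)] by blast
      then show "p \<in> prs (A \<times> B)" using q(2) by (auto simp: prs_iff)
    qed
    show "prs (A \<times> B) \<subseteq> (\<Union>q\<in>?C. E q)"
    proof
      fix p assume "p \<in> prs (A \<times> B)"
      then obtain x y where xy: "x \<in> A" "y \<in> B" "p = pr x y" by (auto simp: prs_iff)
      have x: "x \<in> M" using xy assms mset_in by blast
      have "cd (prs ({x} \<times> B)) \<in> ?C" "p \<in> E (cd (prs ({x} \<times> B)))"
        using 1[OF x] xy by (auto simp: prs_iff)
      then show "p \<in> (\<Union>q\<in>?C. E q)" by blast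
    qed
  qed
  finally show ?thesis .
qed

lemma mrel_Times: "mset A \<Longrightarrow> mset B \<Longrightarrow> mrel (A \<times> B)"
  unfolding mrel_def using mset_prs_Times mset_subset by blast

lemma mrel_sep:
  assumes "mrel R" "dfn (\<lambda>_ e. P (e 0) (e (Suc 0)))"
  shows "mrel {(x, y). (x, y) \<in> R \<and> P x y}"
proof -
  have R: "R \<subseteq> M \<times> M" "mset (prs R)"
    using assms(1) by (simp_all add: mrel_def)
  have "prs {(x, y). (x, y) \<in> R \<and> P x y} = {p \<in> prs R. \<exists>y\<in>M. \<exists>x\<in>M. P x y \<and> p = pr x y}"
  proof (intro set_eqI iffI)
    fix p assume "p \<in> prs {(x, y). (x, y) \<in> R \<and> P x y}"
    then obtain x y where "(x, y) \<in> R" "P x y" "p = pr x y" by (auto simp: prs_iff)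
    then show "p \<in> {p \<in> prs R. \<exists>y\<in>M. \<exists>x\<in>M. P x y \<and> p = pr x y}"
      using R(1) by (auto simp: prs_iff)
  next
    fix p assume "p \<in> {p \<in> prs R. \<exists>y\<in>M. \<exists>x\<in>M. P x y \<and> p = pr x y}"
    then obtain x y where xy: "x \<in> M" "y \<in> M" "p \<in> prs R" "P x y" "p = pr x y" by blast
    then have "(x, y) \<in> R" using in_prs_iff[OF R(1)] by simp
    then show "p \<in> prs {(x, y). (x, y) \<in> R \<and> P x y}"
      using xy by (auto simp: prs_iff)
  qed
  moreover have "mset \<dots>"
    by (intro mset_sep R dfn_intros assms(2))
  ultimately show ?thesis using R(1) by (auto simp: mrel_def)
qed

lemma mrel_Collect:
  assumes "mset A" "mset B" "dfn (\<lambda>_ e. P (e 0) (e (Suc 0)))"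
  shows "mrel {(x, y). x \<in> A \<and> y \<in> B \<and> P x y}"
  using mrel_sep[OF mrel_Times[OF assms(1,2)] assms(3)] by (simp add: case_prod_beta)

lemma mrel_subset: "mrel R \<Longrightarrow> R \<subseteq> M \<times> M"
  by (simp add: mrel_def)

lemma mset_Range [intro]:
  assumes "mrel R" shows "mset (Range R)"
proof -
  have R: "R \<subseteq> M \<times> M" "mset (prs R)"
    using assms by (simp_all add: mrel_def)
  have "mset {y \<in> M. \<exists>p\<in>prs R. \<exists>x\<in>M. p = pr x y}"
    by (rule mset_repl[OF R(2)]) (intro dfn_intros | clarsimp)+
  moreover have "{y \<in> M. \<exists>p\<in>prs R. \<exists>x\<in>M. p = pr x y} = Range R"
  proof (intro set_eqI iffI)
    fix y assume "y \<in> {y \<in> M. \<exists>p\<in>prs R. \<exists>x\<in>M. p = pr x y}"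
    then obtain x where "x \<in> M" "y \<in> M" "pr x y \<in> prs R" by blast
    then show "y \<in> Range R" using in_prs_iff[OF R(1)] by blast
  next
    fix y assume "y \<in> Range R"
    then obtain x where "(x, y) \<in> R" by blast
    then have "x \<in> M" "y \<in> M" "pr x y \<in> prs R" using R(1) by (auto simp: prs_iff)
    then show "y \<in> {y \<in> M. \<exists>p\<in>prs R. \<exists>x\<in>M. p = pr x y}" by blast
  qed
  ultimately show ?thesis by simp
qed

lemma mset_Domain [intro]:
  assumes "mrel R" shows "mset (Domain R)"
proof -
  have R: "R \<subseteq> M \<times> M" "mset (prs R)"
    using assms by (simp_all add: mrel_def)
  have "mset {x \<in> M. \<exists>p\<in>prs R. \<exists>y\<in>M. p = pr x y}"
    by (rule mset_repl[OF R(2)]) (intro dfn_intros | clarsimp)+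
  moreover have "{x \<in> M. \<exists>p\<in>prs R. \<exists>y\<in>M. p = pr x y} = Domain R"
  proof (intro set_eqI iffI)
    fix x assume "x \<in> {x \<in> M. \<exists>p\<in>prs R. \<exists>y\<in>M. p = pr x y}"
    then obtain y where "x \<in> M" "y \<in> M" "pr x y \<in> prs R" by blast
    then show "x \<in> Domain R" using in_prs_iff[OF R(1)] by blast
  next
    fix x assume "x \<in> Domain R"
    then obtain y where "(x, y) \<in> R" by blast
    then have "x \<in> M" "y \<in> M" "pr x y \<in> prs R" using R(1) by (auto simp: prs_iff)
    then show "x \<in> {x \<in> M. \<exists>p\<in>prs R. \<exists>y\<in>M. p = pr x y}" by blast
  qed
  ultimately show ?thesis by simp
qed

lemma mrel_converse [intro]:
  assumes "mrel R" shows "mrel (R\<inverse>)"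
proof -
  have "mrel {(x, y). x \<in> Range R \<and> y \<in> Domain R \<and> (y, x) \<in> R}"
    by (intro mrel_Collect dfn_intros mset_Range mset_Domain assms)
  moreover have "{(x, y). x \<in> Range R \<and> y \<in> Domain R \<and> (y, x) \<in> R} = R\<inverse>" by auto
  ultimately show ?thesis by simp
qed

lemma mrel_comp [intro]:
  assumes "mrel R" "mrel S" shows "mrel (R O S)"
proof -
  have "mrel {(x, z). x \<in> Domain R \<and> z \<in> Range S \<and> (\<exists>y\<in>M. (x, y) \<in> R \<and> (y, z) \<in> S)}"
    by (intro mrel_Collect dfn_intros mset_Range mset_Domain assms)
  moreover have "{(x, z). x \<in> Domain R \<and> z \<in> Range S \<and> (\<exists>y\<in>M. (x, y) \<in> R \<and> (y, z) \<in> S)} = R O S"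
    using mrel_subset[OF assms(1)] by fast
  ultimately show ?thesis by simp
qed

lemma mrel_Un [intro]:
  assumes "mrel R" "mrel S" shows "mrel (R \<union> S)"
  using assms unfolding mrel_def prs_def by (simp add: image_Un mset_Un)

lemma mrel_single [intro]: "x \<in> M \<Longrightarrow> y \<in> M \<Longrightarrow> mrel {(x, y)}"
  unfolding mrel_def prs_def by (simp add: mset_single)

lemma mrel_restrict:
  assumes "mrel R" "mset A" "mset B" shows "mrel (R \<inter> A \<times> B)"
proof -
  have "mrel {(x, y). (x, y) \<in> R \<and> (x \<in> A \<and> y \<in> B)}"
    by (intro mrel_sep dfn_intros assms)
  moreover have "{(x, y). (x, y) \<in> R \<and> (x \<in> A \<and> y \<in> B)} = R \<inter> A \<times> B" by auto
  ultimately show ?thesis by simp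
qed

lemma mset_Image [intro]:
  assumes "mrel R" "mset A" shows "mset (R `` A)"
proof -
  have "mset {y \<in> Range R. \<exists>x\<in>A. (x, y) \<in> R}"
    by (intro mset_sep dfn_intros mset_Range assms)
  moreover have "{y \<in> Range R. \<exists>x\<in>A. (x, y) \<in> R} = R `` A" by auto
  ultimately show ?thesis by simp
qed

lemma mrel_Id_on [intro]:
  assumes "mset A" shows "mrel (Id_on A)"
proof -
  have "mrel {(x, y). x \<in> A \<and> y \<in> A \<and> x = y}"
    by (intro mrel_Collect dfn_intros assms)
  moreover have "{(x, y). x \<in> A \<and> y \<in> A \<and> x = y} = Id_on A" by auto
  ultimately show ?thesis by simp
qed

section \<open>Coded injections\<close>

definition injrel :: "('u \<times> 'u) set \<Rightarrow> 'u set \<Rightarrow> 'u set \<Rightarrow> bool" where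
  "injrel R A B \<longleftrightarrow> R \<subseteq> A \<times> B \<and> A \<subseteq> Domain R \<and> single_valued R \<and> single_valued (R\<inverse>)"

definition lep :: "'u set \<Rightarrow> 'u set \<Rightarrow> bool" where
  "lep A B \<longleftrightarrow> (\<exists>R. mrel R \<and> injrel R A B)"

definition eqp :: "'u set \<Rightarrow> 'u set \<Rightarrow> bool" where
  "eqp A B \<longleftrightarrow> (\<exists>R. mrel R \<and> injrel R A B \<and> B \<subseteq> Range R)"

lemma eqp_imp_lep: "eqp A B \<Longrightarrow> lep A B"
  by (auto simp: eqp_def lep_def)

lemma injrel_comp: "injrel R A B \<Longrightarrow> injrel S B C \<Longrightarrow> injrel (R O S) A C"
  unfolding injrel_def by (auto simp: single_valued_relcomp converse_relcomp) blast

lemma lep_trans [trans]: "lep A B \<Longrightarrow> lep B C \<Longrightarrow> lep A C"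
  unfolding lep_def using injrel_comp mrel_comp by blast

lemma eqp_trans [trans]:
  assumes "eqp A B" "eqp B C" shows "eqp A C"
proof -
  obtain R S where R: "mrel R" "injrel R A B" "B \<subseteq> Range R" and S: "mrel S" "injrel S B C" "C \<subseteq> Range S"
    using assms by (auto simp: eqp_def)
  have "C \<subseteq> Range (R O S)"
    using R(3) S(2,3) unfolding injrel_def by fast
  then show ?thesis
    unfolding eqp_def using injrel_comp[OF R(2) S(2)] mrel_comp[OF R(1) S(1)] by blast
qed

lemma eqp_sym: "eqp A B \<Longrightarrow> eqp B A"
proof -
  assume "eqp A B"
  then obtain R where R: "mrel R" "injrel R A B" "B \<subseteq> Range R" by (auto simp: eqp_def)
  have "injrel (R\<inverse>) B A" "A \<subseteq> Range (R\<inverse>)"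
    using R(2,3) unfolding injrel_def by auto
  then show "eqp B A" unfolding eqp_def using R(1) by blast
qed

lemma injrel_Id_on: "A \<subseteq> B \<Longrightarrow> injrel (Id_on A) A B"
  unfolding injrel_def by (auto simp: single_valued_def)

lemma eqp_refl: "mset A \<Longrightarrow> eqp A A"
  unfolding eqp_def by (rule exI[of _ "Id_on A"]) (auto simp: injrel_Id_on)

lemma lep_subset: "mset A \<Longrightarrow> A \<subseteq> B \<Longrightarrow> lep A B"
  unfolding lep_def by (rule exI[of _ "Id_on A"]) (auto simp: injrel_Id_on)

lemma lep_obtain_subset:
  assumes "lep A B" obtains C where "mset C" "C \<subseteq> B" "eqp A C"
proof -
  obtain R where R: "mrel R" "injrel R A B" using assms by (auto simp: lep_def)
  have "injrel R A (Range R)" "Range R \<subseteq> B"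
    using R(2) unfolding injrel_def by auto
  then show thesis
    using R(1) by (intro that[of "Range R"]) (auto simp: eqp_def)
qed

lemma lepI:
  assumes "mset A" "mset B" "dfn (\<lambda>_ e. P (e 0) (e (Suc 0)))"
    "\<And>x. x \<in> A \<Longrightarrow> \<exists>y\<in>B. P x y"
    "\<And>x y z. x \<in> A \<Longrightarrow> y \<in> B \<Longrightarrow> z \<in> B \<Longrightarrow> P x y \<Longrightarrow> P x z \<Longrightarrow> y = z"
    "\<And>x y z. x \<in> A \<Longrightarrow> y \<in> A \<Longrightarrow> z \<in> B \<Longrightarrow> P x z \<Longrightarrow> P y z \<Longrightarrow> x = y"
  shows "lep A B"
proof -
  let ?R = "{(x, y). x \<in> A \<and> y \<in> B \<and> P x y}"
  have "mrel ?R" by (rule mrel_Collect[OF assms(1-3)])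
  moreover have "injrel ?R A B"
    unfolding injrel_def
  proof (intro conjI)
    show "A \<subseteq> Domain ?R" using assms(4) by fast
    show "single_valued ?R" using assms(5) by (auto simp: single_valued_def)
    show "single_valued (?R\<inverse>)" using assms(6) by (auto simp: single_valued_def)
  qed auto
  ultimately show ?thesis unfolding lep_def by blast
qed

text \<open>The quantifier over coded relations of HOL is replaced by one over their codes in
  \<open>M\<close>. This makes \<open>lep\<close> first-order and thus admissible in Separation and
  induction.\<close>

lemma dfn_lep [dfn_intros]:
  assumes "trm t" "trm s" shows "dfn (\<lambda>_ e. lep (E (t e)) (E (s e)))"
proof (rule dfn_cong1)
  let ?P = "\<lambda>r a b. (\<forall>x\<in>M. \<forall>y\<in>M. pr x y \<in> E r \<longrightarrow> x \<in> E a \<and> y \<in> E b) \<and>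
    (\<forall>x\<in>E a. \<exists>y\<in>M. pr x y \<in> E r) \<and>
    (\<forall>x\<in>M. \<forall>y\<in>M. \<forall>z\<in>M. pr x y \<in> E r \<and> pr x z \<in> E r \<longrightarrow> y = z) \<and>
    (\<forall>x\<in>M. \<forall>y\<in>M. \<forall>z\<in>M. pr y x \<in> E r \<and> pr z x \<in> E r \<longrightarrow> y = z)"
  have *: "injrel (rel r) (E a) (E b) \<longleftrightarrow> ?P r a b" for r a b
    unfolding injrel_def rel_def single_valued_def by (auto dest: E_in)
  show "lep (E (t e)) (E (s e)) = (\<exists>r\<in>M. ?P r (t e) (s e))" for e
  proof -
    have "lep (E (t e)) (E (s e)) \<longleftrightarrow> (\<exists>r\<in>M. injrel (rel r) (E (t e)) (E (s e)))"
      unfolding lep_def using mrel_rel rel_cd cd_in by (metis mrel_def)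
    then show ?thesis by (simp only: *)
  qed
  show "dfn (\<lambda>_ e. \<exists>r\<in>M. ?P r (t e) (s e))"
    by (intro dfn_intros trm_shift assms)
qed

lemma dfn_eqp [dfn_intros]:
  assumes "trm t" "trm s" shows "dfn (\<lambda>_ e. eqp (E (t e)) (E (s e)))"
proof (rule dfn_cong1)
  let ?P = "\<lambda>r a b. (\<forall>x\<in>M. \<forall>y\<in>M. pr x y \<in> E r \<longrightarrow> x \<in> E a \<and> y \<in> E b) \<and>
    (\<forall>x\<in>E a. \<exists>y\<in>M. pr x y \<in> E r) \<and>
    (\<forall>x\<in>M. \<forall>y\<in>M. \<forall>z\<in>M. pr x y \<in> E r \<and> pr x z \<in> E r \<longrightarrow> y = z) \<and>
    (\<forall>x\<in>M. \<forall>y\<in>M. \<forall>z\<in>M. pr y x \<in> E r \<and> pr z x \<in> E r \<longrightarrow> y = z) \<and>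
    (\<forall>y\<in>E b. \<exists>x\<in>M. pr x y \<in> E r)"
  have *: "injrel (rel r) (E a) (E b) \<and> E b \<subseteq> Range (rel r) \<longleftrightarrow> ?P r a b" for r a b
    unfolding injrel_def rel_def single_valued_def by (auto dest: E_in) (meson E_in)
  show "eqp (E (t e)) (E (s e)) = (\<exists>r\<in>M. ?P r (t e) (s e))" for e
  proof -
    have "eqp (E (t e)) (E (s e)) \<longleftrightarrow>
        (\<exists>r\<in>M. injrel (rel r) (E (t e)) (E (s e)) \<and> E (s e) \<subseteq> Range (rel r))"
      unfolding eqp_def using mrel_rel rel_cd cd_in by (metis mrel_def)
    then show ?thesis by (simp only: *)
  qed
  show "dfn (\<lambda>_ e. \<exists>r\<in>M. ?P r (t e) (s e))"
    by (intro dfn_intros trm_shift assms)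
qed

lemma equinumerous_in_iff:
  assumes "a \<in> M" "b \<in> M" shows "equinumerous_in mem M a b \<longleftrightarrow> eqp (E a) (E b)"
proof
  assume "equinumerous_in mem M a b"
  then obtain f where f: "f \<in> M" "is_bijection_in mem M f a b" by (auto simp: equinumerous_in_def)
  have f1: "(x, y) \<in> rel f \<longleftrightarrow> x \<in> M \<and> y \<in> M \<and> related_in mem M f x y" for x y
    by (auto simp: rel_def related_in_iff)
  have "injrel (rel f) (E a) (E b)" "E b \<subseteq> Range (rel f)"
    using f(2) unfolding is_bijection_in_def is_function_in_def injrel_def single_valued_def
    by (auto simp: f1 E_def Domain_iff Range_iff) metis+
  then show "eqp (E a) (E b)"
    using mrel_rel[OF f(1)] by (auto simp: eqp_def)
next
  assume "eqp (E a) (E b)"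
  then obtain R where R: "mrel R" "injrel R (E a) (E b)" "E b \<subseteq> Range R" by (auto simp: eqp_def)
  define f where "f = cd (prs R)"
  have Rm: "R \<subseteq> M \<times> M" "mset (prs R)" using R(1) by (simp_all add: mrel_def)
  have f: "f \<in> M" "E f = prs R" unfolding f_def using Rm by simp_all
  have rf: "related_in mem M f x y \<longleftrightarrow> (x, y) \<in> R" if "x \<in> M" "y \<in> M" for x y
    using that f(2) by (simp add: related_in_iff in_prs_iff[OF Rm(1)])
  have "\<exists>x\<in>M. \<exists>y\<in>M. is_pair_in mem M x y p" if "p \<in> M" "p \<epsilon> f" for p
  proof -
    have "p \<in> prs R" using that f(2) by (auto simp: E_def)
    then obtain x y where "(x, y) \<in> R" "p = pr x y" by (auto simp: prs_iff)
    moreover from this have "x \<in> M" "y \<in> M" using Rm(1) by auto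
    ultimately show ?thesis using is_pair_in_iff that(1) by blast
  qed
  then have "is_bijection_in mem M f a b"
    using R(2,3) unfolding is_bijection_in_def is_function_in_def injrel_def single_valued_def
    by (auto simp: rf E_def Domain_iff Range_iff subset_iff) (metis rf)+
  then show "equinumerous_in mem M a b" unfolding equinumerous_in_def using f(1) by blast
qed

end

context base_model
begin

section \<open>Natural numbers of a model\<close>

definition zero :: 'u where "zero = cd {}"

definition sc :: "'u \<Rightarrow> 'u" where "sc x = cd (insert x (E x))"

definition Om :: "'u set" where "Om = naturals_in mem M"

lemma zero_in [simp]: "zero \<in> M" and E_zero [simp]: "E zero = {}"
  by (simp_all add: zero_def)

lemma sc_in [simp]: "x \<in> M \<Longrightarrow> sc x \<in> M" and E_sc [simp]: "x \<in> M \<Longrightarrow> E (sc x) = insert x (E x)"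
  by (simp_all add: sc_def mset_insert mset_E)

lemma zero_neq_sc [simp]: "x \<in> M \<Longrightarrow> zero \<noteq> sc x" "x \<in> M \<Longrightarrow> sc x \<noteq> zero"
  by (metis E_zero E_sc insert_not_empty)+

lemma is_succ_in_iff: "x \<in> M \<Longrightarrow> y \<in> M \<Longrightarrow> is_succ_in mem M x y \<longleftrightarrow> y = sc x"
proof -
  assume xy: "x \<in> M" "y \<in> M"
  have "is_succ_in mem M x y \<longleftrightarrow> (\<forall>z\<in>M. z \<in> E y \<longleftrightarrow> z \<in> E (sc x))"
    unfolding is_succ_in_def using xy by (auto simp: in_E_iff)
  then show ?thesis using E_eqI xy by auto
qed

lemma nonempty_in_iff: "nonempty_in mem M x \<longleftrightarrow> E x \<noteq> {}"
  by (auto simp: nonempty_in_def E_def)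

lemma inductive_in_iff:
  assumes "w \<in> M"
  shows "inductive_in mem M w \<longleftrightarrow> zero \<in> E w \<and> (\<forall>x\<in>E w. sc x \<in> E w)"
proof -
  have 1: "(\<exists>z\<in>M. \<not> nonempty_in mem M z \<and> z \<epsilon> w) \<longleftrightarrow> zero \<in> E w"
  proof
    assume "\<exists>z\<in>M. \<not> nonempty_in mem M z \<and> z \<epsilon> w"
    then obtain z where z: "z \<in> M" "E z = {}" "z \<epsilon> w" by (auto simp: nonempty_in_iff)
    then have "z = zero" by (intro E_eqD) simp_all
    then show "zero \<in> E w" using z by (simp add: in_E_iff)
  next
    assume "zero \<in> E w"
    then show "\<exists>z\<in>M. \<not> nonempty_in mem M z \<and> z \<epsilon> w"
      by (intro bexI[of _ zero]) (simp_all add: nonempty_in_iff in_E_iff)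
  qed
  have 2: "(\<exists>y\<in>M. is_succ_in mem M x y \<and> y \<epsilon> w) \<longleftrightarrow> sc x \<in> E w" if "x \<in> M" for x
    using that by (auto simp: is_succ_in_iff in_E_iff)
  have "(\<forall>x\<in>M. x \<epsilon> w \<longrightarrow> (\<exists>y\<in>M. is_succ_in mem M x y \<and> y \<epsilon> w)) \<longleftrightarrow>
      (\<forall>x\<in>M. x \<epsilon> w \<longrightarrow> sc x \<in> E w)"
    using 2 by (intro ball_cong) simp_all
  also have "\<dots> \<longleftrightarrow> (\<forall>x\<in>E w. sc x \<in> E w)"
    using in_E_iff E_in by metis
  finally have 3: "(\<forall>x\<in>M. x \<epsilon> w \<longrightarrow> (\<exists>y\<in>M. is_succ_in mem M x y \<and> y \<epsilon> w)) \<longleftrightarrow>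
      (\<forall>x\<in>E w. sc x \<in> E w)" .
  show ?thesis unfolding inductive_in_def 1 3 ..
qed

lemma mset_Om [simp, intro]: "mset Om"
proof -
  obtain w where w: "w \<in> M" "inductive_in mem M w"
    using infinity by (auto simp: infinity_in_def)
  have "mset {x \<in> E w. \<forall>w\<in>M. inductive_in mem M w \<longrightarrow> x \<in> E w}"
    by (intro mset_sep mset_E w(1) dfn_intros dfn_single[OF dfn_inductive_in])
  moreover have "{x \<in> E w. \<forall>w\<in>M. inductive_in mem M w \<longrightarrow> x \<in> E w} = Om"
    unfolding Om_def naturals_in_def E_def using w by auto
  ultimately show ?thesis by simp
qed

lemma Om_iff: "x \<in> Om \<longleftrightarrow> x \<in> M \<and> (\<forall>w\<in>M. inductive_in mem M w \<longrightarrow> x \<in> E w)"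
  unfolding Om_def naturals_in_def E_def by auto

lemma Om_in: "x \<in> Om \<Longrightarrow> x \<in> M"
  by (simp add: Om_iff)

lemma Om_zero [simp, intro]: "zero \<in> Om"
  by (simp add: Om_iff inductive_in_iff)

lemma Om_sc [simp, intro]: "x \<in> Om \<Longrightarrow> sc x \<in> Om"
  by (simp add: Om_iff inductive_in_iff)

text \<open>\<open>Om\<close> may contain nonstandard numbers, so only predicates definable in the
  model are allowed: for these, the numbers satisfying \<open>P\<close> form a coded inductive
  set.\<close>

lemma Om_induct:
  assumes "x \<in> Om" "dfn (\<lambda>_ e. P (e 0))" "P zero" "\<And>x. x \<in> Om \<Longrightarrow> P x \<Longrightarrow> P (sc x)"
  shows "P x"
proof -
  have m: "mset {x \<in> Om. P x}" by (intro mset_sep assms mset_Om)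
  have "inductive_in mem M (cd {x \<in> Om. P x})"
    using assms(3,4) m by (simp add: inductive_in_iff)
  then have "x \<in> E (cd {x \<in> Om. P x})" using assms(1) m by (auto simp: Om_iff)
  then show ?thesis using m by simp
qed

declare dfn_eq [dfn_intros del]

lemma dfn_eq_sc [dfn_intros]:
  assumes "trm t" "trm s" shows "dfn (\<lambda>_ e. t e = sc (s e))"
proof (rule dfn_cong1)
  show "(t e = sc (s e)) = is_succ_in mem M (s e) (t e)" if "range e \<subseteq> M" for e
    using that assms by (simp add: is_succ_in_iff trm_in_M)
  show "dfn (\<lambda>_ e. is_succ_in mem M (s e) (t e))"
    by (rule dfn_single[OF dfn_is_succ_in]) (fact assms)+
qed

declare dfn_eq [dfn_intros]

lemma dfn_subset_E [dfn_intros]: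
  assumes "trm t" "trm s" shows "dfn (\<lambda>_ e. E (t e) \<subseteq> E (s e))"
  unfolding subset_eq by (intro dfn_intros trm_shift assms)

lemma dfn_subset_mset [dfn_intros]:
  assumes "mset A" "trm s" shows "dfn (\<lambda>_ e. A \<subseteq> E (s e))"
  unfolding subset_eq by (intro dfn_intros trm_shift assms)

lemma dfn_mset_subset [dfn_intros]:
  assumes "mset A" "trm s" shows "dfn (\<lambda>_ e. E (s e) \<subseteq> A)"
  unfolding subset_eq by (intro dfn_intros trm_shift assms)

section \<open>Coded products\<close>

definition pp :: "'u set \<Rightarrow> 'u set \<Rightarrow> 'u set" where
  "pp A B = prs (A \<times> B)"

lemma mset_pp [intro]: "mset A \<Longrightarrow> mset B \<Longrightarrow> mset (pp A B)"
  unfolding pp_def by (rule mset_prs_Times)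

lemma pp_iff: "p \<in> pp A B \<longleftrightarrow> (\<exists>x\<in>A. \<exists>y\<in>B. p = pr x y)"
  unfolding pp_def by (auto simp: prs_iff)

lemma pp_Un_left: "pp (A \<union> B) C = pp A C \<union> pp B C"
  unfolding pp_def prs_def by (simp add: Sigma_Un_distrib1 image_Un)

lemma pp_empty [simp]: "pp {} C = {}" "pp C {} = {}"
  by (auto simp: pp_iff)

lemma pp_disjoint: "A \<subseteq> M \<Longrightarrow> B \<subseteq> M \<Longrightarrow> C \<subseteq> M \<Longrightarrow> A \<inter> B = {} \<Longrightarrow> pp A C \<inter> pp B C = {}"
proof (rule ccontr)
  assume *: "A \<subseteq> M" "B \<subseteq> M" "C \<subseteq> M" "A \<inter> B = {}" "pp A C \<inter> pp B C \<noteq> {}"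
  then obtain p where "p \<in> pp A C" "p \<in> pp B C" by blast
  then obtain a c b d where "a \<in> A" "c \<in> C" "b \<in> B" "d \<in> C" "p = pr a c" "pr a c = pr b d"
    by (auto simp: pp_iff)
  moreover from this have "a = b" using * by (subst (asm) pr_inject) auto
  ultimately show False using *(4) by blast
qed

lemma product_in_eq:
  assumes "a \<in> M" "b \<in> M" shows "product_in mem M a b = cd (pp (E a) (E b))"
  unfolding product_in_def
proof (rule the_equality)
  have m: "mset (pp (E a) (E b))" using assms by (simp add: mset_pp mset_E)
  have *: "(\<exists>x\<in>M. \<exists>y\<in>M. x \<epsilon> a \<and> y \<epsilon> b \<and> is_pair_in mem M x y p) \<longleftrightarrow> p \<in> pp (E a) (E b)"
    if "p \<in> M" for p
    using that by (auto simp: pp_iff is_pair_in_iff E_def)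
  then show "cd (pp (E a) (E b)) \<in> M \<and> (\<forall>p\<in>M. p \<epsilon> cd (pp (E a) (E b)) \<longleftrightarrow>
      (\<exists>x\<in>M. \<exists>y\<in>M. x \<epsilon> a \<and> y \<epsilon> b \<and> is_pair_in mem M x y p))"
    using m by (simp flip: in_E_iff)
  fix q assume q: "q \<in> M \<and> (\<forall>p\<in>M. p \<epsilon> q \<longleftrightarrow>
      (\<exists>x\<in>M. \<exists>y\<in>M. x \<epsilon> a \<and> y \<epsilon> b \<and> is_pair_in mem M x y p))"
  show "q = cd (pp (E a) (E b))"
  proof (rule E_eqI)
    fix p assume p: "p \<in> M"
    show "p \<in> E q \<longleftrightarrow> p \<in> E (cd (pp (E a) (E b)))"
      using q p *[OF p] m by (simp add: in_E_iff[of p q])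
  qed (use q m in simp_all)
qed

lemma dfn_E_eq_pp:
  assumes "trm r" "trm t" "trm s" shows "dfn (\<lambda>_ e. E (r e) = pp (E (t e)) (E (s e)))"
proof (rule dfn_cong1)
  let ?P = "\<lambda>q a b. \<forall>p\<in>M. p \<in> E q \<longleftrightarrow> (\<exists>x\<in>E a. \<exists>y\<in>E b. p = pr x y)"
  show "(E (r e) = pp (E (t e)) (E (s e))) = ?P (r e) (t e) (s e)" if "range e \<subseteq> M" for e
  proof
    have m: "mset (pp (E (t e)) (E (s e)))"
      using that assms by (intro mset_pp mset_E trm_in_M)
    assume P: "?P (r e) (t e) (s e)"
    show "E (r e) = pp (E (t e)) (E (s e))"
    proof (intro set_eqI)
      fix p show "p \<in> E (r e) \<longleftrightarrow> p \<in> pp (E (t e)) (E (s e))"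
      proof (cases "p \<in> M")
        case True
        then show ?thesis using P by (simp add: pp_iff)
      next
        case False
        then show ?thesis using mset_in[OF m, of p] E_in[of p "r e"] by blast
      qed
    qed
  qed (simp add: pp_iff)
  show "dfn (\<lambda>_ e. ?P (r e) (t e) (s e))"
    by (intro dfn_intros trm_shift assms)
qed

lemma dfn_lep_pp:
  assumes "trm t" "trm s" "trm r" shows "dfn (\<lambda>_ e. lep (pp (E (t e)) (E (s e))) (E (r e)))"
proof (rule dfn_cong1)
  show "lep (pp (E (t e)) (E (s e))) (E (r e)) =
      (\<exists>q\<in>M. E q = pp (E (t e)) (E (s e)) \<and> lep (E q) (E (r e)))" if "range e \<subseteq> M" for e
  proof -
    have "mset (pp (E (t e)) (E (s e)))"
      using that assms by (intro mset_pp mset_E trm_in_M)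
    then obtain q where "q \<in> M" "E q = pp (E (t e)) (E (s e))" by (auto simp: mset_def)
    then show ?thesis by auto
  qed
  show "dfn (\<lambda>_ e. \<exists>q\<in>M. E q = pp (E (t e)) (E (s e)) \<and> lep (E q) (E (r e)))"
    by (intro dfn_E_eq_pp dfn_intros trm_shift assms)
qed

lemma dfn_lep_pp_right:
  assumes "trm t" "trm s" "trm r" shows "dfn (\<lambda>_ e. lep (E (r e)) (pp (E (t e)) (E (s e))))"
proof (rule dfn_cong1)
  show "lep (E (r e)) (pp (E (t e)) (E (s e))) =
      (\<exists>q\<in>M. E q = pp (E (t e)) (E (s e)) \<and> lep (E (r e)) (E q))" if "range e \<subseteq> M" for e
  proof -
    have "mset (pp (E (t e)) (E (s e)))"
      using that assms by (intro mset_pp mset_E trm_in_M)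
    then obtain q where "q \<in> M" "E q = pp (E (t e)) (E (s e))" by (auto simp: mset_def)
    then show ?thesis by auto
  qed
  show "dfn (\<lambda>_ e. \<exists>q\<in>M. E q = pp (E (t e)) (E (s e)) \<and> lep (E (r e)) (E q))"
    by (intro dfn_E_eq_pp dfn_intros trm_shift assms)
qed

lemma lep_mono_right: "lep A B \<Longrightarrow> B \<subseteq> C \<Longrightarrow> lep A C"
  unfolding lep_def injrel_def by fast

lemma lep_Un_disjoint:
  assumes "lep A U" "lep B V" "U \<inter> V = {}" "mset A" "mset B" "mset V"
  shows "lep (A \<union> B) (U \<union> V)"
proof -
  obtain R S where R: "mrel R" "injrel R A U" and S: "mrel S" "injrel S B V"
    using assms(1,2) by (auto simp: lep_def)
  \<comment> \<open>\<open>A\<close> and \<open>B\<close> may overlap; \<open>S\<close> is used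
    outside \<open>A\<close> only.\<close>
  let ?T = "R \<union> (S \<inter> (B - A) \<times> V)"
  have "mrel ?T" by (intro mrel_Un R mrel_restrict S mset_Diff assms)
  moreover have "injrel ?T (A \<union> B) (U \<union> V)"
    unfolding injrel_def
  proof (intro conjI)
    show "?T \<subseteq> (A \<union> B) \<times> (U \<union> V)" using R(2) by (auto simp: injrel_def)
    show "A \<union> B \<subseteq> Domain ?T"
    proof
      fix x assume x: "x \<in> A \<union> B"
      show "x \<in> Domain ?T"
      proof (cases "x \<in> A")
        case True
        then show ?thesis using R(2) by (auto simp: injrel_def)
      next
        case False
        then obtain y where "(x, y) \<in> S" using x S(2) by (auto simp: injrel_def)
        then show ?thesis using S(2) False x by (auto simp: injrel_def)
      qed
    qed
    have RA: "R \<subseteq> A \<times> U" using R(2) by (simp add: injrel_def)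
    show "single_valued ?T"
      using R(2) S(2) RA unfolding injrel_def single_valued_def by blast
    show "single_valued (?T\<inverse>)"
      using R(2) S(2) RA assms(3) unfolding injrel_def single_valued_def by blast
  qed
  ultimately show ?thesis unfolding lep_def by blast
qed

lemma eqp_pp_single:
  assumes "mset A" "z \<in> M" shows "eqp A (pp {z} A)"
proof -
  let ?R = "{(x, p). x \<in> A \<and> p \<in> pp {z} A \<and> p = pr z x}"
  have A: "A \<subseteq> M" by (rule mset_subset[OF assms(1)])
  have "mrel ?R" by (intro mrel_Collect assms mset_pp mset_single dfn_intros)
  moreover have "injrel ?R A (pp {z} A)" "pp {z} A \<subseteq> Range ?R"
    using A assms(2) unfolding injrel_def single_valued_def by (auto simp: pp_iff subset_iff)
  ultimately show ?thesis unfolding eqp_def by blast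
qed

text \<open>A further set of size at most \<open>C\<close> costs a further copy of \<open>C\<close>.
  Repeated \<open>n\<close> times, this bounds a union of \<open>n\<close> sets of size at most
  \<kappa> by \<open>n \<kappa>\<close>.\<close>

lemma lep_Un_pp:
  assumes "lep A (pp U C)" "lep B C" "v \<in> M" "v \<notin> U" "mset A" "mset B" "mset C" "mset U"
  shows "lep (A \<union> B) (pp (insert v U) C)"
proof -
  have "lep B (pp {v} C)"
    using lep_trans[OF assms(2) eqp_imp_lep[OF eqp_pp_single]] assms(3,7) by blast
  then have "lep (A \<union> B) (pp U C \<union> pp {v} C)"
    using assms by (intro lep_Un_disjoint pp_disjoint mset_pp mset_single mset_subset) auto
  then show ?thesis by (simp add: pp_Un_left[symmetric])
qed

lemma lep_pp_mono:
  assumes "lep A B" "mset U" "mset A" "mset B" shows "lep (pp U A) (pp U B)"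
proof -
  obtain R where R: "mrel R" "injrel R A B" using assms(1) by (auto simp: lep_def)
  have sub: "U \<subseteq> M" "A \<subseteq> M" "B \<subseteq> M" using assms mset_subset by auto
  let ?P = "\<lambda>p q. \<exists>u\<in>U. \<exists>x\<in>A. \<exists>y\<in>B. p = pr u x \<and> q = pr u y \<and> (x, y) \<in> R"
  show ?thesis
  proof (rule lepI[of _ _ ?P])
    show "dfn (\<lambda>_ e. ?P (e 0) (e (Suc 0)))" by (intro dfn_intros assms R)
    fix p assume "p \<in> pp U A"
    then obtain u x where ux: "u \<in> U" "x \<in> A" "p = pr u x" by (auto simp: pp_iff)
    then obtain y where "(x, y) \<in> R" "y \<in> B" using R(2) unfolding injrel_def by blast
    then have "?P p (pr u y)" "pr u y \<in> pp U B"
      using ux by (blast, auto simp: pp_iff)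
    then show "\<exists>y\<in>pp U B. ?P p y" by blast
  next
    fix p q r assume "?P p q" "?P p r"
    then obtain u x y u' x' y' where *: "u \<in> U" "x \<in> A" "y \<in> B" "p = pr u x" "q = pr u y" "(x, y) \<in> R"
      "u' \<in> U" "x' \<in> A" "y' \<in> B" "p = pr u' x'" "r = pr u' y'" "(x', y') \<in> R" by blast
    then have "u = u' \<and> x = x'" using sub by (metis pr_inject subsetD)
    moreover from this have "y = y'" using * R(2) unfolding injrel_def single_valued_def by blast
    ultimately show "q = r" using * by simp
  next
    fix p q r assume "?P p r" "?P q r"
    then obtain u x y u' x' y' where *: "u \<in> U" "x \<in> A" "y \<in> B" "p = pr u x" "r = pr u y" "(x, y) \<in> R"
      "u' \<in> U" "x' \<in> A" "y' \<in> B" "q = pr u' x'" "r = pr u' y'" "(x', y') \<in> R" by blast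
    then have "u = u' \<and> y = y'" using sub by (metis pr_inject subsetD)
    moreover from this have "x = x'" using * R(2) unfolding injrel_def single_valued_def by blast
    ultimately show "p = q" using * by simp
  qed (use assms in \<open>auto intro: mset_pp\<close>)
qed

end

section \<open>Ordinals\<close>

locale zfc_model = base_model mem st full M
  for mem :: "'u \<Rightarrow> 'u \<Rightarrow> bool" (infix "\<epsilon>" 50) and st full and M :: "'u set" +
  assumes power: "power_in mem M"
    and regularity: "regularity_in mem M"
    and choice: "\<forall>a\<in>M. has_choice_in mem M a"
begin

lemma subset_in_iff: "x \<in> M \<Longrightarrow> subset_in mem M x a \<longleftrightarrow> E x \<subseteq> E a"
  by (auto simp: subset_in_def E_def)

lemma mset_Pow:
  assumes "mset A" shows "mset {x \<in> M. E x \<subseteq> A}"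
proof -
  obtain b where b: "b \<in> M" "\<forall>x\<in>M. x \<epsilon> b \<longleftrightarrow> subset_in mem M x (cd A)"
    by (rule bexE[OF power[unfolded power_in_def, rule_format, OF cd_in[OF assms]]])
  show ?thesis
    by (rule mset_eqI[OF b(1)]) (use b(2) assms in \<open>auto simp: subset_in_iff\<close>)
qed

lemma foundation:
  assumes "mset A" "A \<noteq> {}" obtains x where "x \<in> A" "E x \<inter> A = {}"
proof -
  have "nonempty_in mem M (cd A)" using assms by (simp add: nonempty_in_iff)
  then obtain x where "x \<in> M" "x \<epsilon> cd A" "\<not> (\<exists>y\<in>M. y \<epsilon> x \<and> y \<epsilon> cd A)"
    using regularity cd_in[OF assms(1)] unfolding regularity_in_def by blast
  moreover from this have "x \<in> A" using assms(1) by (simp flip: in_E_iff)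
  moreover have "y \<notin> A" if "y \<in> E x" for y
    using calculation(3) that assms(1) E_in[OF that] by (auto simp flip: in_E_iff)
  ultimately show thesis using that by blast
qed

lemma minimal:
  assumes "x \<in> A" "P x" "mset A" "dfn (\<lambda>_ e. P (e 0))"
  obtains y where "y \<in> A" "P y" "\<And>z. z \<in> A \<Longrightarrow> z \<in> E y \<Longrightarrow> \<not> P z"
proof -
  have "mset {x \<in> A. P x}" "{x \<in> A. P x} \<noteq> {}" using assms mset_sep by auto
  from foundation[OF this] obtain y where "y \<in> {x \<in> A. P x}" "E y \<inter> {x \<in> A. P x} = {}" by blast
  then show thesis using that[of y] by blast
qed

lemma mem_irrefl: "x \<in> M \<Longrightarrow> x \<notin> E x"
  using foundation[OF mset_single, of x] by blast

lemma mem_asym: "x \<in> E y \<Longrightarrow> y \<notin> E x"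
proof
  assume *: "x \<in> E y" "y \<in> E x"
  then have "mset {x, y}" using E_in by blast
  from foundation[OF this] * show False by blast
qed

lemma mem_no_3cycle: "x \<in> E y \<Longrightarrow> y \<in> E z \<Longrightarrow> z \<notin> E x"
proof
  assume *: "x \<in> E y" "y \<in> E z" "z \<in> E x"
  then have "mset {x, y, z}" using E_in by blast
  from foundation[OF this] * show False by blast
qed

text \<open>Membership on \<open>a\<close> is well-founded by Regularity in \<open>M\<close>, which
  is what relates this to \<open>is_ordinal_in\<close>.\<close>

definition Ord :: "'u \<Rightarrow> bool" where
  "Ord a \<longleftrightarrow> a \<in> M \<and> (\<forall>x\<in>E a. E x \<subseteq> E a) \<and> (\<forall>x\<in>E a. \<forall>y\<in>E a. x \<in> E y \<or> x = y \<or> y \<in> E x)"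

lemma Ord_in: "Ord a \<Longrightarrow> a \<in> M"
  by (simp add: Ord_def)

lemma Ord_trans: "Ord a \<Longrightarrow> x \<in> E a \<Longrightarrow> E x \<subseteq> E a"
  by (simp add: Ord_def)

lemma is_ordinal_in_iff: "a \<in> M \<Longrightarrow> is_ordinal_in mem M a \<longleftrightarrow> Ord a"
proof -
  assume a: "a \<in> M"
  have 1: "transitive_in mem M a \<longleftrightarrow> (\<forall>x\<in>E a. E x \<subseteq> E a)"
    unfolding transitive_in_def using in_E_iff E_in subset_in_iff by metis
  have 2: "wellfounded_on_in mem M a"
    unfolding wellfounded_on_in_def
  proof (intro ballI impI)
    fix u assume u: "u \<in> M" "subset_in mem M u a \<and> nonempty_in mem M u"
    then have "mset (E u)" "E u \<noteq> {}" by (simp_all add: mset_E nonempty_in_iff)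
    from foundation[OF this] obtain x where "x \<in> E u" "E x \<inter> E u = {}" by blast
    then show "\<exists>x\<in>M. x \<epsilon> u \<and> \<not> (\<exists>y\<in>M. y \<epsilon> u \<and> y \<epsilon> x)"
      by (intro bexI[of _ x]) (auto simp: E_def)
  qed
  have 3: "(\<forall>x\<in>M. \<forall>y\<in>M. x \<epsilon> a \<and> y \<epsilon> a \<longrightarrow> x \<epsilon> y \<or> x = y \<or> y \<epsilon> x) \<longleftrightarrow>
      (\<forall>x\<in>E a. \<forall>y\<in>E a. x \<in> E y \<or> x = y \<or> y \<in> E x)"
    unfolding E_def by blast
  show ?thesis unfolding is_ordinal_in_def Ord_def 1 3 using 2 a by simp
qed

lemma dfn_Ord [dfn_intros]:
  assumes "trm t" shows "dfn (\<lambda>_ e. Ord (t e))"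
proof (rule dfn_cong1)
  let ?P = "\<lambda>a. (\<forall>x\<in>E a. E x \<subseteq> E a) \<and> (\<forall>x\<in>E a. \<forall>y\<in>E a. x \<in> E y \<or> x = y \<or> y \<in> E x)"
  show "Ord (t e) = ?P (t e)" if "range e \<subseteq> M" for e
    unfolding Ord_def using trm_in_M[OF assms that] by simp
  show "dfn (\<lambda>_ e. ?P (t e))"
    by (intro dfn_intros trm_shift assms)
qed

lemma Ord_elem:
  assumes "Ord a" "x \<in> E a" shows "Ord x"
  unfolding Ord_def
proof (intro conjI ballI)
  show "x \<in> M" using assms E_in by blast
  have sub: "E x \<subseteq> E a" by (rule Ord_trans[OF assms])
  fix y assume y: "y \<in> E x"
  show "E y \<subseteq> E x"
  proof
    fix z assume z: "z \<in> E y"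
    have "z \<in> E a" using z y sub Ord_trans[OF assms(1)] by blast
    then have "z \<in> E x \<or> z = x \<or> x \<in> E z" using assms unfolding Ord_def by blast
    then show "z \<in> E x" using y z mem_asym mem_no_3cycle by blast
  qed
  fix z assume "z \<in> E x"
  then show "y \<in> E z \<or> y = z \<or> z \<in> E y" using y sub assms(1) unfolding Ord_def by blast
qed

text \<open>Unless the two are equal, a membership-minimal element of \<open>E b - E a\<close> has
  the same elements as \<open>a\<close>, hence is \<open>a\<close>.\<close>

lemma Ord_subset_cases:
  assumes "Ord a" "Ord b" "E a \<subseteq> E b" shows "a \<in> E b \<or> a = b"
proof (rule disjCI)
  assume ne: "a \<noteq> b"
  have "E b - E a \<noteq> {}"
    using E_eqD[of a b] ne assms Ord_in by blast
  moreover have "mset (E b - E a)" using assms by (intro mset_Diff mset_E Ord_in)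
  ultimately obtain x where x: "x \<in> E b - E a" "E x \<inter> (E b - E a) = {}"
    using foundation by blast
  have "E x = E a"
  proof
    show "E x \<subseteq> E a" using x Ord_trans[OF assms(2)] by blast
    show "E a \<subseteq> E x"
    proof
      fix y assume y: "y \<in> E a"
      then have "y \<in> E x \<or> y = x \<or> x \<in> E y" using x assms(2,3) unfolding Ord_def by blast
      then show "y \<in> E x" using x y Ord_trans[OF assms(1) y] by blast
    qed
  qed
  then have "x = a" using x E_in Ord_in[OF assms(1)] by (intro E_eqD) auto
  then show "a \<in> E b" using x by blast
qed

text \<open>The intersection is an ordinal included in both. If it differed from both, it would be
  an element of both and therefore of itself.\<close>

lemma Ord_linear:
  assumes "Ord a" "Ord b" shows "a \<in> E b \<or> a = b \<or> b \<in> E a"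
proof -
  let ?c = "cd (E a \<inter> E b)"
  have m: "mset (E a \<inter> E b)" using assms by (intro mset_Int mset_E Ord_in)
  have c: "Ord ?c"
    using m assms unfolding Ord_def by (simp add: subset_iff) blast
  have "?c \<in> E a \<or> ?c = a" "?c \<in> E b \<or> ?c = b"
    by (intro Ord_subset_cases c assms; simp add: m)+
  moreover have "\<not> (?c \<in> E a \<and> ?c \<in> E b)"
    using mem_irrefl[of ?c] m by auto
  ultimately show ?thesis by metis
qed

lemma Ord_not_mem: "Ord a \<Longrightarrow> Ord b \<Longrightarrow> a \<notin> E b \<Longrightarrow> E b \<subseteq> E a"
  using Ord_linear Ord_trans by blast

lemma Ord_least:
  assumes "Ord a" "P a" "dfn (\<lambda>_ e. P (e 0))"
  obtains b where "Ord b" "P b" "\<And>c. c \<in> E b \<Longrightarrow> \<not> P c"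
proof -
  have "mset (insert a (E a))" using assms(1) Ord_in by (intro mset_insert mset_E)
  from minimal[OF insertI1 assms(2) this assms(3)] obtain b where
    b: "b \<in> insert a (E a)" "P b" "\<And>z. z \<in> insert a (E a) \<Longrightarrow> z \<in> E b \<Longrightarrow> \<not> P z" by blast
  have "E b \<subseteq> insert a (E a)" using b(1) Ord_trans[OF assms(1)] by blast
  then show thesis
    using b assms(1) Ord_elem by (intro that[of b]) blast+
qed

lemma Ord_zero: "Ord zero"
  by (simp add: Ord_def)

lemma Ord_sc: "Ord x \<Longrightarrow> Ord (sc x)"
  using Ord_in[of x] unfolding Ord_def by auto

lemma Om_Ord: "n \<in> Om \<Longrightarrow> Ord n"
  by (rule Om_induct[of n Ord]) (auto intro: dfn_intros Ord_zero Ord_sc)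

lemma Om_trans: "n \<in> Om \<Longrightarrow> E n \<subseteq> Om"
proof (rule Om_induct[of n "\<lambda>n. E n \<subseteq> Om"])
  show "dfn (\<lambda>_ e. E (e 0) \<subseteq> Om)" by (intro dfn_intros mset_Om)
qed (auto simp: Om_in)

lemma Ord_Om: "Ord (cd Om)"
  unfolding Ord_def using Om_trans Om_Ord Ord_linear by simp

lemma Om_subset: "Ord k \<Longrightarrow> k \<notin> Om \<Longrightarrow> Om \<subseteq> E k"
  using Ord_not_mem[of k "cd Om"] Ord_Om by simp

lemma sc_inject: "Ord x \<Longrightarrow> Ord y \<Longrightarrow> sc x = sc y \<longleftrightarrow> x = y"
  by (metis E_sc Ord_in insert_iff mem_asym)

section \<open>Well-ordering and cardinals\<close>

text \<open>Enumeration of \<open>A\<close> along the ordinals, where \<open>C s\<close> selects the next element out of the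
  set \<open>s\<close> of the remaining ones. The enumeration is the union of all partial ones; since its
  inverse is a function on \<open>A\<close>, Replacement makes its domain a set.\<close>

lemma enumeration:
  assumes A: "mset A" and C: "dfn (\<lambda>_ e. C (e 0) (e (Suc 0)))"
    and select: "\<forall>s\<in>M. E s \<subseteq> A \<and> E s \<noteq> {} \<longrightarrow> (\<exists>!y. y \<in> E s \<and> C s y)"
  obtains \<theta> G where "Ord \<theta>" "mrel G" "injrel G (E \<theta>) A" "A \<subseteq> Range G"
    "\<forall>\<beta> y. (\<beta>, y) \<in> G \<longrightarrow> (\<exists>s\<in>M. E s = A - G `` E \<beta> \<and> y \<in> E s \<and> C s y)"
proof -
  \<comment> \<open>\<open>rest\<close> describes what remains of \<open>A\<close> after the stages
    below \<beta>, \<open>att\<close> the partial enumerations that are correct below \<alpha>, and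
    \<open>R\<close> the union of these. Nothing is required of \<open>f\<close> from stage \<alpha>
    on, so two of them are compared only at stages where both are correct.\<close>
  define rest where "rest s \<beta> f \<longleftrightarrow> (\<forall>z\<in>M. z \<in> E s \<longleftrightarrow> z \<in> A \<and> (\<forall>\<gamma>\<in>E \<beta>. pr \<gamma> z \<notin> E f))" for s \<beta> f
  define att where "att f \<alpha> \<longleftrightarrow> Ord \<alpha> \<and> (\<forall>\<beta>\<in>E \<alpha>. \<exists>s\<in>M. \<exists>y\<in>M. rest s \<beta> f \<and> y \<in> E s \<and> C s y \<and>
      (\<forall>z\<in>M. pr \<beta> z \<in> E f \<longleftrightarrow> z = y))" for f \<alpha>
  define R where "R \<gamma> z \<longleftrightarrow> (\<exists>f\<in>M. \<exists>\<alpha>\<in>M. att f \<alpha> \<and> \<gamma> \<in> E \<alpha> \<and> pr \<gamma> z \<in> E f)" for \<gamma> z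
  have ch: "\<exists>!y. y \<in> E s \<and> C s y" if "s \<in> M" "E s \<subseteq> A" "E s \<noteq> {}" for s
    using select[THEN bspec, OF that(1)] that(2,3) by simp
  have AM: "A \<subseteq> M" by (rule mset_subset[OF A])
  have dR: "dfn (\<lambda>_ e. R (e 0) (e (Suc 0)))"
    unfolding R_def att_def rest_def by (intro dfn_intros dfn_subst2[OF C] trm_shift A)
  have attD: "\<exists>s\<in>M. \<exists>y\<in>M. rest s \<beta> f \<and> y \<in> E s \<and> C s y \<and> (\<forall>z\<in>M. pr \<beta> z \<in> E f \<longleftrightarrow> z = y)"
    if "att f \<alpha>" "\<beta> \<in> E \<alpha>" for f \<alpha> \<beta>
    using that unfolding att_def by blast
  have restA: "E s \<subseteq> A" if "rest s \<beta> f" for s \<beta> f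
    using that E_in unfolding rest_def by blast
  \<comment> \<open>At the least stage of disagreement the remaining sets coincide, and so do the
    elements selected from them.\<close>
  have uniq: "pr \<gamma> z \<in> E f \<longleftrightarrow> pr \<gamma> z \<in> E g"
    if att: "att f \<alpha>" "att g \<beta>" and \<gamma>: "\<gamma> \<in> E \<alpha>" "\<gamma> \<in> E \<beta>" and z: "z \<in> M" and fg: "f \<in> M" "g \<in> M"
    for f g \<alpha> \<beta> \<gamma> z
  proof (rule ccontr)
    let ?P = "\<lambda>\<gamma>. \<gamma> \<in> E \<beta> \<and> (\<exists>z\<in>M. \<not> (pr \<gamma> z \<in> E f \<longleftrightarrow> pr \<gamma> z \<in> E g))"
    assume "\<not> (pr \<gamma> z \<in> E f \<longleftrightarrow> pr \<gamma> z \<in> E g)"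
    then have P: "?P \<gamma>" using z \<gamma> by blast
    have o: "Ord \<alpha>" "Ord \<beta>" using att by (simp_all add: att_def)
    have "mset (E \<alpha>)" "\<beta> \<in> M" using o Ord_in mset_E by blast+
    moreover have "dfn (\<lambda>_ e. ?P (e 0))" by (intro dfn_intros \<open>\<beta> \<in> M\<close> fg)
    ultimately obtain \<delta> where \<delta>: "\<delta> \<in> E \<alpha>" "?P \<delta>" "\<And>z. z \<in> E \<alpha> \<Longrightarrow> z \<in> E \<delta> \<Longrightarrow> \<not> ?P z"
      using minimal[of \<gamma> "E \<alpha>" ?P, OF \<gamma>(1) P] by blast
    have \<delta>\<beta>: "\<delta> \<in> E \<beta>" using \<delta>(2) by blast
    have agree: "pr \<eta> z \<in> E f \<longleftrightarrow> pr \<eta> z \<in> E g" if "\<eta> \<in> E \<delta>" "z \<in> M" for \<eta> z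
    proof -
      have "\<eta> \<in> E \<alpha>" "\<eta> \<in> E \<beta>" using that \<delta>(1) \<delta>\<beta> Ord_trans o by blast+
      then show ?thesis using \<delta>(3)[OF _ that(1)] that(2) by blast
    qed
    obtain s y where s: "s \<in> M" "y \<in> M" "rest s \<delta> f" "y \<in> E s" "C s y"
      "\<forall>z\<in>M. pr \<delta> z \<in> E f \<longleftrightarrow> z = y" using attD[OF att(1) \<delta>(1)] by (elim bexE conjE)
    obtain s' y' where s': "s' \<in> M" "y' \<in> M" "rest s' \<delta> g" "y' \<in> E s'" "C s' y'"
      "\<forall>z\<in>M. pr \<delta> z \<in> E g \<longleftrightarrow> z = y'" using attD[OF att(2) \<delta>\<beta>] by (elim bexE conjE)
    have "s = s'"
      using s(1) s'(1)
    proof (rule E_eqI)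
      fix z assume z: "z \<in> M"
      show "z \<in> E s \<longleftrightarrow> z \<in> E s'"
        using s(3) s'(3) z agree[OF _ z] by (simp add: rest_def)
    qed
    moreover have "E s \<subseteq> A" using restA s(3) by blast
    ultimately have "y = y'" using ch[OF s(1)] s(4,5) s'(4,5) by blast
    then show False using s(6) s'(6) \<delta>(2) by simp
  qed
  have rest_R: "z \<in> E s \<longleftrightarrow> z \<in> A \<and> (\<forall>\<delta>\<in>E \<gamma>. \<not> R \<delta> z)"
    if f: "f \<in> M" "att f \<alpha>" "\<gamma> \<in> E \<alpha>" "rest s \<gamma> f" and z: "z \<in> M" for f \<alpha> \<gamma> s z
  proof -
    have "R \<delta> z \<longleftrightarrow> pr \<delta> z \<in> E f" if \<delta>: "\<delta> \<in> E \<gamma>" for \<delta>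
    proof
      have \<delta>\<alpha>: "\<delta> \<in> E \<alpha>" using \<delta> f(2,3) Ord_trans unfolding att_def by blast
      show "R \<delta> z" if "pr \<delta> z \<in> E f"
        unfolding R_def using that f(1,2) \<delta>\<alpha> Ord_in by (auto simp: att_def)
      assume "R \<delta> z"
      then obtain g \<beta> where g: "g \<in> M" "att g \<beta>" "\<delta> \<in> E \<beta>" "pr \<delta> z \<in> E g"
        unfolding R_def by blast
      then show "pr \<delta> z \<in> E f" using uniq[OF g(2) f(2) g(3) \<delta>\<alpha> z g(1) f(1)] by simp
    qed
    then show ?thesis using f(4) z unfolding rest_def by simp
  qed
  have R_step: "\<exists>s\<in>M. (\<forall>x\<in>M. x \<in> E s \<longleftrightarrow> x \<in> A \<and> (\<forall>\<delta>\<in>E \<gamma>. \<not> R \<delta> x)) \<and> z \<in> E s \<and> C s z"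
    if "R \<gamma> z" "z \<in> M" for \<gamma> z
  proof -
    obtain f \<alpha> where f: "f \<in> M" "att f \<alpha>" "\<gamma> \<in> E \<alpha>" "pr \<gamma> z \<in> E f" using \<open>R \<gamma> z\<close> unfolding R_def by blast
    obtain s y where s: "s \<in> M" "y \<in> M" "rest s \<gamma> f" "y \<in> E s" "C s y"
      "\<forall>z\<in>M. pr \<gamma> z \<in> E f \<longleftrightarrow> z = y" using attD[OF f(2,3)] by (elim bexE conjE)
    have "z = y" using s(6) f(4) that(2) by blast
    moreover have "\<forall>x\<in>M. x \<in> E s \<longleftrightarrow> x \<in> A \<and> (\<forall>\<delta>\<in>E \<gamma>. \<not> R \<delta> x)"
      using rest_R[OF f(1-3) s(3)] by simp
    ultimately show ?thesis using s(1,4,5) by blast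
  qed
  have R_Ord: "Ord \<gamma>" if "R \<gamma> z" for \<gamma> z
    using that Ord_elem unfolding R_def att_def by blast
  have R_sv: "z = z'" if R: "R \<gamma> z" "R \<gamma> z'" "z \<in> M" "z' \<in> M" for \<gamma> z z'
  proof -
    obtain s where s: "s \<in> M" "\<forall>x\<in>M. x \<in> E s \<longleftrightarrow> x \<in> A \<and> (\<forall>\<delta>\<in>E \<gamma>. \<not> R \<delta> x)" "z \<in> E s" "C s z"
      using R_step[OF R(1,3)] by (elim bexE conjE)
    obtain s' where s': "s' \<in> M" "\<forall>x\<in>M. x \<in> E s' \<longleftrightarrow> x \<in> A \<and> (\<forall>\<delta>\<in>E \<gamma>. \<not> R \<delta> x)" "z' \<in> E s'" "C s' z'"
      using R_step[OF R(2,4)] by (elim bexE conjE)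
    have "s = s'" using s(1) s'(1) by (rule E_eqI) (simp add: s(2) s'(2))
    moreover have "E s \<subseteq> A" using s(2) E_in by blast
    ultimately show ?thesis using ch[OF s(1)] s(3,4) s'(3,4) by blast
  qed
  have R_not: "\<not> R \<gamma> z" if R: "R \<gamma>' z" "z \<in> M" "\<gamma> \<in> E \<gamma>'" for \<gamma> \<gamma>' z
  proof -
    obtain s where s: "s \<in> M" "\<forall>x\<in>M. x \<in> E s \<longleftrightarrow> x \<in> A \<and> (\<forall>\<delta>\<in>E \<gamma>'. \<not> R \<delta> x)" "z \<in> E s"
      using R_step[OF R(1,2)] by (elim bexE conjE)
    then show ?thesis using R(2,3) by simp
  qed
  have R_inj: "\<gamma> = \<gamma>'" if "R \<gamma> z" "R \<gamma>' z" "z \<in> M" for \<gamma> \<gamma>' z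
    using Ord_linear[OF R_Ord[OF that(1)] R_Ord[OF that(2)]] R_not that by blast
  have R_A: "z \<in> A" if R: "R \<gamma> z" "z \<in> M" for \<gamma> z
  proof -
    obtain s where "s \<in> M" "\<forall>x\<in>M. x \<in> E s \<longleftrightarrow> x \<in> A \<and> (\<forall>\<delta>\<in>E \<gamma>. \<not> R \<delta> x)" "z \<in> E s"
      using R_step[OF R] by (elim bexE conjE)
    then show ?thesis using R(2) by simp
  qed
  have R_down: "\<exists>z\<in>M. R \<delta> z" if R: "R \<gamma> z" and \<delta>: "\<delta> \<in> E \<gamma>" for \<gamma> \<delta> z
  proof -
    obtain f \<alpha> where f: "f \<in> M" "\<alpha> \<in> M" "att f \<alpha>" "\<gamma> \<in> E \<alpha>" using R unfolding R_def by blast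
    have \<delta>\<alpha>: "\<delta> \<in> E \<alpha>" using \<delta> f(3,4) Ord_trans unfolding att_def by blast
    obtain s y where s: "y \<in> M" "\<forall>z\<in>M. pr \<delta> z \<in> E f \<longleftrightarrow> z = y" using attD[OF f(3) \<delta>\<alpha>] by (elim bexE conjE)
    then have "pr \<delta> y \<in> E f" by simp
    then show ?thesis using s(1) f \<delta>\<alpha> unfolding R_def by blast
  qed
  define D where "D = {\<gamma> \<in> M. \<exists>z\<in>A. R \<gamma> z}"
  have D: "mset D"
    unfolding D_def
  proof (rule mset_repl[OF A])
    show "dfn (\<lambda>_ e. R (e (Suc 0)) (e 0))" by (intro dfn_subst2[OF dR] trm_var)
    show "y = z" if "x \<in> A" "R y x" "R z x" for x y z
      using R_inj[OF that(2,3)] that(1) AM by blast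
  qed
  have D_iff: "\<gamma> \<in> D \<longleftrightarrow> (\<exists>z\<in>M. R \<gamma> z)" for \<gamma>
    unfolding D_def using R_A R_Ord Ord_in AM by blast
  define \<theta> where "\<theta> = cd D"
  have \<theta>: "\<theta> \<in> M" "E \<theta> = D" using D by (simp_all add: \<theta>_def)
  have D_Ord: "Ord \<gamma>" if "\<gamma> \<in> D" for \<gamma> using that R_Ord D_iff by blast
  have "Ord \<theta>"
    unfolding Ord_def \<theta>(2)
  proof (intro conjI ballI)
    fix x assume x: "x \<in> D"
    show "E x \<subseteq> D" using x R_down D_iff by blast
    show "x \<in> E y \<or> x = y \<or> y \<in> E x" if "y \<in> D" for y
      using Ord_linear x that D_Ord by blast
  qed (rule \<theta>(1))
  define G where "G = {(\<gamma>, z). \<gamma> \<in> D \<and> z \<in> A \<and> R \<gamma> z}"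
  have G_iff: "(\<gamma>, z) \<in> G \<longleftrightarrow> z \<in> M \<and> R \<gamma> z" for \<gamma> z
    unfolding G_def using R_A D_iff AM by blast
  have G: "mrel G" unfolding G_def by (intro mrel_Collect D A dR)
  have G_img: "G `` E \<beta> = {z \<in> M. \<exists>\<delta>\<in>E \<beta>. R \<delta> z}" for \<beta>
    using G_iff by auto
  have inj: "injrel G (E \<theta>) A"
    unfolding injrel_def \<theta>(2) single_valued_def
    using G_iff D_iff R_sv R_inj R_A by (auto simp: subset_iff)
  have step: "\<exists>s\<in>M. E s = A - G `` E \<beta> \<and> y \<in> E s \<and> C s y" if "(\<beta>, y) \<in> G" for \<beta> y
  proof -
    have y: "y \<in> M" "R \<beta> y" using that by (simp_all add: G_iff)
    obtain s where s: "s \<in> M" "\<forall>x\<in>M. x \<in> E s \<longleftrightarrow> x \<in> A \<and> (\<forall>\<delta>\<in>E \<beta>. \<not> R \<delta> x)" "y \<in> E s" "C s y"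
      using R_step[OF y(2,1)] by (elim bexE conjE)
    have "E s = A - G `` E \<beta>"
    proof (rule set_eqI)
      fix x show "x \<in> E s \<longleftrightarrow> x \<in> A - G `` E \<beta>"
      proof (cases "x \<in> M")
        case True
        then show ?thesis using s(2) by (simp add: G_img)
      next
        case False
        then show ?thesis using AM E_in by blast
      qed
    qed
    then show ?thesis using s(1,3,4) by blast
  qed
  have onto: "A \<subseteq> Range G"
  proof (rule ccontr)
    assume ne: "\<not> A \<subseteq> Range G"
    define s where "s = cd (A - Range G)"
    have mr: "mset (A - Range G)" by (intro mset_Diff A mset_Range G)
    have s: "s \<in> M" "E s = A - Range G" using mr by (simp_all add: s_def)
    obtain y where y: "y \<in> E s" "C s y" using ch[OF s(1)] s(2) ne by blast
    \<comment> \<open>If something is left over, the element \<open>y\<close> selected from it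
      prolongs the enumeration by the stage \<theta>. The result is correct below
      \<open>sc \<theta>\<close>, so \<theta> would belong to \<open>D\<close>, whose code is
      \<theta> itself.\<close>
    define G' where "G' = G \<union> {(\<theta>, y)}"
    have y': "y \<in> A" "y \<in> M" using y(1) s(2) AM by blast+
    have G': "mrel G'" unfolding G'_def by (intro mrel_Un G mrel_single \<theta> y')
    define f where "f = cd (prs G')"
    have f: "f \<in> M" "E f = prs G'" using G' by (simp_all add: f_def mrel_def)
    have f_iff: "pr \<gamma> z \<in> E f \<longleftrightarrow> (\<gamma>, z) \<in> G'" if "\<gamma> \<in> M" "z \<in> M" for \<gamma> z
      unfolding f(2) using G' that by (simp add: in_prs_iff mrel_def)
    have \<theta>D: "\<theta> \<notin> D" using mem_irrefl[OF \<theta>(1)] \<theta>(2) by simp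
    have "att f (sc \<theta>)"
      unfolding att_def
    proof (intro conjI ballI)
      show "Ord (sc \<theta>)" by (rule Ord_sc[OF \<open>Ord \<theta>\<close>])
      fix \<beta> assume "\<beta> \<in> E (sc \<theta>)"
      then have \<beta>: "\<beta> = \<theta> \<or> \<beta> \<in> D" using \<theta> by simp
      then have \<beta>D: "E \<beta> \<subseteq> D" using Ord_trans[OF \<open>Ord \<theta>\<close>] \<theta>(2) by blast
      have \<beta>M: "\<beta> \<in> M" using \<beta> \<theta> D_Ord Ord_in by blast
      have f_low: "pr \<delta> z \<in> E f \<longleftrightarrow> (\<delta>, z) \<in> G" if "\<delta> \<in> D" "z \<in> M" for \<delta> z
        using that \<theta>D D_Ord Ord_in f_iff unfolding G'_def by auto
      have rest_iff: "rest t \<beta> f \<longleftrightarrow> (\<forall>z\<in>M. z \<in> E t \<longleftrightarrow> z \<in> A \<and> z \<notin> G `` E \<beta>)" for t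
        unfolding rest_def using \<beta>D f_low by (intro ball_cong) auto
      show "\<exists>s\<in>M. \<exists>y\<in>M. rest s \<beta> f \<and> y \<in> E s \<and> C s y \<and> (\<forall>z\<in>M. pr \<beta> z \<in> E f \<longleftrightarrow> z = y)"
      proof (cases "\<beta> \<in> D")
        case True
        then obtain x where x: "(\<beta>, x) \<in> G" using G_iff D_iff by blast
        obtain t where t: "t \<in> M" "E t = A - G `` E \<beta>" "x \<in> E t" "C t x"
          using step[OF x] by (elim bexE conjE)
        have "rest t \<beta> f" unfolding rest_iff t(2) by simp
        moreover have "\<forall>z\<in>M. pr \<beta> z \<in> E f \<longleftrightarrow> z = x"
          using f_low[OF True] x G_iff R_sv by blast
        ultimately show ?thesis using t(1,3,4) x G_iff by blast
      next
        case False
        then have \<beta>\<theta>: "\<beta> = \<theta>" using \<beta> by blast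
        have "G `` E \<beta> = Range G" unfolding \<beta>\<theta> \<theta>(2) using G_iff D_iff by blast
        then have "rest s \<beta> f" unfolding rest_iff s(2) by simp
        moreover have "\<forall>z\<in>M. pr \<beta> z \<in> E f \<longleftrightarrow> z = y"
        proof
          fix z assume "z \<in> M"
          then have "pr \<beta> z \<in> E f \<longleftrightarrow> (\<theta>, z) \<in> G'" using f_iff \<theta>(1) \<beta>\<theta> by simp
          also have "\<dots> \<longleftrightarrow> z = y" unfolding G'_def using \<theta>D by (auto simp: G_def)
          finally show "pr \<beta> z \<in> E f \<longleftrightarrow> z = y" .
        qed
        ultimately show ?thesis using s(1) y y'(2) by blast
      qed
    qed
    moreover have "pr \<theta> y \<in> E f" using f_iff[OF \<theta>(1) y'(2)] by (simp add: G'_def)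
    ultimately have "R \<theta> y" unfolding R_def using f(1) \<theta>(1) by (intro bexI[of _ f] bexI[of _ "sc \<theta>"]) auto
    then have "\<theta> \<in> D" using D_iff y'(2) by blast
    then show False using \<theta>D by blast
  qed
  show thesis
    by (rule that[OF \<open>Ord \<theta>\<close> G inj onto]) (intro allI impI step)
qed

text \<open>Zermelo's argument: the next element is picked by a choice function on the nonempty
  subsets of \<open>A\<close>, which form a set by the axiom of Power set.\<close>

theorem well_ordering:
  assumes "mset A" obtains \<theta> where "Ord \<theta>" "eqp A (E \<theta>)"
proof -
  define p where "p = cd {x \<in> {x \<in> M. E x \<subseteq> A}. E x \<noteq> {}}"
  have m: "mset {x \<in> {x \<in> M. E x \<subseteq> A}. E x \<noteq> {}}"
  proof (rule mset_sep[OF mset_Pow[OF assms]])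
    have "dfn (\<lambda>_ e. \<exists>y\<in>E (e 0). True)" by (intro dfn_intros)
    then show "dfn (\<lambda>_ e. E (e 0) \<noteq> {})" by (simp add: ex_in_conv)
  qed
  then have p: "p \<in> M" "E p = {x \<in> {x \<in> M. E x \<subseteq> A}. E x \<noteq> {}}" by (simp_all add: p_def)
  have "\<forall>x\<in>M. x \<epsilon> p \<longrightarrow> nonempty_in mem M x"
    using p(2) by (auto simp: nonempty_in_iff simp flip: in_E_iff)
  then obtain f where f: "f \<in> M" "is_function_in mem M f"
    "\<forall>x\<in>M. x \<epsilon> p \<longrightarrow> (\<exists>y\<in>M. y \<epsilon> x \<and> related_in mem M f x y)"
    using choice p(1) unfolding has_choice_in_def by blast
  have 1: "dfn (\<lambda>_ e. pr (e 0) (e (Suc 0)) \<in> E f)" by (intro dfn_intros f)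
  have 2: "\<exists>!y. y \<in> E s \<and> pr s y \<in> E f" if s: "s \<in> M" "E s \<subseteq> A" "E s \<noteq> {}" for s
  proof -
    have "s \<epsilon> p" using s p(2) in_E_iff[of s p] by simp
    then obtain y where "y \<in> M" "y \<epsilon> s" "related_in mem M f s y" using f(3) s(1) by blast
    then have y: "y \<in> E s" "pr s y \<in> E f" using s(1) by (simp_all add: in_E_iff related_in_iff)
    moreover have "z = y" if "z \<in> E s" "pr s z \<in> E f" for z
    proof -
      have "related_in mem M f s z" "related_in mem M f s y"
        using that y s(1) E_in by (simp_all add: related_in_iff)
      then show ?thesis using f(2) s(1) that(1) y(1) E_in unfolding is_function_in_def by blast
    qed
    ultimately show ?thesis by blast
  qed
  have sel: "\<forall>s\<in>M. E s \<subseteq> A \<and> E s \<noteq> {} \<longrightarrow> (\<exists>!y. y \<in> E s \<and> pr s y \<in> E f)"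
    by (intro ballI impI 2) simp_all
  obtain \<theta> G where "Ord \<theta>" "mrel G" "injrel G (E \<theta>) A" "A \<subseteq> Range G"
    "\<forall>\<beta> y. (\<beta>, y) \<in> G \<longrightarrow> (\<exists>s\<in>M. E s = A - G `` E \<beta> \<and> y \<in> E s \<and> pr s y \<in> E f)"
    by (rule enumeration[of A "\<lambda>s y. pr s y \<in> E f", OF assms 1 sel])
  then have "eqp (E \<theta>) A" unfolding eqp_def by blast
  then show thesis using that \<open>Ord \<theta>\<close> eqp_sym by blast
qed

text \<open>The next element is always the least remaining ordinal. The enumeration is then
  increasing, so its values never fall below their arguments, and its length does not exceed
  \<kappa>.\<close>

lemma subset_Ord_type:
  assumes "Ord \<kappa>" "mset D" "D \<subseteq> E \<kappa>" obtains \<theta> where "Ord \<theta>" "E \<theta> \<subseteq> E \<kappa>" "eqp D (E \<theta>)"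
proof -
  have 1: "dfn (\<lambda>_ e. \<forall>x\<in>E (e 0). e (Suc 0) = x \<or> e (Suc 0) \<in> E x)" by (intro dfn_intros)
  have DO: "Ord x" if "x \<in> D" for x using that assms Ord_elem by blast
  have 2: "\<exists>!y. y \<in> E s \<and> (\<forall>x\<in>E s. y = x \<or> y \<in> E x)" if s: "s \<in> M" "E s \<subseteq> D" "E s \<noteq> {}" for s
  proof -
    obtain y where y: "y \<in> E s" "E y \<inter> E s = {}" using foundation[OF mset_E[OF s(1)] s(3)] by blast
    have *: "\<forall>x\<in>E s. y = x \<or> y \<in> E x"
    proof
      fix x assume x: "x \<in> E s"
      have "Ord y" "Ord x" "x \<notin> E y" using x y DO s(2) by blast+
      then show "y = x \<or> y \<in> E x" using Ord_linear[of y x] by blast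
    qed
    show ?thesis
    proof (rule ex1I[of _ y])
      fix z assume "z \<in> E s \<and> (\<forall>x\<in>E s. z = x \<or> z \<in> E x)"
      then have "z = y \<or> z \<in> E y" "y = z \<or> y \<in> E z" using y(1) * by blast+
      then show "z = y" using mem_asym[of z y] by blast
    qed (use y(1) * in blast)
  qed
  have sel: "\<forall>s\<in>M. E s \<subseteq> D \<and> E s \<noteq> {} \<longrightarrow> (\<exists>!y. y \<in> E s \<and> (\<forall>x\<in>E s. y = x \<or> y \<in> E x))"
    by (intro ballI impI 2) simp_all
  obtain \<theta> G where G: "Ord \<theta>" "mrel G" "injrel G (E \<theta>) D" "D \<subseteq> Range G"
    "\<forall>\<beta> y. (\<beta>, y) \<in> G \<longrightarrow> (\<exists>s\<in>M. E s = D - G `` E \<beta> \<and> y \<in> E s \<and> (\<forall>x\<in>E s. y = x \<or> y \<in> E x))"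
    by (rule enumeration[of D "\<lambda>s y. \<forall>x\<in>E s. y = x \<or> y \<in> E x", OF assms(2) 1 sel])
  have GD: "\<beta> \<in> E \<theta> \<and> y \<in> D" if "(\<beta>, y) \<in> G" for \<beta> y
    using that G(3) unfolding injrel_def by blast
  have incr: "z \<in> E y" if yz: "(\<beta>, y) \<in> G" "(\<gamma>, z) \<in> G" "\<gamma> \<in> E \<beta>" for \<beta> \<gamma> y z
  proof -
    obtain s where s: "E s = D - G `` E \<gamma>" "\<forall>x\<in>E s. z = x \<or> z \<in> E x" using G(5)[rule_format, OF yz(2)] by blast
    obtain t where t: "E t = D - G `` E \<beta>" "y \<in> E t" using G(5)[rule_format, OF yz(1)] by blast
    have "E \<gamma> \<subseteq> E \<beta>" using yz GD[OF yz(1)] G(1) Ord_elem Ord_trans by blast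
    then have "y \<in> E s" using s(1) t by blast
    then have "z = y \<or> z \<in> E y" using s(2) by blast
    moreover have "z \<noteq> y" using t yz by blast
    ultimately show ?thesis by blast
  qed
  \<comment> \<open>At the least \<gamma> whose value \<open>y\<close> lies below it, the value at
    \<open>y\<close> would lie below \<open>y\<close>, because the enumeration increases; so
    \<open>y\<close> would be a smaller counterexample.\<close>
  have ge: "y \<notin> E \<beta>" if "(\<beta>, y) \<in> G" for \<beta> y
  proof
    assume "y \<in> E \<beta>"
    then have P: "\<exists>y\<in>E \<beta>. (\<beta>, y) \<in> G" using that by blast
    have 1: "mset (E \<theta>)" using G(1) Ord_in mset_E by blast
    have 2: "dfn (\<lambda>_ e. \<exists>y\<in>E (e 0). (e 0, y) \<in> G)" "\<beta> \<in> E \<theta>"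
      using GD[OF that] by (intro dfn_intros G(2) | blast)+
    obtain \<gamma> where \<gamma>: "\<gamma> \<in> E \<theta>" "\<exists>y\<in>E \<gamma>. (\<gamma>, y) \<in> G"
      "\<And>z. z \<in> E \<theta> \<Longrightarrow> z \<in> E \<gamma> \<Longrightarrow> \<not> (\<exists>y\<in>E z. (z, y) \<in> G)"
      using minimal[of \<beta> "E \<theta>" "\<lambda>\<beta>. \<exists>y\<in>E \<beta>. (\<beta>, y) \<in> G", OF 2(2) P 1 2(1)] by blast
    then obtain y where y: "y \<in> E \<gamma>" "(\<gamma>, y) \<in> G" by blast
    have y\<theta>: "y \<in> E \<theta>" using y(1) \<gamma>(1) Ord_trans[OF G(1)] by blast
    then obtain z where z: "(y, z) \<in> G" using G(3) unfolding injrel_def by blast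
    have "z \<in> E y" by (rule incr[OF y(2) z y(1)])
    then show False using \<gamma>(3)[OF y\<theta> y(1)] z by blast
  qed
  have "E \<theta> \<subseteq> E \<kappa>"
  proof
    fix \<beta> assume \<beta>: "\<beta> \<in> E \<theta>"
    then obtain y where y: "(\<beta>, y) \<in> G" using G(3) unfolding injrel_def by blast
    have yD: "y \<in> E \<kappa>" using GD[OF y] assms(3) by blast
    have "\<beta> \<in> E y \<or> \<beta> = y"
      using Ord_linear[of \<beta> y] ge[OF y] Ord_elem[OF G(1) \<beta>] Ord_elem[OF assms(1) yD] by blast
    then show "\<beta> \<in> E \<kappa>" using yD Ord_trans[OF assms(1) yD] by blast
  qed
  moreover have "eqp (E \<theta>) D" using G(2-4) unfolding eqp_def by blast
  ultimately show thesis using that G(1) eqp_sym by blast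
qed

section \<open>Cardinals and the comparison of sizes\<close>

definition Card :: "'u \<Rightarrow> bool" where
  "Card k \<longleftrightarrow> Ord k \<and> (\<forall>a\<in>E k. \<not> eqp (E a) (E k))"

lemma Card_Ord: "Card k \<Longrightarrow> Ord k"
  by (simp add: Card_def)

lemma Card_in: "Card k \<Longrightarrow> k \<in> M"
  by (simp add: Card_def Ord_in)

lemma is_cardinal_in_iff: "k \<in> M \<Longrightarrow> is_cardinal_in mem M k \<longleftrightarrow> Card k"
  unfolding is_cardinal_in_def Card_def by (auto simp: is_ordinal_in_iff equinumerous_in_iff E_def)

lemma Card_unique: "Card k \<Longrightarrow> Card l \<Longrightarrow> eqp (E k) (E l) \<Longrightarrow> k = l"
  using Ord_linear[of k l] eqp_sym unfolding Card_def by blast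

lemma Card_exists:
  assumes "mset A" obtains k where "Card k" "eqp A (E k)"
proof -
  obtain \<theta> where \<theta>: "Ord \<theta>" "eqp A (E \<theta>)" by (rule well_ordering[OF assms])
  have a: "E (cd A) = A" "cd A \<in> M" using assms by simp_all
  have "dfn (\<lambda>_ e. eqp (E (cd A)) (E (e 0)))" by (intro dfn_intros a)
  then have d: "dfn (\<lambda>_ e. eqp A (E (e 0)))" by (simp only: a)
  obtain k where k: "Ord k" "eqp A (E k)" "\<And>c. c \<in> E k \<Longrightarrow> \<not> eqp A (E c)"
    using Ord_least[of \<theta> "\<lambda>k. eqp A (E k)", OF \<theta> d] by metis
  have "Card k" unfolding Card_def using k eqp_trans eqp_sym by blast
  then show thesis using that k(2) by blast
qed

lemma card_in_eq:
  assumes "a \<in> M" "Card k" "eqp (E a) (E k)" shows "card_in mem M a = k"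
  unfolding card_in_def
proof (rule the_equality)
  show "k \<in> M \<and> is_cardinal_in mem M k \<and> equinumerous_in mem M a k"
    using assms Card_in by (simp add: is_cardinal_in_iff equinumerous_in_iff)
  fix l assume "l \<in> M \<and> is_cardinal_in mem M l \<and> equinumerous_in mem M a l"
  then have "Card l" "eqp (E a) (E l)" using assms(1) by (auto simp: is_cardinal_in_iff equinumerous_in_iff)
  then show "l = k" using assms(2,3) Card_unique eqp_sym eqp_trans by blast
qed

lemma card_in_props:
  assumes "a \<in> M" shows "Card (card_in mem M a)" "eqp (E a) (E (card_in mem M a))"
proof -
  obtain k where k: "Card k" "eqp (E a) (E k)" using Card_exists[OF mset_E[OF assms]] by blast
  then have "card_in mem M a = k" by (rule card_in_eq[OF assms])
  then show "Card (card_in mem M a)" "eqp (E a) (E (card_in mem M a))" using k by simp_all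
qed

text \<open>If a well-ordering of \<open>Z\<close> were as long as \<kappa>, its first \<kappa>
  elements would form a subset of size \<kappa>. This turns the absence of subsets into a bound on
  the size.\<close>

lemma lep_Ord_cases:
  assumes "mset Z" "Ord \<kappa>" "\<And>Y. mset Y \<Longrightarrow> Y \<subseteq> Z \<Longrightarrow> \<not> eqp Y (E \<kappa>)" shows "lep Z (E \<kappa>)"
proof -
  obtain \<theta> where \<theta>: "Ord \<theta>" "eqp Z (E \<theta>)" by (rule well_ordering[OF assms(1)])
  have "\<not> E \<kappa> \<subseteq> E \<theta>"
  proof
    assume "E \<kappa> \<subseteq> E \<theta>"
    then have "lep (E \<kappa>) Z"
      using lep_trans[OF lep_subset eqp_imp_lep[OF eqp_sym[OF \<theta>(2)]]] assms(2) Ord_in mset_E by blast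
    then obtain Y where "mset Y" "Y \<subseteq> Z" "eqp (E \<kappa>) Y" by (rule lep_obtain_subset)
    then show False using assms(3)[of Y] eqp_sym[of "E \<kappa>" Y] by blast
  qed
  then have "E \<theta> \<subseteq> E \<kappa>"
    using Ord_linear[OF \<theta>(1) assms(2)] Ord_trans[OF \<theta>(1), of \<kappa>] Ord_trans[OF assms(2), of \<theta>] by blast
  then show ?thesis by (rule lep_mono_right[OF eqp_imp_lep[OF \<theta>(2)]])
qed

text \<open>An injection would make \<mu> equinumerous to a set of ordinals below \<kappa>, hence to
  the order type of this set, which is at most \<kappa> and so below \<mu>.\<close>

lemma Card_not_lep:
  assumes "Card \<mu>" "\<kappa> \<in> E \<mu>" shows "\<not> lep (E \<mu>) (E \<kappa>)"
proof
  assume "lep (E \<mu>) (E \<kappa>)"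
  then obtain D where D: "mset D" "D \<subseteq> E \<kappa>" "eqp (E \<mu>) D" by (rule lep_obtain_subset)
  have \<kappa>: "Ord \<kappa>" using assms Card_Ord Ord_elem by blast
  obtain \<theta> where \<theta>: "Ord \<theta>" "E \<theta> \<subseteq> E \<kappa>" "eqp D (E \<theta>)" by (rule subset_Ord_type[OF \<kappa> D(1,2)])
  have "\<theta> \<in> E \<mu>"
    using Ord_subset_cases[OF \<theta>(1) \<kappa> \<theta>(2)] assms(2) Ord_trans[OF Card_Ord[OF assms(1)] assms(2)] by blast
  moreover have "eqp (E \<theta>) (E \<mu>)" by (rule eqp_sym[OF eqp_trans[OF D(3) \<theta>(3)]])
  ultimately show False using assms(1) unfolding Card_def by blast
qed

section \<open>Multiples of infinite cardinals\<close>

definition two :: "'u set" where "two = {zero, sc zero}"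

lemma mset_two [simp, intro]: "mset two" and two_in: "i \<in> two \<Longrightarrow> i \<in> M"
  by (auto simp: two_def)

lemma lep_Om_remove:
  assumes "lep Om (insert p B)" "mset B" shows "lep Om B"
proof -
  obtain R where R: "mrel R" "injrel R Om (insert p B)" using assms(1) by (auto simp: lep_def)
  have Rsub: "R \<subseteq> Om \<times> insert p B" using R(2) by (simp add: injrel_def)
  show ?thesis
  proof (cases "p \<in> Range R")
    case False
    then have "injrel R Om B" using R(2) unfolding injrel_def by fast
    then show ?thesis using R(1) unfolding lep_def by blast
  next
    case True
    then obtain k where k: "(k, p) \<in> R" by blast
    have kO: "k \<in> Om" using k Rsub by blast
    have m: "mset (Om - {k})" using kO Om_in by (intro mset_Diff mset_single mset_Om)
    \<comment> \<open>The successor map, redirected to zero at the one argument whose successor is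
      \<open>k\<close>. It avoids \<open>k\<close> and is injective: if an argument is redirected at
      all, then \<open>k\<close> is not zero.\<close>
    let ?P = "\<lambda>n m. (k = sc n \<and> m = zero) \<or> (k \<noteq> sc n \<and> m = sc n)"
    have sub: "Om \<subseteq> M" using Om_in by blast
    have 1: "lep Om (Om - {k})"
    proof (rule lepI[of _ _ ?P])
      show "dfn (\<lambda>_ e. ?P (e 0) (e (Suc 0)))"
        by (intro dfn_intros Om_in[OF kO] zero_in)
      show "\<exists>m\<in>Om - {k}. ?P n m" if n: "n \<in> Om" for n
      proof (cases "k = sc n")
        case True
        then have "zero \<in> Om - {k}" using n Om_in by simp
        then show ?thesis using True by blast
      next
        case False
        then have "sc n \<in> Om - {k}" using n by simp
        then show ?thesis using False by blast
      qed
      show "x = y" if xy: "x \<in> Om" "y \<in> Om" "?P x z" "?P y z" for x y z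
      proof -
        have "x \<in> M" "y \<in> M" using xy(1,2) Om_in by blast+
        then have "sc x = sc y" using xy(3,4) zero_neq_sc by metis
        then show ?thesis using sc_inject Om_Ord xy(1,2) by blast
      qed
    qed (use m in auto)
    have "mrel (R \<inter> (Om - {k}) \<times> B)" by (intro mrel_restrict R m assms(2))
    moreover have "injrel (R \<inter> (Om - {k}) \<times> B) (Om - {k}) B"
      unfolding injrel_def
    proof (intro conjI)
      show "Om - {k} \<subseteq> Domain (R \<inter> (Om - {k}) \<times> B)"
      proof
        fix x assume x: "x \<in> Om - {k}"
        then obtain y where y: "(x, y) \<in> R" using R(2) unfolding injrel_def by blast
        have "y \<noteq> p" using y k x R(2) unfolding injrel_def single_valued_def by blast
        then have "y \<in> B" using y Rsub by blast
        then show "x \<in> Domain (R \<inter> (Om - {k}) \<times> B)" using x y by blast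
      qed
    qed (use R(2) in \<open>auto simp: injrel_def single_valued_def\<close>)
    ultimately have "lep (Om - {k}) B" unfolding lep_def by blast
    then show ?thesis by (rule lep_trans[OF 1])
  qed
qed

lemma pp_sc:
  assumes "n \<in> M" shows "pp two (E (sc n)) = insert (pr zero n) (insert (pr (sc zero) n) (pp two (E n)))"
  unfolding two_def using assms by (auto simp: pp_iff)

text \<open>Passing from \<open>n\<close> to its successor adds just two points, which
  \<open>lep_Om_remove\<close> takes away again. The finite case of the doubling argument rests on
  this.\<close>

lemma not_lep_Om_finite:
  assumes "n \<in> Om" shows "\<not> lep Om (pp two (E n))"
proof (rule Om_induct[OF assms, of "\<lambda>n. \<not> lep Om (pp two (E n))"])
  have "dfn (\<lambda>_ e. \<not> lep (E (cd Om)) (pp (E (cd two)) (E (e 0))))"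
    by (intro dfn_neg dfn_lep_pp_right trm_const_in trm_var cd_in mset_two mset_Om)
  then show "dfn (\<lambda>_ e. \<not> lep Om (pp two (E (e 0))))" by simp
next
  show "\<not> lep Om (pp two (E zero))"
  proof
    assume "lep Om (pp two (E zero))"
    then obtain R where "injrel R Om {}" by (auto simp: lep_def)
    then show False unfolding injrel_def using Om_zero by blast
  qed
next
  fix n assume n: "n \<in> Om" "\<not> lep Om (pp two (E n))"
  have "mset (pp two (E n))" using n Om_in by (intro mset_pp mset_two mset_E) blast
  then show "\<not> lep Om (pp two (E (sc n)))"
    using n lep_Om_remove mset_insert pr_in zero_in sc_in Om_in unfolding pp_sc[OF Om_in[OF n(1)]] by metis
qed

text \<open>Hilbert's hotel: the new point goes to zero, natural numbers move up by one, everything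
  else stays.\<close>

lemma lep_insert_infinite:
  assumes "Ord \<beta>" "Om \<subseteq> E \<beta>" shows "lep (insert \<beta> (E \<beta>)) (E \<beta>)"
proof (rule lepI[of _ _ "\<lambda>x y. (x = \<beta> \<and> y = zero) \<or> (x \<noteq> \<beta> \<and> x \<in> Om \<and> y = sc x) \<or> (x \<noteq> \<beta> \<and> x \<notin> Om \<and> y = x)"])
  have \<beta>: "\<beta> \<in> M" "\<beta> \<notin> E \<beta>" using assms(1) Ord_in mem_irrefl by blast+
  show "mset (insert \<beta> (E \<beta>))" "mset (E \<beta>)" using \<beta> by (auto intro: mset_E)
  show "dfn (\<lambda>_ e. (e 0 = \<beta> \<and> e (Suc 0) = zero) \<or> (e 0 \<noteq> \<beta> \<and> e 0 \<in> Om \<and> e (Suc 0) = sc (e 0)) \<or>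
      (e 0 \<noteq> \<beta> \<and> e 0 \<notin> Om \<and> e (Suc 0) = e 0))"
    by (intro dfn_intros \<beta> mset_Om zero_in)
  show "\<exists>y\<in>E \<beta>. (x = \<beta> \<and> y = zero) \<or> (x \<noteq> \<beta> \<and> x \<in> Om \<and> y = sc x) \<or> (x \<noteq> \<beta> \<and> x \<notin> Om \<and> y = x)"
    if x: "x \<in> insert \<beta> (E \<beta>)" for x
  proof -
    have "zero \<in> E \<beta>" "x \<in> Om \<Longrightarrow> sc x \<in> E \<beta>" using assms(2) by auto
    then show ?thesis using x by blast
  qed
  show "y = z"
    if "(x = \<beta> \<and> y = zero) \<or> (x \<noteq> \<beta> \<and> x \<in> Om \<and> y = sc x) \<or> (x \<noteq> \<beta> \<and> x \<notin> Om \<and> y = x)"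
      "(x = \<beta> \<and> z = zero) \<or> (x \<noteq> \<beta> \<and> x \<in> Om \<and> z = sc x) \<or> (x \<noteq> \<beta> \<and> x \<notin> Om \<and> z = x)" for x y z
    using that by blast
  show "x = y"
    if "(x = \<beta> \<and> z = zero) \<or> (x \<noteq> \<beta> \<and> x \<in> Om \<and> z = sc x) \<or> (x \<noteq> \<beta> \<and> x \<notin> Om \<and> z = x)"
      "(y = \<beta> \<and> z = zero) \<or> (y \<noteq> \<beta> \<and> y \<in> Om \<and> z = sc y) \<or> (y \<noteq> \<beta> \<and> y \<notin> Om \<and> z = y)" for x y z
  proof -
    have "x \<in> Om \<Longrightarrow> sc x \<noteq> zero \<and> sc x \<in> Om" "y \<in> Om \<Longrightarrow> sc y \<noteq> zero \<and> sc y \<in> Om"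
      "x \<in> Om \<Longrightarrow> y \<in> Om \<Longrightarrow> sc x = sc y \<Longrightarrow> x = y"
      using sc_inject Om_Ord by (auto simp: Om_in)
    then show ?thesis using that Om_zero by metis
  qed
qed

text \<open>If the lexicographic enumeration of \<open>2 \<times> \<alpha>\<close> (second coordinate major) is longer than \<open>\<alpha>\<close>,
  then \<open>\<alpha>\<close> embeds into \<open>2 \<times> (\<beta> + 1)\<close> for some \<open>\<beta> < \<alpha>\<close>, to which induction applies.\<close>

lemma double_infinite:
  assumes "Ord \<alpha>" "Om \<subseteq> E \<alpha>" shows "lep (pp two (E \<alpha>)) (E \<alpha>)"
proof (rule ccontr)
  let ?Q = "\<lambda>\<alpha>. Om \<subseteq> E \<alpha> \<and> \<not> lep (pp two (E \<alpha>)) (E \<alpha>)"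
  assume "\<not> lep (pp two (E \<alpha>)) (E \<alpha>)"
  then have Q: "?Q \<alpha>" using assms(2) by blast
  have "dfn (\<lambda>_ e. Om \<subseteq> E (e 0) \<and> \<not> lep (pp (E (cd two)) (E (e 0))) (E (e 0)))"
    by (intro dfn_lep_pp dfn_intros mset_Om cd_in mset_two)
  then have d: "dfn (\<lambda>_ e. ?Q (e 0))" by simp
  obtain a where a: "Ord a" "?Q a" "\<And>c. c \<in> E a \<Longrightarrow> \<not> ?Q c"
    using Ord_least[of \<alpha> ?Q, OF assms(1) Q d] by metis
  define A where "A = pp two (E a)"
  have aM: "a \<in> M" by (rule Ord_in[OF a(1)])
  have A: "mset A" unfolding A_def by (intro mset_pp mset_two mset_E aM)
  have EM: "E x \<subseteq> M" for x by (rule E_subset)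
  have twoM: "two \<subseteq> M" using two_in by blast
  have Ea: "Ord x" if "x \<in> E a" for x using that a(1) Ord_elem by blast
  \<comment> \<open>On \<open>two\<close>, the disjunction \<open>i = zero \<or> j = sc zero\<close>
    expresses \<open>i \<le> j\<close>; so the order is reflexive.\<close>
  define lx where "lx p q \<longleftrightarrow> (\<exists>i\<in>two. \<exists>\<beta>\<in>E a. \<exists>j\<in>two. \<exists>\<gamma>\<in>E a. p = pr i \<beta> \<and> q = pr j \<gamma> \<and>
      (\<beta> \<in> E \<gamma> \<or> \<beta> = \<gamma> \<and> (i = zero \<or> j = sc zero)))" for p q
  have lx_iff: "lx (pr i \<beta>) (pr j \<gamma>) \<longleftrightarrow> \<beta> \<in> E \<gamma> \<or> \<beta> = \<gamma> \<and> (i = zero \<or> j = sc zero)"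
    if "i \<in> two" "\<beta> \<in> E a" "j \<in> two" "\<gamma> \<in> E a" for i \<beta> j \<gamma>
  proof
    assume "lx (pr i \<beta>) (pr j \<gamma>)"
    then obtain i' \<beta>' j' \<gamma>' where *: "i' \<in> two" "\<beta>' \<in> E a" "j' \<in> two" "\<gamma>' \<in> E a"
      "pr i \<beta> = pr i' \<beta>'" "pr j \<gamma> = pr j' \<gamma>'" "\<beta>' \<in> E \<gamma>' \<or> \<beta>' = \<gamma>' \<and> (i' = zero \<or> j' = sc zero)"
      unfolding lx_def by blast
    moreover have "i = i' \<and> \<beta> = \<beta>'" "j = j' \<and> \<gamma> = \<gamma>'"
      using * that twoM EM by (metis pr_inject subsetD)+
    ultimately show "\<beta> \<in> E \<gamma> \<or> \<beta> = \<gamma> \<and> (i = zero \<or> j = sc zero)" by simp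
  qed (use that in \<open>unfold lx_def, blast\<close>)
  have d1: "dfn (\<lambda>_ e. \<forall>x\<in>E (e 0). lx (e (Suc 0)) x)"
    unfolding lx_def by (intro dfn_intros mset_two aM zero_in sc_in)
  have sel: "\<forall>s\<in>M. E s \<subseteq> A \<and> E s \<noteq> {} \<longrightarrow> (\<exists>!y. y \<in> E s \<and> (\<forall>x\<in>E s. lx y x))"
  proof (intro ballI impI)
    fix s assume s: "s \<in> M" "E s \<subseteq> A \<and> E s \<noteq> {}"
    have ms: "mset {\<beta> \<in> E a. \<exists>i\<in>two. pr i \<beta> \<in> E s}"
      by (intro mset_sep mset_E aM dfn_intros mset_two s(1))
    have sA: "\<exists>i\<in>two. \<exists>\<beta>\<in>E a. p = pr i \<beta>" if "p \<in> E s" for p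
      using that s(2) unfolding A_def by (auto simp: pp_iff)
    have "{\<beta> \<in> E a. \<exists>i\<in>two. pr i \<beta> \<in> E s} \<noteq> {}" using s(2) sA by blast
    from foundation[OF ms this] obtain \<beta> where \<beta>: "\<beta> \<in> {\<beta> \<in> E a. \<exists>i\<in>two. pr i \<beta> \<in> E s}"
      "E \<beta> \<inter> {\<beta> \<in> E a. \<exists>i\<in>two. pr i \<beta> \<in> E s} = {}" by blast
    define i where "i = (if pr zero \<beta> \<in> E s then zero else sc zero)"
    have i: "i \<in> two" "pr i \<beta> \<in> E s" using \<beta>(1) by (auto simp: i_def two_def)
    have least: "lx (pr i \<beta>) x" if x: "x \<in> E s" for x
    proof -
      obtain j \<gamma> where j: "j \<in> two" "\<gamma> \<in> E a" "x = pr j \<gamma>" using sA[OF x] by blast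
      have "\<gamma> \<notin> E \<beta>" using \<beta>(2) j x by blast
      then have "\<beta> \<in> E \<gamma> \<or> \<beta> = \<gamma>" using Ord_linear[of \<beta> \<gamma>] Ea \<beta>(1) j(2) by blast
      moreover have "i = zero \<or> j = sc zero" if "\<beta> = \<gamma>"
        using that j x unfolding i_def two_def by auto
      ultimately show ?thesis using lx_iff[OF i(1) _ j(1,2)] \<beta>(1) j(3) by blast
    qed
    show "\<exists>!y. y \<in> E s \<and> (\<forall>x\<in>E s. lx y x)"
    proof (rule ex1I[of _ "pr i \<beta>"])
      fix y assume y: "y \<in> E s \<and> (\<forall>x\<in>E s. lx y x)"
      obtain j \<gamma> where j: "j \<in> two" "\<gamma> \<in> E a" "y = pr j \<gamma>" using sA y by blast
      have "lx (pr j \<gamma>) (pr i \<beta>)" "lx (pr i \<beta>) (pr j \<gamma>)" using y i(2) least j(3) by blast+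
      then have 1: "\<gamma> \<in> E \<beta> \<or> \<gamma> = \<beta> \<and> (j = zero \<or> i = sc zero)" "\<beta> \<in> E \<gamma> \<or> \<beta> = \<gamma> \<and> (i = zero \<or> j = sc zero)"
        using lx_iff[OF j(1,2) i(1), of \<beta>] lx_iff[OF i(1) _ j(1,2), of \<beta>] \<beta>(1) by simp_all
      have "\<beta> = \<gamma>" using 1 mem_asym[of \<beta> \<gamma>] by blast
      moreover from this have "(j = zero \<or> i = sc zero) \<and> (i = zero \<or> j = sc zero)"
        using 1 mem_asym[of \<beta> \<gamma>] by blast
      moreover have "zero \<noteq> sc zero" by simp
      ultimately have "i = j" using i(1) j(1) unfolding two_def by fastforce
      then show "y = pr i \<beta>" using j(3) \<open>\<beta> = \<gamma>\<close> by simp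
    qed (use i(2) least in blast)
  qed
  obtain \<theta> G where G: "Ord \<theta>" "mrel G" "injrel G (E \<theta>) A" "A \<subseteq> Range G"
    "\<forall>\<beta> y. (\<beta>, y) \<in> G \<longrightarrow> (\<exists>s\<in>M. E s = A - G `` E \<beta> \<and> y \<in> E s \<and> (\<forall>x\<in>E s. lx y x))"
    by (rule enumeration[of A "\<lambda>s y. \<forall>x\<in>E s. lx y x", OF A d1 sel])
  have eq: "eqp (E \<theta>) A" unfolding eqp_def using G(2-4) by blast
  have GD: "\<beta> \<in> E \<theta> \<and> y \<in> A" if "(\<beta>, y) \<in> G" for \<beta> y
    using that G(3) unfolding injrel_def by blast
  have "\<not> E \<theta> \<subseteq> E a"
  proof
    assume "E \<theta> \<subseteq> E a"
    then have "lep A (E a)" by (rule lep_mono_right[OF eqp_imp_lep[OF eqp_sym[OF eq]]])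
    then show False using a(2) unfolding A_def by blast
  qed
  then have "a \<in> E \<theta>" using Ord_not_mem[OF a(1) G(1)] Ord_linear[OF a(1) G(1)] by blast
  \<comment> \<open>The enumeration is longer than \<open>a\<close>, so it has a stage
    \<open>a\<close>, with value \<open>p\<close>. Whatever is listed before \<open>p\<close> has a
    second coordinate of at most \<beta>, and this embeds \<open>a\<close> into
    \<open>B\<close>.\<close>
  then obtain p where p: "(a, p) \<in> G" using G(3) unfolding injrel_def by blast
  obtain i \<beta> where i: "i \<in> two" "\<beta> \<in> E a" "p = pr i \<beta>" using GD[OF p] unfolding A_def by (auto simp: pp_iff)
  define B where "B = pp two (insert \<beta> (E \<beta>))"
  have \<beta>M: "\<beta> \<in> M" using i(2) E_in by blast
  have Bm: "mset B" unfolding B_def by (intro mset_pp mset_two mset_insert mset_E \<beta>M)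
  have low: "q \<in> B" if q: "(\<gamma>, q) \<in> G" "\<gamma> \<in> E a" for \<gamma> q
  proof -
    obtain s where s: "E s = A - G `` E \<gamma>" "\<forall>x\<in>E s. lx q x" using G(5)[rule_format, OF q(1)] by blast
    have sv: "single_valued (G\<inverse>)" using G(3) by (simp add: injrel_def)
    have "p \<notin> G `` E \<gamma>"
    proof
      assume "p \<in> G `` E \<gamma>"
      then obtain \<delta> where "(\<delta>, p) \<in> G" "\<delta> \<in> E \<gamma>" by blast
      then have "a \<in> E \<gamma>" using sv p unfolding single_valued_def by blast
      then show False using q(2) mem_asym by blast
    qed
    then have "lx q p" using s GD[OF p] by blast
    moreover obtain j \<delta> where j: "j \<in> two" "\<delta> \<in> E a" "q = pr j \<delta>"
      using GD[OF q(1)] unfolding A_def by (auto simp: pp_iff)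
    ultimately have "\<delta> \<in> insert \<beta> (E \<beta>)" using lx_iff[OF j(1,2) i(1,2)] i(3) by auto
    then show ?thesis unfolding B_def using j by (auto simp: pp_iff)
  qed
  have "mrel (G \<inter> E a \<times> B)" by (intro mrel_restrict G mset_E aM Bm)
  moreover have "injrel (G \<inter> E a \<times> B) (E a) B"
    unfolding injrel_def
  proof (intro conjI)
    show "E a \<subseteq> Domain (G \<inter> E a \<times> B)"
    proof
      fix x assume x: "x \<in> E a"
      have "x \<in> E \<theta>" using x Ord_trans[OF G(1) \<open>a \<in> E \<theta>\<close>] by blast
      then obtain y where "(x, y) \<in> G" using G(3) unfolding injrel_def by blast
      then show "x \<in> Domain (G \<inter> E a \<times> B)" using x low by blast
    qed
  qed (use G(3) in \<open>auto simp: injrel_def single_valued_def\<close>)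
  ultimately have aB: "lep (E a) B" unfolding lep_def by blast
  have \<beta>O: "Ord \<beta>" by (rule Ea[OF i(2)])
  show False
  proof (cases "\<beta> \<in> Om")
    case True
    have "lep Om (E a)" using a(2) by (intro lep_subset mset_Om) blast
    then have "lep Om B" using aB by (rule lep_trans)
    moreover have "B = pp two (E (sc \<beta>))" unfolding B_def using \<beta>M by simp
    ultimately show False using not_lep_Om_finite[of "sc \<beta>"] True by simp
  next
    case False
    then have Om\<beta>: "Om \<subseteq> E \<beta>" by (rule Om_subset[OF \<beta>O])
    have m: "mset (E \<beta>)" "mset (E a)" "mset (insert \<beta> (E \<beta>))" using \<beta>M aM by (auto intro: mset_E)
    \<comment> \<open>By minimality of \<open>a\<close>, two copies of \<beta> fit into \<beta>.
      Hence a \<le> 2(\<beta> + 1) \<le> 2\<beta> \<le> \<beta>, and therefore 2a \<le> 2\<beta>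
      \<le> \<beta> \<le> a.\<close>
    have IH: "lep (pp two (E \<beta>)) (E \<beta>)" using a(3)[OF i(2)] Om\<beta> by blast
    have "lep B (pp two (E \<beta>))" unfolding B_def
      by (rule lep_pp_mono[OF lep_insert_infinite[OF \<beta>O Om\<beta>] mset_two m(3,1)])
    then have "lep (E a) (E \<beta>)" by (rule lep_trans[OF aB lep_trans[OF _ IH]])
    then have "lep (pp two (E a)) (pp two (E \<beta>))" by (rule lep_pp_mono[OF _ mset_two m(2,1)])
    then have "lep (pp two (E a)) (E \<beta>)" by (rule lep_trans[OF _ IH])
    then have "lep (pp two (E a)) (E a)" by (rule lep_mono_right[OF _ Ord_trans[OF a(1) i(2)]])
    then show False using a(2) by blast
  qed
qed

lemma lep_Un_infinite:
  assumes "Ord \<kappa>" "Om \<subseteq> E \<kappa>" "lep A (E \<kappa>)" "lep B (E \<kappa>)" "mset A" "mset B"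
  shows "lep (A \<union> B) (E \<kappa>)"
proof -
  have m: "mset (E \<kappa>)" using assms(1) Ord_in mset_E by blast
  have "lep A (pp {sc zero} (E \<kappa>))"
    by (rule lep_trans[OF assms(3) eqp_imp_lep[OF eqp_pp_single[OF m]]]) simp
  then have "lep (A \<union> B) (pp (insert zero {sc zero}) (E \<kappa>))"
    by (rule lep_Un_pp[OF _ assms(4)]) (use assms m in auto)
  then show ?thesis
    using lep_trans[OF _ double_infinite[OF assms(1,2)]] unfolding two_def by simp
qed

text \<open>The induction takes place inside the model, so \<open>n\<close> may be any of its
  natural numbers, also a nonstandard one. Each step absorbs one more copy of \<kappa> by
  doubling.\<close>

lemma multiple_infinite:
  assumes "Ord \<kappa>" "Om \<subseteq> E \<kappa>" "n \<in> Om" shows "lep (pp (E n) (E \<kappa>)) (E \<kappa>)"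
proof (rule Om_induct[OF assms(3), of "\<lambda>n. lep (pp (E n) (E \<kappa>)) (E \<kappa>)"])
  have \<kappa>: "\<kappa> \<in> M" "mset (E \<kappa>)" using assms(1) Ord_in mset_E by blast+
  show "dfn (\<lambda>_ e. lep (pp (E (e 0)) (E \<kappa>)) (E \<kappa>))" by (intro dfn_lep_pp dfn_intros \<kappa>)
  show "lep (pp (E zero) (E \<kappa>)) (E \<kappa>)" by (simp add: lep_subset)
  fix n assume n: "n \<in> Om" "lep (pp (E n) (E \<kappa>)) (E \<kappa>)"
  have nM: "n \<in> M" by (rule Om_in[OF n(1)])
  have "lep (pp {n} (E \<kappa>)) (E \<kappa>)"
    by (rule eqp_imp_lep[OF eqp_sym[OF eqp_pp_single[OF \<kappa>(2) nM]]])
  then have "lep (pp (E n) (E \<kappa>) \<union> pp {n} (E \<kappa>)) (E \<kappa>)"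
    using n(2) by (intro lep_Un_infinite assms mset_pp mset_E mset_single \<kappa> nM)
  also have "pp (E n) (E \<kappa>) \<union> pp {n} (E \<kappa>) = pp (E (sc n)) (E \<kappa>)"
    using nM by (simp flip: pp_Un_left)
  finally show "lep (pp (E (sc n)) (E \<kappa>)) (E \<kappa>)" .
qed

section \<open>Cardinal multiplication and supersets of prescribed size\<close>

definition times :: "'u \<Rightarrow> 'u \<Rightarrow> 'u" where
  "times n k = card_in mem M (product_in mem M n k)"

lemma times_props:
  assumes "n \<in> M" "k \<in> M"
  shows "Card (times n k)" "eqp (pp (E n) (E k)) (E (times n k))"
proof -
  have m: "mset (pp (E n) (E k))" using assms by (intro mset_pp mset_E)
  show "Card (times n k)" "eqp (pp (E n) (E k)) (E (times n k))"
    using card_in_props[OF cd_in[OF m]] m unfolding times_def product_in_eq[OF assms] by simp_all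
qed

lemma finite_if_less_multiple:
  assumes "Card \<kappa>" "n \<in> Om" "\<kappa> \<in> E (times n \<kappa>)" shows "\<kappa> \<in> Om"
proof (rule ccontr)
  assume "\<kappa> \<notin> Om"
  then have "lep (pp (E n) (E \<kappa>)) (E \<kappa>)"
    using assms by (intro multiple_infinite Om_subset Card_Ord)
  moreover have t: "Card (times n \<kappa>)" "eqp (pp (E n) (E \<kappa>)) (E (times n \<kappa>))"
    using times_props assms Om_in Card_in by blast+
  ultimately have "lep (E (times n \<kappa>)) (E \<kappa>)" by (metis lep_trans eqp_imp_lep eqp_sym)
  then show False using Card_not_lep[OF t(1) assms(3)] by blast
qed

lemma not_less_times_lep:
  assumes "Card \<mu>" "\<mu> \<notin> E (times n \<kappa>)" "n \<in> M" "\<kappa> \<in> M" "lep Z (pp (E n) (E \<kappa>))"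
  shows "lep Z (E \<mu>)"
proof -
  have t: "Card (times n \<kappa>)" "eqp (pp (E n) (E \<kappa>)) (E (times n \<kappa>))"
    using times_props assms by blast+
  have "E (times n \<kappa>) \<subseteq> E \<mu>" using Ord_not_mem[OF Card_Ord[OF assms(1)] Card_Ord[OF t(1)] assms(2)] .
  then show ?thesis by (rule lep_mono_right[OF lep_trans[OF assms(5) eqp_imp_lep[OF t(2)]]])
qed

text \<open>The tag \<open>cd T\<close> makes the copy of \<open>L\<close> disjoint from \<open>W\<close>, since no set is its own element.\<close>

lemma extend_to_size:
  assumes "mset W" "mset L"
  obtains V where "mset V" "W \<subseteq> V"
    "\<forall>Z. mset Z \<and> Z \<subseteq> W \<and> lep Z L \<longrightarrow> (\<exists>Y. mset Y \<and> Z \<subseteq> Y \<and> Y \<subseteq> V \<and> eqp Y L)"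
proof -
  have LM: "L \<subseteq> M" by (rule mset_subset[OF assms(2)])
  define T where "T = {t \<in> M. \<exists>p\<in>W. \<exists>x\<in>M. p = pr t x}"
  have T: "mset T" unfolding T_def
    by (rule mset_repl[OF assms(1)]) (intro dfn_intros | clarsimp)+
  define t where "t = cd T"
  have t: "t \<in> M" "t \<notin> T" using T mem_irrefl[of t] by (auto simp: t_def)
  have disj: "W \<inter> pp {t} L = {}"
  proof (rule ccontr)
    assume "W \<inter> pp {t} L \<noteq> {}"
    then obtain x where "x \<in> L" "pr t x \<in> W" by (auto simp: pp_iff)
    then show False using t LM unfolding T_def by blast
  qed
  show thesis
  \<comment> \<open>A single \<open>V\<close> serves all \<open>Z\<close>, so that the supersets of
    size \<open>L\<close> can later be collected in one internal set, as Saturation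
    requires.\<close>
  proof (rule that[of "W \<union> pp {t} L"])
    show "mset (W \<union> pp {t} L)" by (intro mset_Un mset_pp mset_single assms t)
    show "\<forall>Z. mset Z \<and> Z \<subseteq> W \<and> lep Z L \<longrightarrow>
        (\<exists>Y. mset Y \<and> Z \<subseteq> Y \<and> Y \<subseteq> W \<union> pp {t} L \<and> eqp Y L)"
    proof (intro allI impI, elim conjE)
      fix Z assume Z: "mset Z" "Z \<subseteq> W" "lep Z L"
      then obtain R where R: "mrel R" "injrel R Z L" by (auto simp: lep_def)
      \<comment> \<open>\<open>K\<close> is the part of \<open>L\<close> that the injection
        \<open>R\<close> misses. Its tagged copy is added to \<open>Z\<close>, which brings the size
        to exactly that of \<open>L\<close>.\<close>
      define K where "K = L - Range R"
      have K: "mset K" unfolding K_def by (intro mset_Diff assms mset_Range R)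
      have KL: "K \<subseteq> L" by (auto simp: K_def)
      obtain S where S: "mrel S" "injrel S (pp {t} K) K" "K \<subseteq> Range S"
        using eqp_sym[OF eqp_pp_single[OF K t(1)]] by (auto simp: eqp_def)
      have sub: "pp {t} K \<subseteq> pp {t} L" using KL unfolding pp_def prs_def by blast
      have RZ: "R \<subseteq> Z \<times> L" "S \<subseteq> pp {t} K \<times> K" using R(2) S(2) by (simp_all add: injrel_def)
      have dis: "Z \<inter> pp {t} K = {}" using disj Z(2) sub by blast
      have "injrel (R \<union> S) (Z \<union> pp {t} K) L"
        unfolding injrel_def
      proof (intro conjI)
        show "R \<union> S \<subseteq> (Z \<union> pp {t} K) \<times> L" using RZ KL by blast
        show "Z \<union> pp {t} K \<subseteq> Domain (R \<union> S)" using R(2) S(2) by (auto simp: injrel_def)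
        have sv: "single_valued R" "single_valued S" "single_valued (R\<inverse>)" "single_valued (S\<inverse>)"
          using R(2) S(2) by (simp_all add: injrel_def)
        show "single_valued (R \<union> S)"
        proof (rule single_valuedI)
          fix x y z assume xy: "(x, y) \<in> R \<union> S" "(x, z) \<in> R \<union> S"
          have "(x, y) \<in> R \<and> (x, z) \<in> R \<or> (x, y) \<in> S \<and> (x, z) \<in> S"
            using xy RZ dis by blast
          then show "y = z" using sv(1,2) by (auto dest: single_valuedD)
        qed
        show "single_valued ((R \<union> S)\<inverse>)"
        proof (rule single_valuedI)
          fix x y z assume "(x, y) \<in> (R \<union> S)\<inverse>" "(x, z) \<in> (R \<union> S)\<inverse>"
          then have xy: "(y, x) \<in> R \<union> S" "(z, x) \<in> R \<union> S" by blast+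
          have "x \<notin> K" if "(w, x) \<in> R" for w using that unfolding K_def by blast
          then have "(y, x) \<in> R \<and> (z, x) \<in> R \<or> (y, x) \<in> S \<and> (z, x) \<in> S"
            using xy RZ(2) by blast
          then show "y = z" using sv(3,4) by (auto dest: single_valuedD)
        qed
      qed
      moreover have "L \<subseteq> Range (R \<union> S)" using S(3) unfolding K_def by blast
      ultimately have "eqp (Z \<union> pp {t} K) L" unfolding eqp_def using mrel_Un[OF R(1) S(1)] by blast
      moreover have "mset (Z \<union> pp {t} K)" by (intro mset_Un Z mset_pp mset_single t K)
      ultimately show "\<exists>Y. mset Y \<and> Z \<subseteq> Y \<and> Y \<subseteq> W \<union> pp {t} L \<and> eqp Y L"
        using Z(2) sub by (intro exI[of _ "Z \<union> pp {t} K"]) blast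
    qed
  qed blast
qed

end

section \<open>Transfer of the axioms\<close>

text \<open>Universal closure in the variables below \<open>n\<close>. Transfer admits standard
  assignments only, so internal values of variables are reached by quantifying over them.\<close>

primrec close_fm :: "nat \<Rightarrow> fm \<Rightarrow> fm" where
  "close_fm 0 p = p"
| "close_fm (Suc n) p = FForall n (close_fm n p)"

lemma in_formula_close [simp]: "in_formula (close_fm n p) \<longleftrightarrow> in_formula p"
  by (induction n) auto

lemma sat_close:
  "range e \<subseteq> M \<Longrightarrow> sat mem st M (close_fm n p) e \<longleftrightarrow>
    (\<forall>e'. range e' \<subseteq> M \<and> (\<forall>i\<ge>n. e' i = e i) \<longrightarrow> sat mem st M p e')"
proof (induction n arbitrary: e)
  case 0
  have "e' = e" if "\<forall>i\<ge>0. e' i = e i" for e' :: "nat \<Rightarrow> 'a" using that by auto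
  then show ?case using 0 by auto
next
  case (Suc n)
  have r: "range (e(n := x)) \<subseteq> M" if "x \<in> M" for x using Suc.prems that by auto
  show ?case
  proof
    assume l: "sat mem st M (close_fm (Suc n) p) e"
    show "\<forall>e'. range e' \<subseteq> M \<and> (\<forall>i\<ge>Suc n. e' i = e i) \<longrightarrow> sat mem st M p e'"
    proof (intro allI impI)
      fix e' assume e': "range e' \<subseteq> M \<and> (\<forall>i\<ge>Suc n. e' i = e i)"
      then have m: "e' n \<in> M" by blast
      then have "sat mem st M (close_fm n p) (e(n := e' n))" using l by simp
      moreover have "\<forall>i\<ge>n. e' i = (e(n := e' n)) i" using e' by (simp add: le_Suc_eq Suc_le_eq)
      ultimately show "sat mem st M p e'" using e' Suc.IH[OF r[OF m]] by blast
    qed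
  next
    assume a: "\<forall>e'. range e' \<subseteq> M \<and> (\<forall>i\<ge>Suc n. e' i = e i) \<longrightarrow> sat mem st M p e'"
    have "sat mem st M (close_fm n p) (e(n := x))" if x: "x \<in> M" for x
      unfolding Suc.IH[OF r[OF x]]
    proof (intro allI impI)
      fix e' assume e': "range e' \<subseteq> M \<and> (\<forall>i\<ge>n. e' i = (e(n := x)) i)"
      then show "sat mem st M p e'" using a by simp
    qed
    then show "sat mem st M (close_fm (Suc n) p) e" by simp
  qed
qed

section \<open>The standard and the internal universe\<close>

locale hst =
  fixes mem :: "'u \<Rightarrow> 'u \<Rightarrow> bool" (infix "\<epsilon>" 50) and st :: "'u \<Rightarrow> bool"
  assumes HST: "HST mem st"
begin

abbreviation SS :: "'u set" where "SS \<equiv> Standard st"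
abbreviation II :: "'u set" where "II \<equiv> Internal mem st"

lemma HST_axioms:
  "extensionality_in mem UNIV" "pairing_in mem UNIV" "union_in mem UNIV" "infinity_in mem UNIV"
  "separation_in mem st UNIV UNIV" "collection_in mem st UNIV UNIV" "ZFC_in mem st SS"
  "transfer mem st" "internal_transitivity mem st"
  "standardization mem st" "saturation mem st"
  using HST unfolding HST_def by simp_all

text \<open>Predicates given by one formula, free of \<open>st\<close> and with parameters common to
  both universes, are exactly those to which Transfer applies.\<close>

sublocale T: language "mem" st False "{SS, II}" .

text \<open>A standard set is an element of its standard singleton.\<close>

lemma SS_subset_II: "SS \<subseteq> II"
proof
  have pair: "pairing_in mem SS" using HST_axioms(7) unfolding ZFC_in_def by simp
  fix x assume x: "x \<in> SS"
  obtain p where "p \<in> SS" "is_upair_in mem SS x x p"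
    by (rule bexE[OF pair[unfolded pairing_in_def, rule_format, OF x x]])
  then have "st p" "x \<epsilon> p" using x by (simp_all add: is_upair_in_def Standard_def)
  then show "x \<in> II" unfolding Internal_def by blast
qed

lemma SS_nonempty: "\<exists>c. c \<in> SS"
  using HST_axioms(7) unfolding ZFC_in_def infinity_in_def by blast

lemma transfer_rule:
  assumes d: "T.dfn P" and SS: "\<And>e. range e \<subseteq> SS \<Longrightarrow> P SS e" and e1: "range e1 \<subseteq> II"
  shows "P II e1"
proof (rule T.dfnE[OF d])
  fix p k q
  assume p: "False \<or> in_formula p" and q: "\<And>i M. i < k \<Longrightarrow> M \<in> {SS, II} \<Longrightarrow> q i \<in> M"
    and P: "\<And>M e. M \<in> {SS, II} \<Longrightarrow> range e \<subseteq> M \<Longrightarrow> P M e = sat mem st M p (with_params k q e)"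
  \<comment> \<open>The parameters are moved behind the other variables, which are then quantified.\<close>
  define N where "N = var_bound p + k"
  define f where "f n = (if n < k then n + N else if n < N + k then n - k else n)" for n
  have inj: "inj f"
  proof (rule injI)
    fix m n assume "f m = f n"
    then show "m = n" unfolding f_def by (simp split: if_splits)
  qed
  obtain c where c: "c \<in> SS" using SS_nonempty by blast
  \<comment> \<open>The assignment has to be standard throughout, so every variable that holds no
    parameter gets the arbitrary standard value \<open>c\<close>.\<close>
  define e0 where "e0 n = (if N \<le> n \<and> n < N + k then q (n - N) else c)" for n
  have e0: "e0 n \<in> SS" for n unfolding e0_def using q[of "n - N" SS] c by auto
  let ?p = "close_fm N (rename f p)"
  have *: "sat mem st M p (with_params k q e) = sat mem st M (rename f p) e'"
    if "\<forall>i\<ge>N. e' i = e0 i" "\<forall>i<N. e' i = e i" for M e and e' :: "nat \<Rightarrow> 'u"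
    unfolding sat_rename[OF inj]
  proof (rule sat_cong)
    fix n assume n: "n < var_bound p"
    show "with_params k q e n = (e' \<circ> f) n"
    proof (cases "n < k")
      case True
      then show ?thesis using that(1) by (simp add: with_params_def f_def e0_def)
    next
      case False
      then have "n < N + k" "n - k < N" using n by (simp_all add: N_def)
      then show ?thesis using that(2) False by (simp add: with_params_def f_def)
    qed
  qed
  have cl: "sat mem st M ?p e0 \<longleftrightarrow> (\<forall>e. range e \<subseteq> M \<longrightarrow> P M e)"
    if M: "M \<in> {SS, II}" for M
  proof -
    have e0M: "range e0 \<subseteq> M" using e0 SS_subset_II M by auto
    show ?thesis
      unfolding sat_close[OF e0M]
    proof (intro iffI allI impI)
      fix e :: "nat \<Rightarrow> 'u" assume a: "\<forall>e'. range e' \<subseteq> M \<and> (\<forall>i\<ge>N. e' i = e0 i) \<longrightarrow> sat mem st M (rename f p) e'"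
        and e: "range e \<subseteq> M"
      let ?e = "\<lambda>i. if i < N then e i else e0 i"
      have "range ?e \<subseteq> M" using e e0M by auto
      then have "sat mem st M (rename f p) ?e" using a by simp
      moreover have "sat mem st M p (with_params k q e) = sat mem st M (rename f p) ?e"
        by (rule *) simp_all
      ultimately show "P M e" using P[OF M e] by simp
    next
      fix e' assume a: "\<forall>e. range e \<subseteq> M \<longrightarrow> P M e"
        and e': "range e' \<subseteq> M \<and> (\<forall>i\<ge>N. e' i = e0 i)"
      then have "P M e'" by blast
      then have "sat mem st M p (with_params k q e')" using P[OF M] e' by simp
      then show "sat mem st M (rename f p) e'" using *[of e' e'] e' by simp
    qed
  qed
  have "sat mem st SS ?p e0" using cl[of SS] SS by simp
  moreover have "in_formula ?p" "range e0 \<subseteq> SS" using p e0 by auto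
  ultimately have "sat mem st II ?p e0"
    using HST_axioms(8)[unfolded transfer_def, rule_format, of ?p e0] by simp
  then show "P II e1" using cl[of II] e1 by blast
qed

lemma transfer_sentence:
  assumes "T.dfn (\<lambda>M _. P M)" "P SS" shows "P II"
proof -
  obtain c where c: "c \<in> SS" using SS_nonempty by blast
  show ?thesis
    by (rule transfer_rule[OF assms(1), of "\<lambda>_. c"]) (use assms(2) c SS_subset_II in auto)
qed

text \<open>The single axioms transfer together as one sentence. A schema transfers instance by
  instance; the internal parameters of an instance sit in the environment, over which
  \<open>transfer_rule\<close> generalizes.\<close>

lemma ZFC_Internal: "ZFC_in mem st II"
proof -
  note S = HST_axioms(7)[unfolded ZFC_in_def]
  have 1: "extensionality_in mem II \<and> pairing_in mem II \<and> union_in mem II \<and> infinity_in mem II \<and>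
      power_in mem II \<and> regularity_in mem II \<and> (\<forall>a\<in>II. has_choice_in mem II a)"
  proof (rule transfer_sentence[of "\<lambda>M. extensionality_in mem M \<and> pairing_in mem M \<and> union_in mem M \<and>
      infinity_in mem M \<and> power_in mem M \<and> regularity_in mem M \<and> (\<forall>a\<in>M. has_choice_in mem M a)"])
    show "T.dfn (\<lambda>M _. extensionality_in mem M \<and> pairing_in mem M \<and> union_in mem M \<and>
        infinity_in mem M \<and> power_in mem M \<and> regularity_in mem M \<and> (\<forall>a\<in>M. has_choice_in mem M a))"
      unfolding extensionality_in_def pairing_in_def union_in_def infinity_in_def power_in_def
        regularity_in_def
      by (intro T.dfn_intros)
  qed (use S in simp)
  have 2: "separation_in mem st {p. in_formula p} II"
    unfolding separation_in_def
  proof (intro ballI allI impI)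
    fix p a and e :: "nat \<Rightarrow> 'u" assume p: "p \<in> {p. in_formula p}" and e: "range e \<subseteq> II" and a: "a \<in> II"
    define C where "C x e n = (case n of 0 \<Rightarrow> x | Suc l \<Rightarrow> e l)" for x :: 'u and e and n :: nat
    \<comment> \<open>Below the quantifiers for \<open>a\<close>, \<open>b\<close>, \<open>x\<close>
      the variable 0 of \<open>p\<close> is again variable 0, while its other variables come after
      these three: variable 1 becomes 3, and so on.\<close>
    define f where "f n = (case n of 0 \<Rightarrow> 0 | Suc m \<Rightarrow> m + 3)" for n :: nat
    have inj: "inj f" unfolding f_def inj_def by (auto split: nat.splits)
    let ?P = "\<lambda>M e. \<forall>a\<in>M. \<exists>b\<in>M. \<forall>x\<in>M. x \<epsilon> b \<longleftrightarrow> x \<epsilon> a \<and> sat mem st M p (C x e)"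
    have upd: "C x (\<lambda>n. e (Suc n)) = e(0 := x)" for x and e :: "nat \<Rightarrow> 'u"
      by (auto simp: C_def fun_eq_iff split: nat.splits)
    have "T.dfn (\<lambda>M e. sat mem st M p (\<lambda>n. e (f n)))"
      by (rule T.dfn_sat[OF _ inj]) (use p in simp)
    moreover have "(\<lambda>n. e (f n)) = C (e 0) (\<lambda>n. e (Suc (Suc (Suc n))))" for e :: "nat \<Rightarrow> 'u"
      by (auto simp: f_def C_def fun_eq_iff eval_nat_numeral split: nat.splits)
    ultimately have d: "T.dfn (\<lambda>M e. sat mem st M p (C (e 0) (\<lambda>n. e (Suc (Suc (Suc n))))))" by simp
    have "?P II (\<lambda>n. e (Suc n))"
    proof (rule transfer_rule[of ?P])
      show "T.dfn ?P" by (intro T.dfn_intros d)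
      show "range (\<lambda>n. e (Suc n)) \<subseteq> II" using e by auto
      fix e' :: "nat \<Rightarrow> 'u" assume e': "range e' \<subseteq> SS"
      \<comment> \<open>The value at 0 is arbitrary, for it is overwritten by
        \<open>x\<close>.\<close>
      define e2 where "e2 = C (e' 0) e'"
      have r: "range e2 \<subseteq> SS" unfolding e2_def using e' by (auto simp: C_def split: nat.splits)
      have C: "C x e' = e2(0 := x)" for x
        by (auto simp: e2_def C_def fun_eq_iff split: nat.splits)
      have sep: "separation_in mem st {p. in_formula p} SS" using S by simp
      show "?P SS e'"
        unfolding C by (rule sep[unfolded separation_in_def, THEN bspec, OF p, THEN spec, THEN mp, OF r])
    qed
    from this[unfolded upd, rule_format, OF a]
    show "\<exists>b\<in>II. \<forall>x\<in>II. x \<epsilon> b \<longleftrightarrow> x \<epsilon> a \<and> sat mem st II p (e(0 := x))" .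
  qed
  have 3: "collection_in mem st {p. in_formula p} II"
    unfolding collection_in_def
  proof (intro ballI allI)
    fix p and e :: "nat \<Rightarrow> 'u" show "range e \<subseteq> II \<longrightarrow> (\<forall>a\<in>II. \<exists>b\<in>II. \<forall>x\<in>II. x \<epsilon> a \<longrightarrow>
        (\<exists>y\<in>II. sat mem st II p (e(0 := x, 1 := y))) \<longrightarrow>
        (\<exists>y\<in>II. y \<epsilon> b \<and> sat mem st II p (e(0 := x, 1 := y))))"
      if p: "p \<in> {p. in_formula p}"
    proof
      assume e: "range e \<subseteq> II"
      define C where "C x y e n = (case n of 0 \<Rightarrow> x | Suc m \<Rightarrow> case m of 0 \<Rightarrow> y | Suc l \<Rightarrow> e l)"
        for x y :: 'u and e and n :: nat
      \<comment> \<open>The innermost quantifiers are now \<open>a\<close>, \<open>b\<close>,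
        \<open>x\<close>, \<open>y\<close>; this exchanges the variables 0 and 1 of \<open>p\<close>
        and puts its variable 2 at 4.\<close>
      define f where "f n = (case n of 0 \<Rightarrow> Suc 0 | Suc m \<Rightarrow> case m of 0 \<Rightarrow> 0 | Suc l \<Rightarrow> l + 4)" for n :: nat
      have inj: "inj f" unfolding f_def inj_def by (auto split: nat.splits)
      let ?P = "\<lambda>M e. \<forall>a\<in>M. \<exists>b\<in>M. \<forall>x\<in>M. x \<epsilon> a \<longrightarrow> (\<exists>y\<in>M. sat mem st M p (C x y e)) \<longrightarrow>
        (\<exists>y\<in>M. y \<epsilon> b \<and> sat mem st M p (C x y e))"
      have upd: "C x y (\<lambda>n. e (Suc (Suc n))) = e(0 := x, 1 := y)" for x y and e :: "nat \<Rightarrow> 'u"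
        by (auto simp: C_def fun_eq_iff split: nat.splits)
      have "T.dfn (\<lambda>M e. sat mem st M p (\<lambda>n. e (f n)))"
        by (rule T.dfn_sat[OF _ inj]) (use p in simp)
      moreover have "(\<lambda>n. e (f n)) = C (e (Suc 0)) (e 0) (\<lambda>n. e (Suc (Suc (Suc (Suc n)))))"
        for e :: "nat \<Rightarrow> 'u"
        by (auto simp: f_def C_def fun_eq_iff eval_nat_numeral split: nat.splits)
      ultimately have d: "T.dfn (\<lambda>M e. sat mem st M p
          (C (e (Suc 0)) (e 0) (\<lambda>n. e (Suc (Suc (Suc (Suc n)))))))" by simp
      have "?P II (\<lambda>n. e (Suc (Suc n)))"
      proof (rule transfer_rule[of ?P])
        show "T.dfn ?P" by (intro T.dfn_intros d)
        show "range (\<lambda>n. e (Suc (Suc n))) \<subseteq> II" using e by auto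
        fix e' :: "nat \<Rightarrow> 'u" assume e': "range e' \<subseteq> SS"
        define e2 where "e2 = C (e' 0) (e' 0) e'"
        have r: "range e2 \<subseteq> SS" unfolding e2_def using e' by (auto simp: C_def split: nat.splits)
        have C: "C x y e' = e2(0 := x, 1 := y)" for x y
          by (auto simp: e2_def C_def fun_eq_iff split: nat.splits)
        have col: "collection_in mem st {p. in_formula p} SS" using S by simp
        show "?P SS e'"
          unfolding C by (rule col[unfolded collection_in_def, THEN bspec, OF p, THEN spec, THEN mp, OF r])
      qed
      then show "\<forall>a\<in>II. \<exists>b\<in>II. \<forall>x\<in>II. x \<epsilon> a \<longrightarrow>
          (\<exists>y\<in>II. sat mem st II p (e(0 := x, 1 := y))) \<longrightarrow>
          (\<exists>y\<in>II. y \<epsilon> b \<and> sat mem st II p (e(0 := x, 1 := y)))" unfolding upd .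
    qed
  qed
  show ?thesis unfolding ZFC_in_def using 1 2 3 by simp
qed

lemma zfc_modelI: "ZFC_in mem st M \<Longrightarrow> zfc_model mem st False M"
  unfolding ZFC_in_def by unfold_locales simp_all

text \<open>In \<open>S\<close> and \<open>I\<close> the cardinal arithmetic of ZFC is available,
  with schemata free of \<open>st\<close>. In \<open>U\<close> the schemata admit \<open>st\<close>,
  as external arguments need, but Power set is not at hand.\<close>

sublocale S: zfc_model "mem" st False SS
  by (rule zfc_modelI) (rule HST_axioms(7))

sublocale I: zfc_model "mem" st False II
  by (rule zfc_modelI) (rule ZFC_Internal)

sublocale U: base_model "mem" st True UNIV
  by unfold_locales (use HST_axioms in simp_all)

section \<open>Definability in the universe of HST\<close>

named_theorems udfn

lemma U_trm_const [udfn]: "U.trm (\<lambda>_. c)"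
  by (rule U.trm_const_in) simp

lemma U_pr_mem [udfn]:
  "U.trm t \<Longrightarrow> U.trm s \<Longrightarrow> U.trm r \<Longrightarrow> U.dfn (\<lambda>_ e. U.pr (s e) (r e) \<epsilon> t e)"
  using U.dfn_pr_E[of t s r] by (simp add: U.E_def)

lemma U_eq_pr [udfn]:
  "U.trm t \<Longrightarrow> U.trm s \<Longrightarrow> U.trm r \<Longrightarrow> U.dfn (\<lambda>_ e. t e = U.pr (s e) (r e))"
  by (rule U.dfn_eq_pr)

lemmas [udfn] = U.trm_var U.dfn_neg U.dfn_conj U.dfn_disj U.dfn_imp U.dfn_iff U.dfn_mem U.dfn_eq

lemma U_all [udfn]:
  "U.dfn (\<lambda>_ e. Q (e 0) (\<lambda>n. e (Suc n))) \<Longrightarrow> U.dfn (\<lambda>_ e. \<forall>x. Q x e)"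
  using U.dfn_all_M[of Q] by simp

lemma U_ex [udfn]:
  "U.dfn (\<lambda>_ e. Q (e 0) (\<lambda>n. e (Suc n))) \<Longrightarrow> U.dfn (\<lambda>_ e. \<exists>x. Q x e)"
  using U.dfn_ex_M[of Q] by simp

lemma U_st [udfn]: "U.trm t \<Longrightarrow> U.dfn (\<lambda>_ e. st (t e))"
  using U.dfn_st by simp

lemma U_SS [udfn]: "U.trm t \<Longrightarrow> U.dfn (\<lambda>_ e. t e \<in> SS)"
  unfolding Standard_def mem_Collect_eq by (rule U_st)

lemma U_II [udfn]: "U.trm t \<Longrightarrow> U.dfn (\<lambda>_ e. t e \<in> II)"
  unfolding Internal_def mem_Collect_eq by (intro udfn U.trm_shift)

lemma U_SE [udfn]: "U.trm t \<Longrightarrow> U.trm s \<Longrightarrow> U.dfn (\<lambda>_ e. t e \<in> S.E (s e))"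
  unfolding S.E_def mem_Collect_eq by (intro udfn U.trm_shift)

lemma U_ball_SS [udfn]:
  "U.dfn (\<lambda>_ e. Q (e 0) (\<lambda>n. e (Suc n))) \<Longrightarrow> U.dfn (\<lambda>_ e. \<forall>x\<in>SS. Q x e)"
  unfolding Ball_def by (intro udfn)

lemma U_bex_SS [udfn]:
  "U.dfn (\<lambda>_ e. Q (e 0) (\<lambda>n. e (Suc n))) \<Longrightarrow> U.dfn (\<lambda>_ e. \<exists>x\<in>SS. Q x e)"
  unfolding Bex_def by (intro udfn)

lemma U_ball_II [udfn]:
  "U.dfn (\<lambda>_ e. Q (e 0) (\<lambda>n. e (Suc n))) \<Longrightarrow> U.dfn (\<lambda>_ e. \<forall>x\<in>II. Q x e)"
  unfolding Ball_def by (intro udfn)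

lemma U_bex_II [udfn]:
  "U.dfn (\<lambda>_ e. Q (e 0) (\<lambda>n. e (Suc n))) \<Longrightarrow> U.dfn (\<lambda>_ e. \<exists>x\<in>II. Q x e)"
  unfolding Bex_def by (intro udfn)

lemma U_ball_SE [udfn]:
  "U.dfn (\<lambda>_ e. Q (e 0) (\<lambda>n. e (Suc n))) \<Longrightarrow> U.trm s \<Longrightarrow> U.dfn (\<lambda>_ e. \<forall>x\<in>S.E (s e). Q x e)"
  unfolding Ball_def by (intro udfn U.trm_shift)

lemma U_bex_SE [udfn]:
  "U.dfn (\<lambda>_ e. Q (e 0) (\<lambda>n. e (Suc n))) \<Longrightarrow> U.trm s \<Longrightarrow> U.dfn (\<lambda>_ e. \<exists>x\<in>S.E (s e). Q x e)"
  unfolding Bex_def by (intro udfn U.trm_shift)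

lemma U_pair_II [udfn]:
  "U.trm t \<Longrightarrow> U.trm s \<Longrightarrow> U.trm r \<Longrightarrow> U.dfn (\<lambda>_ e. is_pair_in mem II (t e) (s e) (r e))"
  unfolding is_pair_in_def is_upair_in_def by (intro udfn U.trm_shift)

lemma U_related_II [udfn]:
  "U.trm t \<Longrightarrow> U.trm s \<Longrightarrow> U.trm r \<Longrightarrow> U.dfn (\<lambda>_ e. related_in mem II (t e) (s e) (r e))"
  unfolding related_in_def by (intro udfn U.trm_shift)

lemma U_pair_SS [udfn]:
  "U.trm t \<Longrightarrow> U.trm s \<Longrightarrow> U.trm r \<Longrightarrow> U.dfn (\<lambda>_ e. is_pair_in mem SS (t e) (s e) (r e))"
  unfolding is_pair_in_def is_upair_in_def by (intro udfn U.trm_shift)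

lemma U_E_iff: "y \<in> U.E x \<longleftrightarrow> y \<epsilon> x"
  by (simp add: U.E_def)

lemma ext: "(\<And>z. z \<epsilon> x \<longleftrightarrow> z \<epsilon> y) \<Longrightarrow> x = y"
  by (rule U.E_eqI) (simp_all add: U_E_iff)

lemma U_sep:
  assumes "U.dfn (\<lambda>_ e. P (e 0))" obtains b where "\<forall>x. x \<epsilon> b \<longleftrightarrow> x \<epsilon> a \<and> P x"
proof -
  have m: "U.mset {x \<in> U.E a. P x}" by (intro U.mset_sep U.mset_E assms) simp
  then have "U.E (U.cd {x \<in> U.E a. P x}) = {x \<in> U.E a. P x}" by simp
  then have "x \<epsilon> U.cd {x \<in> U.E a. P x} \<longleftrightarrow> x \<epsilon> a \<and> P x" for x
    unfolding set_eq_iff by (simp add: U_E_iff)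
  then show thesis by (intro that[of "U.cd {x \<in> U.E a. P x}"] allI)
qed

lemma U_coll:
  assumes "U.dfn (\<lambda>_ e. P (e 0) (e (Suc 0)))"
  obtains b where "\<forall>x y. x \<epsilon> a \<longrightarrow> P x y \<longrightarrow> (\<exists>y. y \<epsilon> b \<and> P x y)"
proof -
  have "U.mset (U.E a)" by (rule U.mset_E) simp
  from U.mset_collection[OF this assms] obtain B where
    B: "U.mset B" "\<And>x y. x \<in> U.E a \<Longrightarrow> y \<in> UNIV \<Longrightarrow> P x y \<Longrightarrow> \<exists>y\<in>B. P x y" by blast
  have EB: "U.E (U.cd B) = B" using B(1) by simp
  show thesis
  proof (rule that[of "U.cd B"], intro allI impI)
    fix x y assume "x \<epsilon> a" "P x y"
    then obtain y where y: "y \<in> B" "P x y" using B(2)[of x y] by (auto simp: U_E_iff)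
    have "y \<epsilon> U.cd B" using y(1) U_E_iff[of y "U.cd B"] EB by simp
    then show "\<exists>y. y \<epsilon> U.cd B \<and> P x y" using y(2) by blast
  qed
qed

lemma standardize:
  obtains Y where "Y \<in> SS" "\<forall>x\<in>SS. x \<epsilon> Y \<longleftrightarrow> x \<epsilon> X"
proof -
  obtain Y where "st Y" "\<forall>x. st x \<longrightarrow> (x \<epsilon> X \<longleftrightarrow> x \<epsilon> Y)"
    using HST_axioms(10)[unfolded standardization_def, rule_format, of X] by (elim exE conjE)
  then show thesis by (intro that[of Y]) (simp_all add: Standard_def)
qed

text \<open>Replaces Separation in the standard universe for properties that mention
  \<open>st\<close> or external sets; the description of \<open>Y\<close> is correct for its
  standard elements only.\<close>

lemma standardize_sep:
  assumes "U.dfn (\<lambda>_ e. P (e 0))"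
  obtains Y where "Y \<in> SS" "\<forall>x\<in>SS. x \<epsilon> Y \<longleftrightarrow> x \<epsilon> a \<and> P x"
proof -
  obtain b where b: "\<forall>x. x \<epsilon> b \<longleftrightarrow> x \<epsilon> a \<and> P x" by (rule U_sep[OF assms])
  obtain Y where Y: "Y \<in> SS" "\<forall>x\<in>SS. x \<epsilon> Y \<longleftrightarrow> x \<epsilon> b" by (rule standardize)
  show thesis by (rule that[OF Y(1)]) (simp add: Y(2) b)
qed

lemma elem_internal: "x \<in> II \<Longrightarrow> y \<epsilon> x \<Longrightarrow> y \<in> II"
  using HST_axioms(9) unfolding internal_transitivity_def by blast

text \<open>Because the internal universe is transitive, \<open>I.E\<close> is the true extension of
  an internal set, whereas \<open>S.E\<close> retains only the standard elements.\<close>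

lemma I_E_iff: "x \<in> II \<Longrightarrow> y \<in> I.E x \<longleftrightarrow> y \<epsilon> x"
  using elem_internal by (auto simp: I.E_def)

lemma S_E_iff: "y \<in> S.E x \<longleftrightarrow> y \<in> SS \<and> y \<epsilon> x"
  by (auto simp: S.E_def)

lemma mset_I_cd_iff: "I.mset A \<Longrightarrow> y \<epsilon> I.cd A \<longleftrightarrow> y \<in> A"
  using I_E_iff[of "I.cd A" y] by simp

section \<open>Well-founded sets are of standard size\<close>

text \<open>The isomorphism between well-founded and standard sets, restricted to a transitive
  well-founded set \<open>T\<close>, is obtained as the union of all bisimulations between \<open>T\<close> and the standard
  sets.\<close>

lemma WellFounded_index:
  assumes "A \<in> WellFounded mem"
  obtains a R where "a \<in> SS" "U.dfn (\<lambda>_ e. R (e 0) (e (Suc 0)))"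
    "\<forall>x. x \<epsilon> A \<longrightarrow> (\<exists>t\<in>S.E a. R t x)" "\<forall>t x. R t x \<longrightarrow> x \<epsilon> A"
    "\<forall>t\<in>S.E a. \<exists>x. R t x" "\<forall>t x y. R t x \<longrightarrow> R t y \<longrightarrow> x = y"
proof -
  obtain T where T: "subset_in mem UNIV A T" "transitive_in mem UNIV T" "wellfounded_on_in mem UNIV T"
    using assms unfolding WellFounded_def by blast
  have AT: "x \<epsilon> T" if "x \<epsilon> A" for x using T(1) that unfolding subset_in_def by blast
  have TT: "y \<epsilon> T" if "x \<epsilon> T" "y \<epsilon> x" for x y
    using T(2) that unfolding transitive_in_def subset_in_def by blast
  have ind: "P x"
    if x: "x \<epsilon> T" and d: "U.dfn (\<lambda>_ e. P (e 0))" and step: "\<And>x. x \<epsilon> T \<Longrightarrow> (\<And>y. y \<epsilon> x \<Longrightarrow> P y) \<Longrightarrow> P x"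
    for P x
  proof (rule ccontr)
    assume "\<not> P x"
    obtain u where u: "\<forall>x. x \<epsilon> u \<longleftrightarrow> x \<epsilon> T \<and> \<not> P x" by (rule U_sep[OF U.dfn_neg[OF d]])
    have "subset_in mem UNIV u T \<and> nonempty_in mem UNIV u"
      using u x \<open>\<not> P x\<close> unfolding subset_in_def nonempty_in_def by simp blast
    then obtain z where z: "z \<epsilon> u" "\<not> (\<exists>y\<in>UNIV. y \<epsilon> u \<and> y \<epsilon> z)"
      using T(3) unfolding wellfounded_on_in_def by blast
    have zT: "z \<epsilon> T" "\<not> P z" using z(1) u by simp_all
    have "P y" if "y \<epsilon> z" for y using z(2) that u TT[OF zT(1) that] by blast
    then show False using step[OF zT(1)] zT(2) by blast
  qed
  \<comment> \<open>Elements of \<open>x\<close> are matched with the standard elements of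
    \<open>s\<close>; nonstandard elements of \<open>s\<close> do not count. The union
    \<open>R\<close> of all such \<open>r\<close> becomes the graph of the isomorphism.\<close>
  define bis where "bis r \<longleftrightarrow> (\<forall>x s. U.pr x s \<epsilon> r \<longrightarrow> s \<in> SS \<and> x \<epsilon> T \<and>
      (\<forall>x'. x' \<epsilon> x \<longrightarrow> (\<exists>s'\<in>SS. s' \<epsilon> s \<and> U.pr x' s' \<epsilon> r)) \<and>
      (\<forall>s'\<in>SS. s' \<epsilon> s \<longrightarrow> (\<exists>x'. x' \<epsilon> x \<and> U.pr x' s' \<epsilon> r)))" for r
  define R where "R x s \<longleftrightarrow> (\<exists>r. bis r \<and> U.pr x s \<epsilon> r)" for x s
  have dbis: "U.dfn (\<lambda>_ e. bis (e 0))" unfolding bis_def by (intro udfn)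
  have dR: "U.dfn (\<lambda>_ e. R (e 0) (e (Suc 0)))" unfolding R_def by (intro udfn U.dfn_subst1[OF dbis])
  have R_std: "s \<in> SS" and R_T: "x \<epsilon> T" if "R x s" for x s
    using that unfolding R_def bis_def by blast+
  have R_forth: "\<exists>s'\<in>SS. s' \<epsilon> s \<and> R x' s'" if h: "R x s" "x' \<epsilon> x" for x s x'
  proof -
    obtain r where r: "bis r" "U.pr x s \<epsilon> r" using h(1) unfolding R_def by blast
    then obtain s' where "s' \<in> SS" "s' \<epsilon> s" "U.pr x' s' \<epsilon> r" using h(2) unfolding bis_def by blast
    then show ?thesis using r(1) unfolding R_def by blast
  qed
  have R_back: "\<exists>x'. x' \<epsilon> x \<and> R x' s'" if h: "R x s" "s' \<epsilon> s" "s' \<in> SS" for x s s'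
  proof -
    obtain r where r: "bis r" "U.pr x s \<epsilon> r" using h(1) unfolding R_def by blast
    then obtain x' where "x' \<epsilon> x" "U.pr x' s' \<epsilon> r" using h(2,3) unfolding bis_def by blast
    then show ?thesis using r(1) unfolding R_def by blast
  qed
  have uniq: "\<forall>s s'. R x s \<longrightarrow> R x s' \<longrightarrow> s = s'" if "x \<epsilon> T" for x
  proof (rule ind[OF that, of "\<lambda>x. \<forall>s s'. R x s \<longrightarrow> R x s' \<longrightarrow> s = s'"])
    show "U.dfn (\<lambda>_ e. \<forall>s s'. R (e 0) s \<longrightarrow> R (e 0) s' \<longrightarrow> s = s')"
      by (intro udfn U.dfn_subst2[OF dR])
    fix x assume x: "x \<epsilon> T" and IH: "\<And>y. y \<epsilon> x \<Longrightarrow> \<forall>s s'. R y s \<longrightarrow> R y s' \<longrightarrow> s = s'"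
    have sub: "t \<epsilon> s'" if h: "R x s" "R x s'" "t \<in> SS" "t \<epsilon> s" for s s' t
    proof -
      obtain x' where x': "x' \<epsilon> x" "R x' t" using R_back[OF h(1,4,3)] by blast
      obtain t' where "t' \<epsilon> s'" "R x' t'" using R_forth[OF h(2) x'(1)] by blast
      then show ?thesis using IH[OF x'(1)] x'(2) by blast
    qed
    show "\<forall>s s'. R x s \<longrightarrow> R x s' \<longrightarrow> s = s'"
    proof (intro allI impI)
      fix s s' assume s: "R x s" "R x s'"
      show "s = s'"
      \<comment> \<open>Extensionality of the standard universe: standard sets with the same
        standard elements are equal.\<close>
      proof (rule S.E_eqI)
        show "t \<in> S.E s \<longleftrightarrow> t \<in> S.E s'" if "t \<in> SS" for t
          using sub[OF s that] sub[OF s(2,1) that] that by (auto simp: S_E_iff)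
      qed (use s R_std in blast)+
    qed
  qed
  have inj: "\<forall>x' s. R x s \<longrightarrow> R x' s \<longrightarrow> x = x'" if "x \<epsilon> T" for x
  proof (rule ind[OF that, of "\<lambda>x. \<forall>x' s. R x s \<longrightarrow> R x' s \<longrightarrow> x = x'"])
    show "U.dfn (\<lambda>_ e. \<forall>x' s. R (e 0) s \<longrightarrow> R x' s \<longrightarrow> e 0 = x')"
      by (intro udfn U.dfn_subst2[OF dR])
    fix x assume x: "x \<epsilon> T" and IH: "\<And>y. y \<epsilon> x \<Longrightarrow> \<forall>x' s. R y s \<longrightarrow> R x' s \<longrightarrow> y = x'"
    show "\<forall>x' s. R x s \<longrightarrow> R x' s \<longrightarrow> x = x'"
    proof (intro allI impI)
      fix x' s assume s: "R x s" "R x' s"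
      show "x = x'"
      proof (rule ext)
        fix z show "z \<epsilon> x \<longleftrightarrow> z \<epsilon> x'"
        proof
          assume z: "z \<epsilon> x"
          then obtain t where t: "t \<in> SS" "t \<epsilon> s" "R z t" using R_forth[OF s(1)] by blast
          then obtain z' where "z' \<epsilon> x'" "R z' t" using R_back[OF s(2)] by blast
          then show "z \<epsilon> x'" using IH[OF z] t(3) by blast
        next
          assume z: "z \<epsilon> x'"
          then obtain t where t: "t \<in> SS" "t \<epsilon> s" "R z t" using R_forth[OF s(2)] by blast
          then obtain z' where z': "z' \<epsilon> x" "R z' t" using R_back[OF s(1)] by blast
          then show "z \<epsilon> x" using IH[OF z'(1)] t(3) by blast
        qed
      qed
    qed
  qed
  have total: "\<exists>s. R x s" if "x \<epsilon> T" for x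
  proof (rule ind[OF that, of "\<lambda>x. \<exists>s. R x s"])
    show "U.dfn (\<lambda>_ e. \<exists>s. R (e 0) s)" by (intro udfn U.dfn_subst2[OF dR])
    fix x assume x: "x \<epsilon> T" and IH: "\<And>y. y \<epsilon> x \<Longrightarrow> \<exists>s. R y s"
    have "U.dfn (\<lambda>_ e. bis (e (Suc 0)) \<and> (\<exists>s. U.pr (e 0) s \<epsilon> e (Suc 0)))"
      by (intro udfn U.dfn_subst1[OF dbis])
    then obtain b where b: "\<forall>x' r. x' \<epsilon> x \<longrightarrow> bis r \<and> (\<exists>s. U.pr x' s \<epsilon> r) \<longrightarrow>
        (\<exists>r. r \<epsilon> b \<and> bis r \<and> (\<exists>s. U.pr x' s \<epsilon> r))"
      by (rule U_coll)
    have "U.mset (\<Union>r\<in>U.E b. U.E r)" by (intro U.mset_Union U.mset_E) simp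
    then have "U.E (U.cd (\<Union>r\<in>U.E b. U.E r)) = (\<Union>r\<in>U.E b. U.E r)" by (rule U.E_cd)
    then have Un: "p \<epsilon> U.cd (\<Union>r\<in>U.E b. U.E r) \<longleftrightarrow> (\<exists>r. r \<epsilon> b \<and> p \<epsilon> r)" for p
      unfolding set_eq_iff UN_iff Bex_def U_E_iff by blast
    have "U.dfn (\<lambda>_ e. \<exists>r. r \<epsilon> b \<and> bis r \<and> e 0 \<epsilon> r)" by (intro udfn U.dfn_subst1[OF dbis])
    then obtain g where
      "\<forall>p. p \<epsilon> g \<longleftrightarrow> p \<epsilon> U.cd (\<Union>r\<in>U.E b. U.E r) \<and> (\<exists>r. r \<epsilon> b \<and> bis r \<and> p \<epsilon> r)" by (rule U_sep)
    then have g: "p \<epsilon> g \<longleftrightarrow> (\<exists>r. r \<epsilon> b \<and> bis r \<and> p \<epsilon> r)" for p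
      using Un by blast
    have bg: "bis g"
      unfolding bis_def
    proof (intro allI impI)
      fix y s assume "U.pr y s \<epsilon> g"
      then obtain r where r: "r \<epsilon> b" "bis r" "U.pr y s \<epsilon> r" using g by blast
      have sub: "p \<epsilon> g" if "p \<epsilon> r" for p using that r(1,2) g by blast
      have "s \<in> SS \<and> y \<epsilon> T \<and> (\<forall>x'. x' \<epsilon> y \<longrightarrow> (\<exists>s'\<in>SS. s' \<epsilon> s \<and> U.pr x' s' \<epsilon> r)) \<and>
          (\<forall>s'\<in>SS. s' \<epsilon> s \<longrightarrow> (\<exists>x'. x' \<epsilon> y \<and> U.pr x' s' \<epsilon> r))"
        using r(2)[unfolded bis_def, rule_format, OF r(3)] .
      then show "s \<in> SS \<and> y \<epsilon> T \<and> (\<forall>x'. x' \<epsilon> y \<longrightarrow> (\<exists>s'\<in>SS. s' \<epsilon> s \<and> U.pr x' s' \<epsilon> g)) \<and>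
          (\<forall>s'\<in>SS. s' \<epsilon> s \<longrightarrow> (\<exists>x'. x' \<epsilon> y \<and> U.pr x' s' \<epsilon> g))"
        using sub by blast
    qed
    have gx: "\<exists>s. U.pr x' s \<epsilon> g" if x': "x' \<epsilon> x" for x'
    proof -
      obtain s r where "bis r" "U.pr x' s \<epsilon> r" using IH[OF x'] unfolding R_def by blast
      then have "\<exists>r. r \<epsilon> b \<and> bis r \<and> (\<exists>s. U.pr x' s \<epsilon> r)" using b x' by blast
      then show ?thesis using g by blast
    qed
    define c where "c = U.cd (U.rel g `` U.E x)"
    have "U.mset (U.rel g `` U.E x)" by (intro U.mset_Image U.mrel_rel U.mset_E) simp_all
    then have "U.E c = U.rel g `` U.E x" by (simp add: c_def)
    then have c: "s \<epsilon> c \<longleftrightarrow> (\<exists>x'. x' \<epsilon> x \<and> U.pr x' s \<epsilon> g)" for s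
      unfolding set_eq_iff U.rel_def by (auto simp: U_E_iff)
    \<comment> \<open>The image of \<open>x\<close> must be standard, which the set \<open>c\<close>
      of the images of its elements need not be; \<open>y\<close> has the same standard elements as
      \<open>c\<close>.\<close>
    obtain y where y: "y \<in> SS" "\<forall>t\<in>SS. t \<epsilon> y \<longleftrightarrow> t \<epsilon> c" by (rule standardize)
    define h where "h = U.cd (insert (U.pr x y) (U.E g))"
    have "U.mset (insert (U.pr x y) (U.E g))" by (intro U.mset_insert U.mset_E) simp_all
    then have "U.E h = insert (U.pr x y) (U.E g)" by (simp add: h_def)
    then have h: "p \<epsilon> h \<longleftrightarrow> p = U.pr x y \<or> p \<epsilon> g" for p
      unfolding set_eq_iff by (simp add: U_E_iff)
    have "bis h"
      unfolding bis_def
    proof (intro allI impI)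
      fix z s assume "U.pr z s \<epsilon> h"
      then consider "z = x" "s = y" | "U.pr z s \<epsilon> g" using h by auto
      then show "s \<in> SS \<and> z \<epsilon> T \<and> (\<forall>x'. x' \<epsilon> z \<longrightarrow> (\<exists>s'\<in>SS. s' \<epsilon> s \<and> U.pr x' s' \<epsilon> h)) \<and>
          (\<forall>s'\<in>SS. s' \<epsilon> s \<longrightarrow> (\<exists>x'. x' \<epsilon> z \<and> U.pr x' s' \<epsilon> h))"
      proof cases
        case 1
        have "\<exists>s'\<in>SS. s' \<epsilon> y \<and> U.pr x' s' \<epsilon> h" if x': "x' \<epsilon> x" for x'
        proof -
          obtain s' where s': "U.pr x' s' \<epsilon> g" using gx[OF x'] by blast
          then have "s' \<in> SS" using bg unfolding bis_def by blast
          moreover have "s' \<epsilon> c" using c s' x' by blast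
          ultimately show ?thesis using y(2) h s' by blast
        qed
        moreover have "\<exists>x'. x' \<epsilon> x \<and> U.pr x' s' \<epsilon> h" if "s' \<in> SS" "s' \<epsilon> y" for s'
          using that y(2) c h by blast
        ultimately show ?thesis using 1 y(1) x by blast
      next
        case 2
        have "s \<in> SS \<and> z \<epsilon> T \<and> (\<forall>x'. x' \<epsilon> z \<longrightarrow> (\<exists>s'\<in>SS. s' \<epsilon> s \<and> U.pr x' s' \<epsilon> g)) \<and>
            (\<forall>s'\<in>SS. s' \<epsilon> s \<longrightarrow> (\<exists>x'. x' \<epsilon> z \<and> U.pr x' s' \<epsilon> g))"
          using bg[unfolded bis_def, rule_format, OF 2] .
        then show ?thesis using h by blast
      qed
    qed
    moreover have "U.pr x y \<epsilon> h" using h by blast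
    ultimately show "\<exists>s. R x s" unfolding R_def by blast
  qed
  \<comment> \<open>Collection followed by Standardization gives a standard \<open>a\<close> whose
    standard elements are the images of the elements of \<open>A\<close>.\<close>
  obtain b where b: "\<forall>x s. x \<epsilon> A \<longrightarrow> R x s \<longrightarrow> (\<exists>s. s \<epsilon> b \<and> R x s)" by (rule U_coll[OF dR])
  have "U.dfn (\<lambda>_ e. \<exists>x. x \<epsilon> A \<and> R x (e 0))" by (intro udfn U.dfn_subst2[OF dR])
  then obtain a where
    a: "a \<in> SS" "\<forall>t\<in>SS. t \<epsilon> a \<longleftrightarrow> t \<epsilon> b \<and> (\<exists>x. x \<epsilon> A \<and> R x t)" by (rule standardize_sep)
  show thesis
  proof (rule that[of a "\<lambda>t x. x \<epsilon> A \<and> R x t"])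
    show "U.dfn (\<lambda>_ e. e (Suc 0) \<epsilon> A \<and> R (e (Suc 0)) (e 0))" by (intro udfn U.dfn_subst2[OF dR])
    have sur: "\<exists>t\<in>S.E a. x \<epsilon> A \<and> R x t" if x: "x \<epsilon> A" for x
    proof -
      obtain s where "R x s" using total[OF AT[OF x]] by blast
      then obtain t where t: "t \<epsilon> b" "R x t" using b x by blast
      then have "t \<in> S.E a" using a(2)[rule_format, OF R_std[OF t(2)]] x R_std[OF t(2)] by (auto simp: S_E_iff)
      then show ?thesis using t(2) x by blast
    qed
    then show "\<forall>x. x \<epsilon> A \<longrightarrow> (\<exists>t\<in>S.E a. x \<epsilon> A \<and> R x t)" by blast
    show "\<forall>t x y. x \<epsilon> A \<and> R x t \<longrightarrow> y \<epsilon> A \<and> R y t \<longrightarrow> x = y"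
      using inj AT by blast
    show "\<forall>t\<in>S.E a. \<exists>x. x \<epsilon> A \<and> R x t"
      using a(2) by (auto simp: S_E_iff)
  qed (use a in simp_all)
qed

section \<open>Finite standard sets and saturation\<close>

text \<open>Finiteness in the standard universe in its impredicative form: the finite subsets of
  \<open>b\<close> are those that lie in every standard family closed in this sense. Induction over
  standard families is then immediate.\<close>

definition fin_closed :: "'u \<Rightarrow> 'u \<Rightarrow> bool" where
  "fin_closed b K \<longleftrightarrow> S.zero \<in> S.E K \<and> (\<forall>v\<in>S.E K. \<forall>x\<in>S.E b. \<forall>w\<in>SS.
    (\<forall>z\<in>SS. z \<in> S.E w \<longleftrightarrow> z = x \<or> z \<in> S.E v) \<longrightarrow> w \<in> S.E K)"

definition Fin :: "'u \<Rightarrow> 'u" where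
  "Fin b = S.cd {u \<in> {u \<in> SS. S.E u \<subseteq> S.E b}. \<forall>K\<in>SS. fin_closed b K \<longrightarrow> u \<in> S.E K}"

lemma Fin:
  assumes "b \<in> SS"
  shows Fin_in: "Fin b \<in> SS"
    and Fin_iff: "u \<in> S.E (Fin b) \<longleftrightarrow> u \<in> SS \<and> S.E u \<subseteq> S.E b \<and> (\<forall>K\<in>SS. fin_closed b K \<longrightarrow> u \<in> S.E K)"
proof -
  have "S.mset {u \<in> {u \<in> SS. S.E u \<subseteq> S.E b}. \<forall>K\<in>SS. fin_closed b K \<longrightarrow> u \<in> S.E K}"
    unfolding fin_closed_def
    by (intro S.mset_sep S.mset_Pow S.mset_E assms S.dfn_intros S.zero_in)
  then show "Fin b \<in> SS"
    "u \<in> S.E (Fin b) \<longleftrightarrow> u \<in> SS \<and> S.E u \<subseteq> S.E b \<and> (\<forall>K\<in>SS. fin_closed b K \<longrightarrow> u \<in> S.E K)"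
    unfolding Fin_def by simp_all
qed

lemma S_insert:
  assumes "x \<in> SS" "v \<in> SS"
  shows "S.cd (insert x (S.E v)) \<in> SS" "S.E (S.cd (insert x (S.E v))) = insert x (S.E v)"
  using S.mset_insert[OF assms(1) S.mset_E[OF assms(2)]] by simp_all

lemma Fin_zero: "b \<in> SS \<Longrightarrow> S.zero \<in> S.E (Fin b)"
  by (simp add: Fin_iff fin_closed_def)

lemma Fin_insert:
  assumes "b \<in> SS" "x \<in> S.E b" "v \<in> S.E (Fin b)" shows "S.cd (insert x (S.E v)) \<in> S.E (Fin b)"
proof -
  have v: "v \<in> SS" "S.E v \<subseteq> S.E b" "\<forall>K\<in>SS. fin_closed b K \<longrightarrow> v \<in> S.E K" "x \<in> SS"
    using assms(3) unfolding Fin_iff[OF assms(1)] by (simp_all add: S.E_in[OF assms(2)])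
  note w = S_insert[OF v(4,1)]
  have "S.cd (insert x (S.E v)) \<in> S.E K" if K: "K \<in> SS" "fin_closed b K" for K
  proof -
    have "v \<in> S.E K" using v(3) K by blast
    moreover have "\<forall>z\<in>SS. z \<in> S.E (S.cd (insert x (S.E v))) \<longleftrightarrow> z = x \<or> z \<in> S.E v"
      unfolding w(2) by simp
    ultimately show ?thesis using K(2) assms(2) w(1) unfolding fin_closed_def by blast
  qed
  then show ?thesis using w v(2) assms(1,2) by (simp add: Fin_iff)
qed

text \<open>\<open>P\<close> may be external. Standardization supplies a standard family
  \<open>K\<close> with the finite sets satisfying \<open>P\<close> as its standard members, and the
  definition of \<open>Fin\<close> applies to \<open>K\<close>. In this sense, standard finite sets
  are finite for the whole universe.\<close>

lemma Fin_induct: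
  assumes b: "b \<in> SS" and u: "u \<in> S.E (Fin b)" and d: "U.dfn (\<lambda>_ e. P (e 0))"
    and zero: "P S.zero"
    and step: "\<And>v x. v \<in> S.E (Fin b) \<Longrightarrow> P v \<Longrightarrow> x \<in> S.E b \<Longrightarrow> P (S.cd (insert x (S.E v)))"
  shows "P u"
proof -
  obtain K where K: "K \<in> SS" "\<forall>x\<in>SS. x \<epsilon> K \<longleftrightarrow> x \<epsilon> Fin b \<and> P x" by (rule standardize_sep[OF d])
  have KE: "x \<in> S.E K \<longleftrightarrow> x \<in> S.E (Fin b) \<and> P x" for x
    using K(2) by (auto simp: S_E_iff)
  have "fin_closed b K"
    unfolding fin_closed_def
  proof (intro conjI ballI impI)
    show "S.zero \<in> S.E K" using KE Fin_zero[OF b] zero by blast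
    fix v x w assume v: "v \<in> S.E K" and x: "x \<in> S.E b" and w: "w \<in> SS"
      "\<forall>z\<in>SS. z \<in> S.E w \<longleftrightarrow> z = x \<or> z \<in> S.E v"
    have xv: "x \<in> SS" "v \<in> SS" using x v by (simp_all add: S_E_iff)
    note i = S_insert[OF xv]
    have "w = S.cd (insert x (S.E v))"
      by (rule S.E_eqI[OF w(1) i(1)]) (use w(2) i(2) in simp)
    moreover have "v \<in> S.E (Fin b)" "P v" using v KE by blast+
    ultimately show "w \<in> S.E K" using KE Fin_insert[OF b x] step[OF _ _ x] by blast
  qed
  then have "u \<in> S.E K" using u K(1) Fin_iff[OF b] by blast
  then show ?thesis using KE by blast
qed

lemma Fin_union:
  assumes b: "b \<in> SS" and u: "u \<in> S.E (Fin b)" and v: "v \<in> S.E (Fin b)"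
  shows "\<exists>w\<in>S.E (Fin b). S.E w = S.E u \<union> S.E v"
proof -
  have "\<exists>w\<in>S.E (Fin b). \<forall>z\<in>SS. z \<in> S.E w \<longleftrightarrow> z \<in> S.E u \<or> z \<in> S.E v"
  proof (rule Fin_induct[OF b u, of "\<lambda>u. \<exists>w\<in>S.E (Fin b). \<forall>z\<in>SS. z \<in> S.E w \<longleftrightarrow> z \<in> S.E u \<or> z \<in> S.E v"])
    show "U.dfn (\<lambda>_ e. \<exists>w\<in>S.E (Fin b). \<forall>z\<in>SS. z \<in> S.E w \<longleftrightarrow> z \<in> S.E (e 0) \<or> z \<in> S.E v)"
      by (intro udfn)
    show "\<exists>w\<in>S.E (Fin b). \<forall>z\<in>SS. z \<in> S.E w \<longleftrightarrow> z \<in> S.E S.zero \<or> z \<in> S.E v"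
      by (rule bexI[OF _ v]) simp
    fix u x assume u: "u \<in> S.E (Fin b)" "\<exists>w\<in>S.E (Fin b). \<forall>z\<in>SS. z \<in> S.E w \<longleftrightarrow> z \<in> S.E u \<or> z \<in> S.E v"
      and x: "x \<in> S.E b"
    from u(2) obtain w where w: "w \<in> S.E (Fin b)" "\<forall>z\<in>SS. z \<in> S.E w \<longleftrightarrow> z \<in> S.E u \<or> z \<in> S.E v"
      by (elim bexE)
    have xu: "x \<in> SS" "u \<in> SS" "w \<in> SS" using x u w by (simp_all add: S_E_iff)
    show "\<exists>w\<in>S.E (Fin b). \<forall>z\<in>SS. z \<in> S.E w \<longleftrightarrow> z \<in> S.E (S.cd (insert x (S.E u))) \<or> z \<in> S.E v"
      by (rule bexI[OF _ Fin_insert[OF b x w(1)]])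
        (use w(2) in \<open>simp add: S_insert(2)[OF xu(1,2)] S_insert(2)[OF xu(1,3)]\<close>)
  qed
  then obtain w where w: "w \<in> S.E (Fin b)" "\<forall>z\<in>SS. z \<in> S.E w \<longleftrightarrow> z \<in> S.E u \<or> z \<in> S.E v"
    by (elim bexE)
  have "S.E w = S.E u \<union> S.E v"
  proof (rule set_eqI)
    fix z show "z \<in> S.E w \<longleftrightarrow> z \<in> S.E u \<union> S.E v"
      using w(2) S.E_in[of z] by (cases "z \<in> SS") auto
  qed
  then show ?thesis using w(1) by blast
qed

lemma st_iff: "st u \<longleftrightarrow> u \<in> SS"
  by (simp add: Standard_def)

lemma U_function:
  assumes "U.mrel R" "single_valued R"
  obtains f where "is_function_in mem UNIV f" "\<forall>x y. related_in mem UNIV f x y \<longleftrightarrow> (x, y) \<in> R"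
proof -
  have R: "R \<subseteq> UNIV \<times> UNIV" "U.mset (U.prs R)" using assms(1) by (simp_all add: U.mrel_def)
  define f where "f = U.cd (U.prs R)"
  have f: "U.E f = U.prs R" using R(2) by (simp add: f_def)
  have rel: "related_in mem UNIV f x y \<longleftrightarrow> (x, y) \<in> R" for x y
    by (simp add: U.related_in_iff f U.in_prs_iff[OF R(1)])
  have "\<exists>x\<in>UNIV. \<exists>y\<in>UNIV. is_pair_in mem UNIV x y p" if "p \<epsilon> f" for p
  proof -
    have "p \<in> U.prs R" using that f U_E_iff[of p f] by simp
    then obtain x y where "p = U.pr x y" by (auto simp: U.prs_iff)
    then show ?thesis by (simp add: U.is_pair_in_iff)
  qed
  then have "is_function_in mem UNIV f"
    unfolding is_function_in_def rel using assms(2) unfolding single_valued_def by blast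
  then show thesis using that rel by blast
qed

lemma I_sep:
  assumes "G \<in> II" "I.dfn (\<lambda>_ e. P (e 0))"
  obtains H where "H \<in> II" "\<forall>y. y \<epsilon> H \<longleftrightarrow> y \<epsilon> G \<and> P y"
proof -
  have m: "I.mset {y \<in> I.E G. P y}" by (intro I.mset_sep I.mset_E assms)
  show thesis
  proof (rule that[of "I.cd {y \<in> I.E G. P y}"])
    show "\<forall>y. y \<epsilon> I.cd {y \<in> I.E G. P y} \<longleftrightarrow> y \<epsilon> G \<and> P y"
      using mset_I_cd_iff[OF m] I_E_iff[OF assms(1)] by simp
  qed (use m in simp)
qed

lemma I_Int:
  assumes "G \<in> II" "H \<in> II" obtains K where "K \<in> II" "\<forall>y. y \<epsilon> K \<longleftrightarrow> y \<epsilon> G \<and> y \<epsilon> H"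
proof -
  have "I.dfn (\<lambda>_ e. e 0 \<epsilon> H)" by (intro I.dfn_intros assms)
  then obtain K where "K \<in> II" "\<forall>y. y \<epsilon> K \<longleftrightarrow> y \<epsilon> G \<and> y \<epsilon> H" by (rule I_sep[OF assms(1)])
  then show thesis by (rule that)
qed

text \<open>Saturation for a family of internal sets indexed by the standard elements of \<open>b\<close>; the finite
  subfamilies are indexed by the standard finite subsets of \<open>b\<close>.\<close>

lemma saturation_finite:
  assumes b: "b \<in> SS" and dR: "U.dfn (\<lambda>_ e. R (e 0) (e (Suc 0)))"
    and int: "\<And>t. t \<in> S.E b \<Longrightarrow> \<exists>G\<in>II. \<forall>y. y \<epsilon> G \<longleftrightarrow> R t y"
    and fip: "\<And>u. u \<in> S.E (Fin b) \<Longrightarrow> \<exists>y. \<forall>t\<in>S.E u. R t y"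
    and t0: "t0 \<in> S.E b"
  shows "\<exists>y. \<forall>t\<in>S.E b. R t y"
proof -
  \<comment> \<open>Intersecting with the set indexed by \<open>t0\<close> gives the empty subfamily
    an intersection, too, and confines all intersections to one internal set.\<close>
  obtain W where W: "W \<in> II" "\<forall>y. y \<epsilon> W \<longleftrightarrow> R t0 y" using int[OF t0] by (elim bexE)
  define Gd where "Gd u G \<longleftrightarrow> (\<forall>y. y \<epsilon> G \<longleftrightarrow> y \<epsilon> W \<and> (\<forall>t\<in>S.E u. R t y))" for u G
  have dGd: "U.dfn (\<lambda>_ e. Gd (e 0) (e (Suc 0)))"
    unfolding Gd_def by (intro udfn U.dfn_subst2[OF dR])
  have Gd_ex: "\<exists>G\<in>II. Gd u G" if u: "u \<in> S.E (Fin b)" for u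
  proof (rule Fin_induct[OF b u, of "\<lambda>u. \<exists>G\<in>II. Gd u G"])
    show "U.dfn (\<lambda>_ e. \<exists>G\<in>II. Gd (e 0) G)" by (intro udfn U.dfn_subst2[OF dGd])
    show "\<exists>G\<in>II. Gd S.zero G" by (rule bexI[OF _ W(1)]) (simp add: Gd_def)
    fix v x assume v: "v \<in> S.E (Fin b)" "\<exists>G\<in>II. Gd v G" and x: "x \<in> S.E b"
    obtain G where G: "G \<in> II" "Gd v G" using v(2) by blast
    obtain H where H: "H \<in> II" "\<forall>y. y \<epsilon> H \<longleftrightarrow> R x y" using int[OF x] by (elim bexE)
    obtain K where K: "K \<in> II" "\<forall>y. y \<epsilon> K \<longleftrightarrow> y \<epsilon> G \<and> y \<epsilon> H" by (rule I_Int[OF G(1) H(1)])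
    have xv: "x \<in> SS" "v \<in> SS" using x v by (simp_all add: S_E_iff)
    have "Gd (S.cd (insert x (S.E v))) K"
      unfolding Gd_def S_insert(2)[OF xv] using K(2) H(2) G(2) unfolding Gd_def by auto
    then show "\<exists>G\<in>II. Gd (S.cd (insert x (S.E v))) G" using K(1) by blast
  qed
  have Gd_sv: "G = H" if "Gd u G" "Gd u H" for u G H
    by (rule ext) (use that in \<open>simp add: Gd_def\<close>)
  \<comment> \<open>The internal power set of \<open>W\<close> contains every finite intersection,
    so that these form a set \<open>F\<close> by Separation in the universe of HST.\<close>
  have mP: "I.mset {G \<in> II. I.E G \<subseteq> I.E W}" by (intro I.mset_Pow I.mset_E W)
  define PW where "PW = I.cd {G \<in> II. I.E G \<subseteq> I.E W}"
  have PW: "G \<epsilon> PW \<longleftrightarrow> G \<in> II \<and> I.E G \<subseteq> I.E W" for G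
    unfolding PW_def using mset_I_cd_iff[OF mP] by simp
  have Gd_PW: "G \<epsilon> PW" if "G \<in> II" "Gd u G" for u G
    using that by (auto simp: PW I_E_iff W(1) Gd_def)
  have "U.dfn (\<lambda>_ e. \<exists>u\<in>S.E (Fin b). Gd u (e 0))" by (intro udfn U.dfn_subst2[OF dGd])
  then obtain F where F0: "\<forall>G. G \<epsilon> F \<longleftrightarrow> G \<epsilon> PW \<and> (\<exists>u\<in>S.E (Fin b). Gd u G)" by (rule U_sep)
  have F: "G \<epsilon> F \<longleftrightarrow> G \<in> II \<and> (\<exists>u\<in>S.E (Fin b). Gd u G)" for G
    using F0 Gd_PW PW by blast
  \<comment> \<open>Assigning to a standard finite \<open>u\<close> the intersection over
    \<open>u\<close> is a function, and it shows that \<open>F\<close> is of standard size.\<close>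
  let ?R = "{(u, G). u \<in> U.E (Fin b) \<and> G \<in> U.E PW \<and> (u \<in> SS \<and> Gd u G)}"
  have "U.mrel ?R"
    by (rule U.mrel_Collect) (intro U.mset_E UNIV_I udfn U.dfn_subst2[OF dGd])+
  moreover have "single_valued ?R" unfolding single_valued_def using Gd_sv by blast
  ultimately obtain f where f: "is_function_in mem UNIV f"
    "\<forall>x y. related_in mem UNIV f x y \<longleftrightarrow> (x, y) \<in> ?R" by (rule U_function)
  have "standard_size mem st F"
    unfolding standard_size_def
  proof (intro exI conjI allI)
    show "st (Fin b)" using Fin_in[OF b] by (simp add: Standard_def)
    show "is_function_in mem UNIV f" by (rule f(1))
    fix G
    show "G \<epsilon> F \<longleftrightarrow> (\<exists>u. st u \<and> u \<epsilon> Fin b \<and> related_in mem UNIV f u G)"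
    proof
      assume "G \<epsilon> F"
      then obtain u where u: "G \<epsilon> PW" "u \<in> S.E (Fin b)" "Gd u G" using F0 by blast
      then have "u \<in> SS" "u \<epsilon> Fin b" by (simp_all add: S_E_iff)
      moreover from this have "(u, G) \<in> ?R" using u by (simp add: U_E_iff)
      ultimately show "\<exists>u. st u \<and> u \<epsilon> Fin b \<and> related_in mem UNIV f u G"
        using f(2) st_iff by blast
    next
      assume "\<exists>u. st u \<and> u \<epsilon> Fin b \<and> related_in mem UNIV f u G"
      then obtain u where "u \<epsilon> Fin b" "(u, G) \<in> ?R" using f(2) by blast
      then have "u \<in> S.E (Fin b)" "G \<epsilon> PW" "Gd u G" by (simp_all add: S_E_iff U_E_iff)
      then show "G \<epsilon> F" using F0 by blast
    qed
  qed
  moreover have "\<forall>X. X \<epsilon> F \<longrightarrow> X \<in> II \<and> nonempty_in mem UNIV X"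
  proof (intro allI impI conjI)
    fix X assume "X \<epsilon> F"
    then obtain u where u: "X \<in> II" "u \<in> S.E (Fin b)" "Gd u X" using F by blast
    show "X \<in> II" by (rule u(1))
    have tu: "t0 \<in> SS" "u \<in> SS" using t0 u by (simp_all add: S_E_iff)
    \<comment> \<open>The members of \<open>F\<close> are cut down to \<open>W\<close>, so a witness
      is taken for \<open>u\<close> together with \<open>t0\<close>.\<close>
    obtain y where "\<forall>t\<in>insert t0 (S.E u). R t y"
      using fip[OF Fin_insert[OF b t0 u(2)]] unfolding S_insert(2)[OF tu] by (elim exE)
    then have "y \<epsilon> X" using u(3) W(2) by (simp add: Gd_def)
    then show "nonempty_in mem UNIV X" unfolding nonempty_in_def by blast
  qed
  moreover have "\<forall>X Y. X \<epsilon> F \<and> Y \<epsilon> F \<longrightarrow> (\<exists>Z. Z \<epsilon> F \<and> (\<forall>x. x \<epsilon> Z \<longleftrightarrow> x \<epsilon> X \<and> x \<epsilon> Y))"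
  proof (intro allI impI)
    fix X Y assume XY: "X \<epsilon> F \<and> Y \<epsilon> F"
    then obtain u v where u: "u \<in> S.E (Fin b)" "Gd u X" and v: "v \<in> S.E (Fin b)" "Gd v Y"
      using F by blast
    obtain w where w: "w \<in> S.E (Fin b)" "S.E w = S.E u \<union> S.E v" using Fin_union[OF b u(1) v(1)] by blast
    obtain Z where Z: "Z \<in> II" "Gd w Z" using Gd_ex[OF w(1)] by blast
    have "x \<epsilon> Z \<longleftrightarrow> x \<epsilon> X \<and> x \<epsilon> Y" for x
      using Z(2) u(2) v(2) w(2) by (auto simp: Gd_def)
    moreover have "Z \<epsilon> F" using F Z w(1) by blast
    ultimately show "\<exists>Z. Z \<epsilon> F \<and> (\<forall>x. x \<epsilon> Z \<longleftrightarrow> x \<epsilon> X \<and> x \<epsilon> Y)" by blast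
  qed
  ultimately have "\<exists>x. \<forall>X. X \<epsilon> F \<longrightarrow> x \<epsilon> X"
    using HST_axioms(11)[unfolded saturation_def, rule_format, of F] by blast
  then obtain y where y: "\<forall>X. X \<epsilon> F \<longrightarrow> y \<epsilon> X" by (elim exE)
  have "R t y" if t: "t \<in> S.E b" for t
  proof -
    let ?u = "S.cd (insert t (S.E S.zero))"
    have u: "?u \<in> S.E (Fin b)" by (rule Fin_insert[OF b t Fin_zero[OF b]])
    obtain G where G: "G \<in> II" "Gd ?u G" using Gd_ex[OF u] by blast
    then have "y \<epsilon> G" using y F u by blast
    moreover have "S.E ?u = insert t (S.E S.zero)"
      using t by (intro S_insert(2)) (simp_all add: S_E_iff)
    ultimately show ?thesis using G(2) by (simp add: Gd_def)
  qed
  then show ?thesis by blast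
qed

text \<open>Collection finds standard sets that cover \<open>X\<close>, and Standardization makes
  them the standard elements of one standard \<open>Y\<close>. By Transfer the standard union of
  \<open>Y\<close> also contains the nonstandard elements of these sets.\<close>

lemma internal_cover:
  assumes "\<And>x. x \<epsilon> X \<Longrightarrow> x \<in> II" obtains w where "w \<in> SS" "\<forall>x. x \<epsilon> X \<longrightarrow> x \<epsilon> w"
proof -
  have "U.dfn (\<lambda>_ e. e (Suc 0) \<in> SS \<and> e 0 \<epsilon> e (Suc 0))" by (intro udfn)
  then obtain b where b: "\<forall>x s. x \<epsilon> X \<longrightarrow> s \<in> SS \<and> x \<epsilon> s \<longrightarrow> (\<exists>s. s \<epsilon> b \<and> s \<in> SS \<and> x \<epsilon> s)"
    by (rule U_coll)
  obtain Y where Y: "Y \<in> SS" "\<forall>s\<in>SS. s \<epsilon> Y \<longleftrightarrow> s \<epsilon> b" by (rule standardize)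
  have mU: "S.mset (\<Union>s\<in>S.E Y. S.E s)" by (intro S.mset_Union S.mset_E Y)
  define w where "w = S.cd (\<Union>s\<in>S.E Y. S.E s)"
  have w: "w \<in> SS" "S.E w = (\<Union>s\<in>S.E Y. S.E s)" using mU by (simp_all add: w_def)
  have "\<forall>s\<in>II. \<forall>x\<in>II. s \<epsilon> Y \<and> x \<epsilon> s \<longrightarrow> x \<epsilon> w"
  proof (rule transfer_sentence[of "\<lambda>M. \<forall>s\<in>M. \<forall>x\<in>M. s \<epsilon> Y \<and> x \<epsilon> s \<longrightarrow> x \<epsilon> w"])
    have "Y \<in> M" "w \<in> M" if "M \<in> {SS, II}" for M using that Y(1) w(1) SS_subset_II by auto
    then show "T.dfn (\<lambda>M _. \<forall>s\<in>M. \<forall>x\<in>M. s \<epsilon> Y \<and> x \<epsilon> s \<longrightarrow> x \<epsilon> w)"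
      by (intro T.dfn_intros)
    show "\<forall>s\<in>SS. \<forall>x\<in>SS. s \<epsilon> Y \<and> x \<epsilon> s \<longrightarrow> x \<epsilon> w"
      using w(2) unfolding S.E_def by blast
  qed
  moreover have "\<exists>s\<in>II. s \<epsilon> Y \<and> x \<epsilon> s" if x: "x \<epsilon> X" for x
  proof -
    obtain s where s: "s \<in> SS" "x \<epsilon> s"
      using assms[OF x] unfolding Internal_def Standard_def by blast
    then obtain s where "s \<epsilon> b" "s \<in> SS" "x \<epsilon> s" using b x by blast
    then show ?thesis using Y(2) SS_subset_II by blast
  qed
  ultimately have "\<forall>x. x \<epsilon> X \<longrightarrow> x \<epsilon> w" using assms by blast
  then show thesis using that w(1) by blast
qed

section \<open>Natural numbers\<close>

lemma zero_eq: "U.zero = I.zero"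
proof (rule U.E_eqI)
  show "x \<in> U.E U.zero \<longleftrightarrow> x \<in> U.E I.zero" for x
    using I_E_iff[OF I.zero_in, of x] by (simp add: U_E_iff[of x I.zero])
qed simp_all

lemma sc_eq:
  assumes "n \<in> II" shows "U.sc n = I.sc n"
proof (rule U.E_eqI)
  show "x \<in> U.E (U.sc n) \<longleftrightarrow> x \<in> U.E (I.sc n)" for x
    using I_E_iff[OF I.sc_in[OF assms], of x] I_E_iff[OF assms, of x] assms
    by (simp add: U_E_iff[of x n] U_E_iff[of x "I.sc n"])
qed simp_all

text \<open>Zero and successor are the same in both universes, so the set of internal natural
  numbers is inductive in the universe of HST.\<close>

lemma NN_subset: "n \<in> U.Om \<Longrightarrow> n \<in> I.Om"
proof -
  assume n: "n \<in> U.Om"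
  have c: "x \<epsilon> I.cd I.Om \<longleftrightarrow> x \<in> I.Om" for x by (rule mset_I_cd_iff[OF I.mset_Om])
  have "n \<epsilon> I.cd I.Om"
  proof (rule U.Om_induct[OF n, of "\<lambda>n. n \<epsilon> I.cd I.Om"])
    show "U.dfn (\<lambda>_ e. e 0 \<epsilon> I.cd I.Om)" by (intro udfn)
    show "U.zero \<epsilon> I.cd I.Om" unfolding c zero_eq by simp
    fix x assume "x \<epsilon> I.cd I.Om"
    then have "x \<in> I.Om" unfolding c .
    then show "U.sc x \<epsilon> I.cd I.Om" unfolding c using sc_eq[OF I.Om_in] by simp
  qed
  then show ?thesis unfolding c .
qed

section \<open>The gap between the spectra\<close>

lemma U_family [udfn]:
  assumes "U.trm t" "U.trm s" "U.trm r"
  shows "U.dfn (\<lambda>_ e. family_member mem F (t e) (s e) (r e))"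
proof -
  have "family_member mem F a b Y \<longleftrightarrow> (\<exists>p. p = U.pr a b \<and> U.pr p Y \<epsilon> F)" for a b Y
    unfolding family_member_def by (simp add: U.is_pair_in_iff U.related_in_iff U_E_iff)
  then show ?thesis by (simp only:) (intro udfn U.trm_shift assms)
qed

text \<open>Russell's argument. It excludes the case that \<open>B\<close> is empty and the
  intersection over \<open>B\<close> is the whole universe.\<close>

lemma not_universal: "\<exists>x. \<not> x \<epsilon> X"
proof -
  have "U.dfn (\<lambda>_ e. \<not> e 0 \<epsilon> e 0)" by (intro udfn)
  then obtain r where "\<forall>x. x \<epsilon> r \<longleftrightarrow> x \<epsilon> X \<and> \<not> x \<epsilon> x" by (rule U_sep)
  then have "r \<epsilon> r \<longleftrightarrow> r \<epsilon> X \<and> \<not> r \<epsilon> r" by (rule spec)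
  then show ?thesis by blast
qed

text \<open>All pairs of an index \<open>a\<close> and a finite subintersection of \<open>P a\<close> of size at most \<open>\<kappa>\<close> are
  covered simultaneously, so that no choice of the sets \<open>Z a\<close> is needed.\<close>

lemma Sigma_ss_2_cover:
  assumes X: "Sigma_ss_2 mem st X" and \<kappa>: "I.Card \<kappa>" and l: "I.Card l"
    and no_subset: "\<And>y. y \<in> II \<Longrightarrow> \<forall>z. z \<epsilon> y \<longrightarrow> z \<epsilon> X \<Longrightarrow> \<not> I.eqp (I.E y) (I.E \<kappa>)"
    and large: "\<And>n. n \<in> U.Om \<Longrightarrow> l \<notin> I.E (I.times n \<kappa>)"
  shows "\<exists>y\<in>II. (\<forall>z. z \<epsilon> X \<longrightarrow> z \<epsilon> y) \<and> I.eqp (I.E y) (I.E l)"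
proof (cases "\<exists>x. x \<epsilon> X")
  case False
  \<comment> \<open>The cardinal \<open>l\<close>, being an internal set of size \<open>l\<close>,
    covers the empty set.\<close>
  have "l \<in> II" by (rule I.Card_in[OF l])
  then show ?thesis using False I.eqp_refl[OF I.mset_E] by blast
next
  case True
  have \<kappa>I: "\<kappa> \<in> II" and lI: "l \<in> II" using \<kappa> l I.Card_in by blast+
  obtain A B F where AB: "A \<in> WellFounded mem" "B \<in> WellFounded mem" and F: "internal_family mem st F A B"
    and XF: "\<forall>x. x \<epsilon> X \<longleftrightarrow> (\<exists>a. a \<epsilon> A \<and> (\<forall>b. b \<epsilon> B \<longrightarrow> (\<exists>Y. family_member mem F a b Y \<and> x \<epsilon> Y)))"
    using X unfolding Sigma_ss_2_def by (elim bexE exE conjE)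
  obtain a0 Ra where a0: "a0 \<in> SS" and dRa: "U.dfn (\<lambda>_ e. Ra (e 0) (e (Suc 0)))"
    and Ra: "\<forall>x. x \<epsilon> A \<longrightarrow> (\<exists>t\<in>S.E a0. Ra t x)" "\<forall>t x. Ra t x \<longrightarrow> x \<epsilon> A"
      "\<forall>t\<in>S.E a0. \<exists>x. Ra t x" "\<forall>t x y. Ra t x \<longrightarrow> Ra t y \<longrightarrow> x = y"
    by (rule WellFounded_index[OF AB(1)])
  have Ra_sur: "\<exists>t\<in>S.E a0. Ra t x" if "x \<epsilon> A" for x using Ra(1) that by blast
  have Ra_A: "x \<epsilon> A" if "Ra t x" for t x using Ra(2) that by blast
  have Ra_sv: "x = y" if "Ra t x" "Ra t y" for t x y using Ra(4) that by blast
  obtain b0 Rb where b0: "b0 \<in> SS" and dRb: "U.dfn (\<lambda>_ e. Rb (e 0) (e (Suc 0)))"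
    and Rb: "\<forall>x. x \<epsilon> B \<longrightarrow> (\<exists>t\<in>S.E b0. Rb t x)" "\<forall>t x. Rb t x \<longrightarrow> x \<epsilon> B"
      "\<forall>t\<in>S.E b0. \<exists>x. Rb t x" "\<forall>t x y. Rb t x \<longrightarrow> Rb t y \<longrightarrow> x = y"
    by (rule WellFounded_index[OF AB(2)])
  have Rb_sur: "\<exists>t\<in>S.E b0. Rb t x" if "x \<epsilon> B" for x using Rb(1) that by blast
  have Rb_B: "x \<epsilon> B" if "Rb t x" for t x using Rb(2) that by blast
  have Rb_sv: "x = y" if "Rb t x" "Rb t y" for t x y using Rb(4) that by blast
  have Rb_ex: "\<exists>x. Rb t x" if "t \<in> S.E b0" for t using Rb(3) that by blast
  have fam_sv: "Y = Y'" if "family_member mem F a b Y" "family_member mem F a b Y'" for a b Y Y'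
  proof -
    have "is_function_in mem UNIV F" using F by (simp add: internal_family_def)
    then have "\<forall>x y z. related_in mem UNIV F x y \<and> related_in mem UNIV F x z \<longrightarrow> y = z"
      unfolding is_function_in_def by simp
    then show ?thesis using that unfolding family_member_def by (simp add: U.is_pair_in_iff)
  qed
  \<comment> \<open>\<open>x\<close> belongs to the member of the family with indices
    \<open>a\<close> and the \<open>b\<close> coded by \<open>t\<close>. The second index thus runs
    through the standard elements of \<open>b0\<close>.\<close>
  define D where "D a t x \<longleftrightarrow> (\<exists>b. Rb t b \<and> (\<exists>Y. family_member mem F a b Y \<and> x \<epsilon> Y))" for a t x
  have dD: "U.dfn (\<lambda>_ e. D (f e) (g e) (h e))" if "U.trm f" "U.trm g" "U.trm h" for f g h
    unfolding D_def by (intro udfn U.dfn_subst2[OF dRb] U.trm_shift that)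
  have D_int: "\<exists>Y\<in>II. \<forall>x. x \<epsilon> Y \<longleftrightarrow> D a t x" if a: "a \<epsilon> A" and t: "t \<in> S.E b0" for a t
  proof -
    obtain b where b: "Rb t b" using Rb_ex[OF t] by blast
    then obtain Y where Y: "Y \<in> II" "family_member mem F a b Y"
      using F a Rb_B[OF b] unfolding internal_family_def by blast
    have "x \<epsilon> Y \<longleftrightarrow> D a t x" for x
      unfolding D_def using b Y(2) Rb_sv fam_sv by blast
    then show ?thesis using Y(1) by blast
  qed
  have X_iff: "x \<epsilon> X \<longleftrightarrow> (\<exists>a. a \<epsilon> A \<and> (\<forall>t\<in>S.E b0. D a t x))" for x
  proof -
    have "(\<forall>b. b \<epsilon> B \<longrightarrow> (\<exists>Y. family_member mem F a b Y \<and> x \<epsilon> Y)) \<longleftrightarrow> (\<forall>t\<in>S.E b0. D a t x)" for a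
    proof
      assume h: "\<forall>b. b \<epsilon> B \<longrightarrow> (\<exists>Y. family_member mem F a b Y \<and> x \<epsilon> Y)"
      show "\<forall>t\<in>S.E b0. D a t x" unfolding D_def using h Rb_ex Rb_B by blast
    next
      assume h: "\<forall>t\<in>S.E b0. D a t x"
      show "\<forall>b. b \<epsilon> B \<longrightarrow> (\<exists>Y. family_member mem F a b Y \<and> x \<epsilon> Y)"
      proof (intro allI impI)
        fix b assume "b \<epsilon> B"
        then obtain t where t: "t \<in> S.E b0" "Rb t b" using Rb_sur by blast
        then obtain b' where "Rb t b'" "\<exists>Y. family_member mem F a b' Y \<and> x \<epsilon> Y"
          using h unfolding D_def by blast
        then show "\<exists>Y. family_member mem F a b Y \<and> x \<epsilon> Y" using Rb_sv[OF t(2)] by blast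
      qed
    qed
    then show ?thesis using XF by simp
  qed
  obtain aa where aa: "aa \<epsilon> A" using True X_iff by blast
  obtain t0 where t0: "t0 \<in> S.E b0"
  proof -
    have "S.E b0 \<noteq> {}"
    proof
      assume "S.E b0 = {}"
      then have "x \<epsilon> X" for x using X_iff aa by blast
      then show False using not_universal by blast
    qed
    then show thesis using that by blast
  qed
  have X_int: "x \<in> II" if x: "x \<epsilon> X" for x
  proof -
    obtain a where a: "a \<epsilon> A" "D a t0 x" using x X_iff t0 by blast
    obtain Y where Y: "Y \<in> II" "\<forall>x. x \<epsilon> Y \<longleftrightarrow> D a t0 x" using D_int[OF a(1) t0] by (elim bexE)
    show ?thesis by (rule elem_internal[OF Y(1)]) (simp add: Y(2) a(2))
  qed
  \<comment> \<open>All candidates are sought inside one internal set, so that they form internal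
    sets by Power set and Separation in the internal universe.\<close>
  obtain W where "W \<in> SS" and XW: "\<forall>x. x \<epsilon> X \<longrightarrow> x \<epsilon> W" by (rule internal_cover[OF X_int])
  then have W: "W \<in> II" using SS_subset_II by blast
  have mPW: "I.mset {y \<in> II. I.E y \<subseteq> I.E W}" by (intro I.mset_Pow I.mset_E W)
  have mLK: "I.mset {y \<in> {y \<in> II. I.E y \<subseteq> I.E W}. I.lep (I.E y) (I.E \<kappa>)}"
    by (intro I.mset_sep mPW I.dfn_intros \<kappa>I)
  have mEK: "I.mset {y \<in> {y \<in> II. I.E y \<subseteq> I.E W}. I.eqp (I.E y) (I.E \<kappa>)}"
    by (intro I.mset_sep mPW I.dfn_intros \<kappa>I)
  \<comment> \<open>\<open>LK\<close> contains the admissible sets \<open>Z a\<close>;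
    \<open>EK\<close> contains the sets of size \<kappa> among which Saturation is to find a subset
    of \<open>X\<close>.\<close>
  define LK where "LK = I.cd {y \<in> {y \<in> II. I.E y \<subseteq> I.E W}. I.lep (I.E y) (I.E \<kappa>)}"
  define EK where "EK = I.cd {y \<in> {y \<in> II. I.E y \<subseteq> I.E W}. I.eqp (I.E y) (I.E \<kappa>)}"
  have LK: "y \<epsilon> LK \<longleftrightarrow> y \<in> II \<and> I.E y \<subseteq> I.E W \<and> I.lep (I.E y) (I.E \<kappa>)" for y
    unfolding LK_def using mset_I_cd_iff[OF mLK] by simp
  have EK: "y \<epsilon> EK \<longleftrightarrow> y \<in> II \<and> I.E y \<subseteq> I.E W \<and> I.eqp (I.E y) (I.E \<kappa>)" for y
    unfolding EK_def using mset_I_cd_iff[OF mEK] by simp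
  have EK_II: "EK \<in> II" unfolding EK_def using mEK by simp
  define Zd where "Zd a u Z \<longleftrightarrow> (\<forall>x. x \<epsilon> Z \<longleftrightarrow> x \<epsilon> W \<and> (\<forall>t\<in>S.E u. D a t x))" for a u Z
  have dZd: "U.dfn (\<lambda>_ e. Zd (f e) (g e) (h e))" if "U.trm f" "U.trm g" "U.trm h" for f g h
    unfolding Zd_def by (intro udfn dD U.trm_shift that)
  have Zd_sv: "Z = Z'" if "Zd a u Z" "Zd a u Z'" for a u Z Z'
    by (rule ext) (use that in \<open>simp add: Zd_def\<close>)
  have Zd_ex: "\<exists>Z\<in>II. Zd a u Z" if a: "a \<epsilon> A" and u: "u \<in> S.E (Fin b0)" for a u
  proof (rule Fin_induct[OF b0 u, of "\<lambda>u. \<exists>Z\<in>II. Zd a u Z"])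
    show "U.dfn (\<lambda>_ e. \<exists>Z\<in>II. Zd a (e 0) Z)" by (intro udfn dZd)
    show "\<exists>Z\<in>II. Zd a S.zero Z" by (rule bexI[OF _ W]) (simp add: Zd_def)
    fix v x assume v: "v \<in> S.E (Fin b0)" "\<exists>Z\<in>II. Zd a v Z" and x: "x \<in> S.E b0"
    obtain Z where Z: "Z \<in> II" "Zd a v Z" using v(2) by blast
    obtain Y where Y: "Y \<in> II" "\<forall>y. y \<epsilon> Y \<longleftrightarrow> D a x y" using D_int[OF a x] by (elim bexE)
    obtain K where K: "K \<in> II" "\<forall>y. y \<epsilon> K \<longleftrightarrow> y \<epsilon> Z \<and> y \<epsilon> Y" by (rule I_Int[OF Z(1) Y(1)])
    have xv: "x \<in> SS" "v \<in> SS" using x v by (simp_all add: S_E_iff)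
    have "Zd a (S.cd (insert x (S.E v))) K"
      unfolding Zd_def S_insert(2)[OF xv] using K(2) Y(2) Z(2) unfolding Zd_def by auto
    then show "\<exists>Z\<in>II. Zd a (S.cd (insert x (S.E v))) Z" using K(1) by blast
  qed
  have Z_W: "I.E Z \<subseteq> I.E W" if "Z \<in> II" "Zd a u Z" for a u Z
    using that by (auto simp: I_E_iff W Zd_def)
  \<comment> \<open>Otherwise every finite intersection includes a member of \<open>EK\<close> by
    \<open>lep_Ord_cases\<close>. Saturation, applied to the sets of those \<open>y\<close> in
    \<open>EK\<close> that are included in the set indexed by \<open>t\<close>, yields one
    \<open>y\<close> inside \<open>P a\<close>, against \<open>no_subset\<close>.\<close>
  have small: "\<exists>u\<in>S.E (Fin b0). \<exists>Z\<in>II. Zd a u Z \<and> Z \<epsilon> LK" if a: "a \<epsilon> A" for a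
  proof (rule ccontr)
    assume no: "\<not> (\<exists>u\<in>S.E (Fin b0). \<exists>Z\<in>II. Zd a u Z \<and> Z \<epsilon> LK)"
    have "\<exists>y. \<forall>t\<in>S.E b0. y \<epsilon> EK \<and> (\<forall>x. x \<epsilon> y \<longrightarrow> D a t x)"
    proof (rule saturation_finite[OF b0 _ _ _ t0])
      show "U.dfn (\<lambda>_ e. e (Suc 0) \<epsilon> EK \<and> (\<forall>x. x \<epsilon> e (Suc 0) \<longrightarrow> D a (e 0) x))"
        by (intro udfn dD)
      fix t assume t: "t \<in> S.E b0"
      obtain Y where Y: "Y \<in> II" "\<forall>y. y \<epsilon> Y \<longleftrightarrow> D a t y" using D_int[OF a t] by (elim bexE)
      have "I.dfn (\<lambda>_ e. I.E (e 0) \<subseteq> I.E Y)" by (intro I.dfn_intros Y)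
      then obtain G where G: "G \<in> II" "\<forall>y. y \<epsilon> G \<longleftrightarrow> y \<epsilon> EK \<and> I.E y \<subseteq> I.E Y" by (rule I_sep[OF EK_II])
      have "y \<epsilon> G \<longleftrightarrow> y \<epsilon> EK \<and> (\<forall>x. x \<epsilon> y \<longrightarrow> D a t x)" for y
        using G(2) Y EK by (auto simp: subset_eq I_E_iff)
      then show "\<exists>G\<in>II. \<forall>y. y \<epsilon> G \<longleftrightarrow> y \<epsilon> EK \<and> (\<forall>x. x \<epsilon> y \<longrightarrow> D a t x)" using G(1) by blast
    next
      fix u assume u: "u \<in> S.E (Fin b0)"
      obtain Z where Z: "Z \<in> II" "Zd a u Z" using Zd_ex[OF a u] by blast
      then have "\<not> I.lep (I.E Z) (I.E \<kappa>)" using no u Z_W LK by blast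
      then obtain Y where Y: "I.mset Y" "Y \<subseteq> I.E Z" "I.eqp Y (I.E \<kappa>)"
        using I.lep_Ord_cases[OF I.mset_E[OF Z(1)] I.Card_Ord[OF \<kappa>]] by blast
      have "I.cd Y \<epsilon> EK" using EK Y Z_W[OF Z] by simp
      moreover have "\<forall>t\<in>S.E u. D a t x" if "x \<epsilon> I.cd Y" for x
        using that Z Y(2) unfolding mset_I_cd_iff[OF Y(1)] Zd_def by (auto simp: I_E_iff)
      ultimately show "\<exists>y. \<forall>t\<in>S.E u. y \<epsilon> EK \<and> (\<forall>x. x \<epsilon> y \<longrightarrow> D a t x)" by blast
    qed
    then obtain y where y: "\<forall>t\<in>S.E b0. y \<epsilon> EK \<and> (\<forall>x. x \<epsilon> y \<longrightarrow> D a t x)" by (elim exE)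
    have "y \<epsilon> EK" using y t0 by blast
    then have "y \<in> II" "I.eqp (I.E y) (I.E \<kappa>)" using EK by blast+
    moreover have "\<forall>z. z \<epsilon> y \<longrightarrow> z \<epsilon> X" using y X_iff a by blast
    ultimately show False using no_subset by blast
  qed
  have mP0: "S.mset (S.pp (S.E a0) (S.E (Fin b0)))"
    by (intro S.mset_pp S.mset_E a0 Fin_in b0)
  define P0 where "P0 = S.cd (S.pp (S.E a0) (S.E (Fin b0)))"
  have P0: "P0 \<in> SS" "S.E P0 = S.pp (S.E a0) (S.E (Fin b0))" using mP0 by (simp_all add: P0_def)
  \<comment> \<open>The index \<open>i\<close> codes some \<open>a\<close> and a finite
    \<open>u\<close>. It imposes no condition when the intersection over \<open>u\<close> is not in
    \<open>LK\<close>, as then no \<open>Z\<close> belongs to it.\<close>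
  define Wz where "Wz i Z \<longleftrightarrow> (\<exists>t\<in>S.E a0. \<exists>u\<in>S.E (Fin b0). is_pair_in mem SS t u i \<and>
      (\<exists>a. Ra t a \<and> Zd a u Z \<and> Z \<epsilon> LK))" for i Z
  have dWz: "U.dfn (\<lambda>_ e. Wz (e 0) (e (Suc 0)))"
    unfolding Wz_def by (intro udfn U.dfn_subst2[OF dRa] dZd)
  have Wz_sv: "Z = Z'" if i: "i \<in> SS" "Wz i Z" "Wz i Z'" for i Z Z'
  proof -
    obtain t u a where 1: "t \<in> SS" "u \<in> SS" "is_pair_in mem SS t u i" "Ra t a" "Zd a u Z"
      using i(2) unfolding Wz_def by (auto simp: S_E_iff)
    obtain t' u' a' where 2: "t' \<in> SS" "u' \<in> SS" "is_pair_in mem SS t' u' i" "Ra t' a'" "Zd a' u' Z'"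
      using i(3) unfolding Wz_def by (auto simp: S_E_iff)
    have "S.pr t u = S.pr t' u'" using 1(1-3) 2(1-3) i(1) by (simp add: S.is_pair_in_iff)
    then have "t = t'" "u = u'" using 1(1,2) 2(1,2) by simp_all
    then show ?thesis using 1 2 Ra_sv Zd_sv by blast
  qed
  have Wz_LK: "Z \<epsilon> LK" if "Wz i Z" for i Z using that unfolding Wz_def by blast
  obtain V where V: "I.mset V" "I.E W \<subseteq> V"
    "\<forall>Z. I.mset Z \<and> Z \<subseteq> I.E W \<and> I.lep Z (I.E l) \<longrightarrow>
      (\<exists>Y. I.mset Y \<and> Z \<subseteq> Y \<and> Y \<subseteq> V \<and> I.eqp Y (I.E l))"
    by (rule I.extend_to_size[OF I.mset_E[OF W] I.mset_E[OF lI]])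
  have mEL: "I.mset {y \<in> {y \<in> II. I.E y \<subseteq> V}. I.eqp (I.E y) (I.E l)}"
    by (intro I.mset_sep I.mset_Pow V I.dfn_intros lI)
  define EL where "EL = I.cd {y \<in> {y \<in> II. I.E y \<subseteq> V}. I.eqp (I.E y) (I.E l)}"
  have EL: "y \<epsilon> EL \<longleftrightarrow> y \<in> II \<and> I.E y \<subseteq> V \<and> I.eqp (I.E y) (I.E l)" for y
    unfolding EL_def using mset_I_cd_iff[OF mEL] by simp
  have EL_II: "EL \<in> II" unfolding EL_def using mEL by simp
  \<comment> \<open>Being of size at most \<open>n \<kappa>\<close> is a notion of the internal
    universe. Coding it as an internal relation \<open>ln\<close> lets it enter formulas of the
    whole universe as a mere parameter.\<close>
  let ?LN = "{(n, z). n \<in> I.Om \<and> z \<in> {y \<in> II. I.E y \<subseteq> I.E W} \<and> I.lep (I.E z) (I.pp (I.E n) (I.E \<kappa>))}"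
  have LNm: "I.mrel ?LN"
    by (intro I.mrel_Collect I.mset_Om mPW I.dfn_lep_pp_right I.trm_var I.trm_const_in \<kappa>I)
  define ln where "ln = I.cd (I.prs ?LN)"
  have ln: "related_in mem II ln n z \<longleftrightarrow> n \<in> I.Om \<and> I.E z \<subseteq> I.E W \<and> I.lep (I.E z) (I.pp (I.E n) (I.E \<kappa>))"
    if "n \<in> II" "z \<in> II" for n z
  proof -
    have m: "?LN \<subseteq> II \<times> II" "I.mset (I.prs ?LN)" using LNm by (simp_all only: I.mrel_def)
    have "related_in mem II ln n z \<longleftrightarrow> (n, z) \<in> ?LN"
      unfolding ln_def I.related_in_iff[OF that] I.E_cd[OF m(2)] by (rule I.in_prs_iff[OF m(1) that])
    then show ?thesis using that(2) by simp
  qed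
  \<comment> \<open>As an element of the universe, the set of true natural numbers can be a
    parameter of formulas.\<close>
  define om where "om = U.cd U.Om"
  have om: "n \<epsilon> om \<longleftrightarrow> n \<in> U.Om" for n
    using U_E_iff[of n om] by (simp add: om_def)
  \<comment> \<open>The bound \<open>n\<close> must be a true natural number, because
    \<open>large\<close> speaks of these only. This makes the property external, so its induction
    requires \<open>Fin_induct\<close>.\<close>
  define bounded where "bounded v \<longleftrightarrow> (\<exists>n. n \<epsilon> om \<and> (\<exists>z\<in>II. related_in mem II ln n z \<and>
      (\<forall>i\<in>S.E v. \<forall>Z. Wz i Z \<longrightarrow> (\<forall>x. x \<epsilon> Z \<longrightarrow> x \<epsilon> z))))" for v
  have finite_bound: "bounded v" if v: "v \<in> S.E (Fin P0)" for v
  proof (rule Fin_induct[OF P0(1) v])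
    show "U.dfn (\<lambda>_ e. bounded (e 0))"
      unfolding bounded_def by (intro udfn U.dfn_subst2[OF dWz])
    have "I.lep (I.E I.zero) (I.pp (I.E I.zero) (I.E \<kappa>))" by (simp add: I.lep_subset)
    then have "related_in mem II ln I.zero I.zero" by (simp add: ln)
    moreover have "I.zero \<epsilon> om" unfolding om zero_eq[symmetric] by simp
    ultimately show "bounded S.zero"
      unfolding bounded_def
      by (intro exI[of _ I.zero] conjI bexI[of _ I.zero]) simp_all
    fix v j assume v: "v \<in> S.E (Fin P0)" "bounded v" and j: "j \<in> S.E P0"
    have jv: "j \<in> SS" "v \<in> SS" using j v(1) by (simp_all add: S_E_iff)
    obtain n z where n: "n \<in> U.Om" and z: "z \<in> II" "related_in mem II ln n z"
      "\<forall>i\<in>S.E v. \<forall>Z. Wz i Z \<longrightarrow> (\<forall>x. x \<epsilon> Z \<longrightarrow> x \<epsilon> z)" using v(2) om unfolding bounded_def by blast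
    have nI: "n \<in> I.Om" "n \<in> II" using NN_subset[OF n] I.Om_in by blast+
    have z': "I.E z \<subseteq> I.E W" "I.lep (I.E z) (I.pp (I.E n) (I.E \<kappa>))" using z(2) ln[OF nI(2) z(1)] by blast+
    show "bounded (S.cd (insert j (S.E v)))"
    proof (cases "\<exists>Z. Wz j Z")
      case False
      then have "\<forall>i\<in>insert j (S.E v). \<forall>Z. Wz i Z \<longrightarrow> (\<forall>x. x \<epsilon> Z \<longrightarrow> x \<epsilon> z)" using z(3) by blast
      then show ?thesis
        unfolding bounded_def S_insert(2)[OF jv] using n z(1,2) om by blast
    next
      case True
      then obtain Z where Z: "Wz j Z" by blast
      have ZL: "Z \<in> II" "I.E Z \<subseteq> I.E W" "I.lep (I.E Z) (I.E \<kappa>)" using Wz_LK[OF Z] LK by blast+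
      have m: "I.mset (I.E z)" "I.mset (I.E Z)" "I.mset (I.E \<kappa>)" "I.mset (I.E n)"
        using z(1) ZL(1) \<kappa>I nI(2) by (simp_all add: I.mset_E)
      have mU: "I.mset (I.E z \<union> I.E Z)" using m by blast
      define z1 where "z1 = I.cd (I.E z \<union> I.E Z)"
      have z1: "z1 \<in> II" "I.E z1 = I.E z \<union> I.E Z" using mU by (simp_all add: z1_def)
      \<comment> \<open>In the successor of \<open>n\<close> the new element is \<open>n\<close>
        itself; it indexes the additional copy of \<kappa>, into which \<open>Z\<close> is
        mapped.\<close>
      have "I.lep (I.E z \<union> I.E Z) (I.pp (insert n (I.E n)) (I.E \<kappa>))"
        by (rule I.lep_Un_pp[OF z'(2) ZL(3) nI(2) I.mem_irrefl[OF nI(2)] m(1-4)])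
      then have "related_in mem II ln (I.sc n) z1"
        using nI z'(1) ZL(2) z1 by (simp add: ln)
      moreover have "I.sc n \<epsilon> om" unfolding om sc_eq[OF nI(2), symmetric] using n by simp
      moreover have "\<forall>i\<in>insert j (S.E v). \<forall>Z. Wz i Z \<longrightarrow> (\<forall>x. x \<epsilon> Z \<longrightarrow> x \<epsilon> z1)"
      proof (intro ballI allI impI)
        fix i Z' x assume i: "i \<in> insert j (S.E v)" "Wz i Z'" "x \<epsilon> Z'"
        have "x \<epsilon> z \<or> x \<epsilon> Z"
          using i z(3) Wz_sv[OF jv(1) Z] by blast
        then have "x \<in> I.E z1" using z1(2) I_E_iff z(1) ZL(1) by blast
        then show "x \<epsilon> z1" using I_E_iff[OF z1(1)] by blast
      qed
      ultimately show ?thesis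
        unfolding bounded_def S_insert(2)[OF jv] using z1(1) by blast
    qed
  qed
  obtain ta where ta: "ta \<in> S.E a0" using Ra_sur[OF aa] by blast
  have "S.pr ta S.zero \<in> S.E P0"
    unfolding P0(2) S.pp_iff using ta Fin_zero[OF b0] by blast
  \<comment> \<open>Saturation for the sets of those \<open>y\<close> in \<open>EL\<close> that
    include the set \<open>Z\<close> of index \<open>i\<close>. Finitely many of them have a common
    element, obtained by enlarging the bound \<open>z\<close>, of size at most \<open>l\<close>, to
    size \<open>l\<close> inside \<open>V\<close>.\<close>
  then have "\<exists>y. \<forall>i\<in>S.E P0. y \<epsilon> EL \<and> (\<forall>Z. Wz i Z \<longrightarrow> (\<forall>x. x \<epsilon> Z \<longrightarrow> x \<epsilon> y))"
  proof (rule saturation_finite[OF P0(1), rotated 3])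
    show "U.dfn (\<lambda>_ e. e (Suc 0) \<epsilon> EL \<and> (\<forall>Z. Wz (e 0) Z \<longrightarrow> (\<forall>x. x \<epsilon> Z \<longrightarrow> x \<epsilon> e (Suc 0))))"
      by (intro udfn U.dfn_subst2[OF dWz])
    fix i assume i: "i \<in> S.E P0"
    show "\<exists>G\<in>II. \<forall>y. y \<epsilon> G \<longleftrightarrow> y \<epsilon> EL \<and> (\<forall>Z. Wz i Z \<longrightarrow> (\<forall>x. x \<epsilon> Z \<longrightarrow> x \<epsilon> y))"
    proof (cases "\<exists>Z. Wz i Z")
      case False
      then show ?thesis using EL_II by blast
    next
      case True
      then obtain Z where Z: "Wz i Z" by blast
      have ZI: "Z \<in> II" using Wz_LK[OF Z] LK by blast
      have "I.dfn (\<lambda>_ e. I.E Z \<subseteq> I.E (e 0))" by (intro I.dfn_intros ZI)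
      then obtain G where G: "G \<in> II" "\<forall>y. y \<epsilon> G \<longleftrightarrow> y \<epsilon> EL \<and> I.E Z \<subseteq> I.E y" by (rule I_sep[OF EL_II])
      have "y \<epsilon> G \<longleftrightarrow> y \<epsilon> EL \<and> (\<forall>Z. Wz i Z \<longrightarrow> (\<forall>x. x \<epsilon> Z \<longrightarrow> x \<epsilon> y))" for y
      proof -
        have "(\<forall>Z. Wz i Z \<longrightarrow> (\<forall>x. x \<epsilon> Z \<longrightarrow> x \<epsilon> y)) \<longleftrightarrow> (\<forall>x. x \<epsilon> Z \<longrightarrow> x \<epsilon> y)"
          using Z Wz_sv[OF S.E_in[OF i] Z] by blast
        moreover have "I.E Z \<subseteq> I.E y \<longleftrightarrow> (\<forall>x. x \<epsilon> Z \<longrightarrow> x \<epsilon> y)" if "y \<in> II"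
          using I_E_iff[OF ZI] I_E_iff[OF that] by (simp add: subset_eq Ball_def)
        ultimately show ?thesis using G(2) EL by blast
      qed
      then show ?thesis using G(1) by blast
    qed
  next
    fix v assume v: "v \<in> S.E (Fin P0)"
    obtain n z where n: "n \<in> U.Om" and z: "z \<in> II" "related_in mem II ln n z"
      "\<forall>i\<in>S.E v. \<forall>Z. Wz i Z \<longrightarrow> (\<forall>x. x \<epsilon> Z \<longrightarrow> x \<epsilon> z)" using finite_bound[OF v] om unfolding bounded_def by blast
    have nI: "n \<in> II" using NN_subset[OF n] I.Om_in by blast
    have z': "I.E z \<subseteq> I.E W" "I.lep (I.E z) (I.pp (I.E n) (I.E \<kappa>))" using z(2) ln[OF nI z(1)] by blast+
    have "I.lep (I.E z) (I.E l)" by (rule I.not_less_times_lep[OF l large[OF n] nI \<kappa>I z'(2)])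
    then obtain Y where Y: "I.mset Y" "I.E z \<subseteq> Y" "Y \<subseteq> V" "I.eqp Y (I.E l)"
      using V(3) I.mset_E[OF z(1)] z'(1) by blast
    have "I.cd Y \<epsilon> EL" using EL Y by simp
    moreover have "x \<epsilon> I.cd Y" if "x \<epsilon> z" for x
      using that Y(2) I_E_iff[OF z(1)] mset_I_cd_iff[OF Y(1)] by blast
    ultimately show "\<exists>y. \<forall>i\<in>S.E v. y \<epsilon> EL \<and> (\<forall>Z. Wz i Z \<longrightarrow> (\<forall>x. x \<epsilon> Z \<longrightarrow> x \<epsilon> y))"
      using z(3) by blast
  qed
  then obtain y where y: "\<forall>i\<in>S.E P0. y \<epsilon> EL \<and> (\<forall>Z. Wz i Z \<longrightarrow> (\<forall>x. x \<epsilon> Z \<longrightarrow> x \<epsilon> y))" by (elim exE)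
  have "y \<epsilon> EL" using y \<open>S.pr ta S.zero \<in> S.E P0\<close> by blast
  then have "y \<in> II" "I.eqp (I.E y) (I.E l)" using EL by blast+
  moreover have "x \<epsilon> y" if x: "x \<epsilon> X" for x
  proof -
    obtain a where a: "a \<epsilon> A" "\<forall>t\<in>S.E b0. D a t x" using x X_iff by blast
    obtain t where t: "t \<in> S.E a0" "Ra t a" using Ra_sur[OF a(1)] by blast
    obtain u Z where u: "u \<in> S.E (Fin b0)" "Z \<in> II" "Zd a u Z" "Z \<epsilon> LK" using small[OF a(1)] by blast
    have i: "S.pr t u \<in> S.E P0" unfolding P0(2) S.pp_iff using t(1) u(1) by blast
    have "is_pair_in mem SS t u (S.pr t u)"
      using t(1) u(1) by (simp add: S.is_pair_in_iff S.E_in)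
    then have "Wz (S.pr t u) Z" unfolding Wz_def using t u by blast
    moreover have "x \<epsilon> Z"
    proof -
      have "S.E u \<subseteq> S.E b0" using u(1) Fin_iff[OF b0] by blast
      then show ?thesis using u(3) XW x a(2) unfolding Zd_def by blast
    qed
    ultimately show ?thesis using y i by blast
  qed
  ultimately show ?thesis by blast
qed

section \<open>Spectra and galaxies\<close>

lemma star_Card_iff: "k \<in> star_Card mem st \<longleftrightarrow> I.Card k"
  unfolding star_Card_def using I.is_cardinal_in_iff I.Card_in by blast

lemma star_NN_eq: "star_NN mem st = I.Om"
  unfolding star_NN_def I.Om_def ..

lemma NN_eq: "NN mem = U.Om"
  unfolding NN_def U.Om_def ..

lemma star_times_eq: "star_times mem st n k = I.times n k"
  unfolding star_times_def I.times_def ..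

lemma spectra_subset: "spn mem st X \<union> spv mem st X \<subseteq> star_Card mem st"
  unfolding spn_def spv_def using star_Card_iff I.card_in_props(1) by blast

text \<open>The two hypotheses on spectra concern different cardinals. For two members of the gap it
  can thus be applied in either order, and also to one member taken twice.\<close>

lemma less_multiple_if_not_in_spectra:
  assumes "Sigma_ss_2 mem st X" "\<kappa> \<in> star_Card mem st" "l \<in> star_Card mem st"
    "\<kappa> \<notin> spn mem st X" "l \<notin> spv mem st X"
  shows "\<exists>n\<in>NN mem. l \<in> I.E (star_times mem st n \<kappa>)"
proof (rule ccontr)
  assume "\<not> (\<exists>n\<in>NN mem. l \<in> I.E (star_times mem st n \<kappa>))"
  then have large: "l \<notin> I.E (I.times n \<kappa>)" if "n \<in> U.Om" for n
    using that unfolding NN_eq star_times_eq by blast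
  have \<kappa>: "I.Card \<kappa>" and l: "I.Card l" using assms(2,3) star_Card_iff by blast+
  have no: "\<not> I.eqp (I.E y) (I.E \<kappa>)" if y: "y \<in> II" "\<forall>z. z \<epsilon> y \<longrightarrow> z \<epsilon> X" for y
  proof
    assume "I.eqp (I.E y) (I.E \<kappa>)"
    then have "card_in mem II y = \<kappa>" by (rule I.card_in_eq[OF y(1) \<kappa>])
    moreover have "subset_in mem UNIV y X" using y(2) by (simp add: subset_in_def)
    ultimately have "\<kappa> \<in> spn mem st X" unfolding spn_def using y(1) by blast
    then show False using assms(4) by blast
  qed
  obtain y where y: "y \<in> II" "\<forall>z. z \<epsilon> X \<longrightarrow> z \<epsilon> y" "I.eqp (I.E y) (I.E l)"
    using Sigma_ss_2_cover[OF assms(1) \<kappa> l no large] by blast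
  have "card_in mem II y = l" by (rule I.card_in_eq[OF y(1) l y(3)])
  moreover have "subset_in mem UNIV X y" using y(2) by (simp add: subset_in_def)
  ultimately have "l \<in> spv mem st X" unfolding spv_def using y(1) by blast
  then show False using assms(5) by blast
qed

lemma gap_in_star_NN:
  assumes "Sigma_ss_2 mem st X" "\<kappa> \<in> star_Card mem st" "\<kappa> \<notin> spv mem st X \<union> spn mem st X"
  shows "\<kappa> \<in> star_NN mem st"
proof -
  have *: "\<kappa> \<notin> spn mem st X" "\<kappa> \<notin> spv mem st X" using assms(3) by blast+
  obtain n where n: "n \<in> NN mem" "\<kappa> \<in> I.E (star_times mem st n \<kappa>)"
    using less_multiple_if_not_in_spectra[OF assms(1,2,2) *] by blast
  then show ?thesis
    using I.finite_if_less_multiple assms(2) NN_subset star_Card_iff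
    unfolding NN_eq star_NN_eq star_times_eq by blast
qed

text \<open>The two orders of application correspond to the two halves of the galaxy:
  \<open>l < n \<kappa>\<close> puts \<open>l\<close> into \<open>mult_NN\<close>, and
  \<open>\<kappa> < m l\<close> keeps it out of \<open>div_NN\<close>.\<close>

lemma gap_in_gal:
  assumes X: "Sigma_ss_2 mem st X"
    and \<kappa>: "\<kappa> \<in> star_Card mem st" "\<kappa> \<notin> spv mem st X \<union> spn mem st X"
    and l: "l \<in> star_Card mem st" "l \<notin> spv mem st X \<union> spn mem st X"
  shows "l \<in> gal mem st \<kappa>"
proof -
  have s: "\<kappa> \<notin> spn mem st X" "\<kappa> \<notin> spv mem st X" "l \<notin> spn mem st X" "l \<notin> spv mem st X"
    using \<kappa> l by blast+
  have lN: "l \<in> star_NN mem st" by (rule gap_in_star_NN[OF X l])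
  obtain n where n: "n \<in> NN mem" "l \<in> I.E (star_times mem st n \<kappa>)"
    using less_multiple_if_not_in_spectra[OF X \<kappa>(1) l(1) s(1,4)] by blast
  have "l \<epsilon> star_times mem st n \<kappa>" using n(2) by (simp add: I.E_def)
  then have 1: "l \<in> mult_NN mem st \<kappa>" unfolding mult_NN_def using lN n(1) by blast
  obtain m where m: "m \<in> NN mem" "\<kappa> \<in> I.E (star_times mem st m l)"
    using less_multiple_if_not_in_spectra[OF X l(1) \<kappa>(1) s(3,2)] by blast
  have mI: "m \<in> II" using m(1) NN_subset I.Om_in unfolding NN_eq by blast
  have lI: "l \<in> II" and \<kappa>I: "\<kappa> \<in> II" using l(1) \<kappa>(1) star_Card_iff I.Card_in by blast+
  have t: "I.Card (I.times m l)" "I.eqp (I.pp (I.E m) (I.E l)) (I.E (I.times m l))"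
    using I.times_props[OF mI lI] by blast+
  \<comment> \<open>\<open>div_NN\<close> concerns nonzero multipliers only; \<open>m\<close> is one
    of these, since a product with zero has no elements and \<kappa> lies below
    \<open>m l\<close>.\<close>
  have "nonempty_in mem UNIV m"
  proof (rule ccontr)
    assume "\<not> nonempty_in mem UNIV m"
    then have "I.E m = {}" unfolding nonempty_in_def I.E_def by blast
    then have "I.eqp {} (I.E (I.times m l))" using t(2) by simp
    then have "I.E (I.times m l) = {}" unfolding I.eqp_def I.injrel_def by blast
    then show False using m(2) unfolding star_times_eq by blast
  qed
  moreover have "\<not> star_times mem st m l \<epsilon> \<kappa>"
    using I.mem_asym[OF m(2)] I.in_E_iff I.Card_in[OF t(1)] unfolding star_times_eq by blast
  ultimately have "l \<notin> div_NN mem st \<kappa>" unfolding div_NN_def using m(1) by blast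
  then show ?thesis using 1 unfolding gal_def by blast
qed

end

theorem theorem5p5:
  fixes mem :: "'u \<Rightarrow> 'u \<Rightarrow> bool" and st :: "'u \<Rightarrow> bool"
  assumes "HST mem st"
  shows "(\<forall>X \<kappa>. Delta_ss_2 mem st X \<and> \<kappa> \<in> star_Card mem st \<and>
            \<kappa> \<notin> spv mem st X \<union> spn mem st X \<longrightarrow>
            \<kappa> \<in> star_NN mem st \<and>
            star_Card mem st - (spv mem st X \<union> spn mem st X) \<subseteq> gal mem st \<kappa>) \<and>
         (\<forall>X. Delta_ss_2 mem st X \<and> star_NN mem st \<subseteq> spn mem st X \<longrightarrow>
            spn mem st X \<union> spv mem st X = star_Card mem st)"
proof -
  interpret hst mem st by unfold_locales (rule assms)
  show ?thesis
  proof (intro conjI allI impI)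
    fix X \<kappa> assume a: "Delta_ss_2 mem st X \<and> \<kappa> \<in> star_Card mem st \<and> \<kappa> \<notin> spv mem st X \<union> spn mem st X"
    then have X: "Sigma_ss_2 mem st X" by (simp add: Delta_ss_2_def)
    show "\<kappa> \<in> star_NN mem st" using gap_in_star_NN[OF X] a by blast
    show "star_Card mem st - (spv mem st X \<union> spn mem st X) \<subseteq> gal mem st \<kappa>"
      using gap_in_gal[OF X] a by blast
  next
    fix X assume a: "Delta_ss_2 mem st X \<and> star_NN mem st \<subseteq> spn mem st X"
    then have X: "Sigma_ss_2 mem st X" by (simp add: Delta_ss_2_def)
    show "spn mem st X \<union> spv mem st X = star_Card mem st"
    proof
      \<comment> \<open>A cardinal outside both spectra would be an internal natural number, and
        these belong to \<open>spn\<close> by hypothesis.\<close>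
      show "star_Card mem st \<subseteq> spn mem st X \<union> spv mem st X"
        using gap_in_star_NN[OF X] a by blast
    qed (rule spectra_subset)
  qed
qed

end
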